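(* Let $p_n\to\infty$ with $p_n=o(n)$. Then there exists a constant $C>1$ such that the MMLE $\hat\tau_M$ satisfies $$\inf_{\theta_0\in\Theta[p_n]}P_{\theta_0}\bigl(C^{-1}\tau_n(\tilde p(\theta_0))\le\hat\tau_M\le C\tau_n(\tilde p(\theta_0))\bigr)\to1 .$$
   Context: Model: $Y^n=(Y_1,\dots,Y_n)$ with $Y_i=\theta_{0,i}+\varepsilon_i$, $\varepsilon_i$ i.i.d. $N(0,1)$; $P_{\theta_0}$ is the law of $Y^n$. $\ell_0[p]=\{\theta\in\mathbb R^n:\#\{i:\theta_i\ne0\}\le p\}$ and $\tau_n(p)=(p/n)\sqrt{\log(n/p)}$. Let $\phi$ be the standard normal density and $g_\tau(\theta)=\int_0^\infty\phi\bigl(\frac{\theta}{\lambda\tau}\bigr)\frac1{\lambda\tau}\frac{2}{\pi(1+\lambda^2)}\,d\lambda$ (the horseshoe density). The MMLE is $\hat\tau_M=\arg\max_{\tau\in[1/n,1]}\prod_{i=1}^n\int_{-\infty}^\infty\phi(Y_i-\theta)g_\tau(\theta)\,d\theta$. Excessive-bias restriction: fix constants $A>1$ and $C_s,C_b>0$ (independent of $n$). A vector $\theta_0\in\ell_0[p]$ satisfies it if there is an integer $q\ge1$ (with $q\le n$) such that $$\sum_{i:|\theta_{0,i}|<A\sqrt{2\log(n/q)}}\theta_{0,i}^2\le C_b\,q\log(n/q),\qquad \#\bigl(i:|\theta_{0,i}|\ge A\sqrt{2\log(n/q)}\bigr)\ge\frac q{C_s}.$$ $\Theta[p]$ is the set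 of all such $\theta_0\in\ell_0[p]$, and $\tilde p(\theta_0)=\#\bigl(i:|\theta_{0,i}|\ge A\sqrt{2\log(n/q)}\bigr)$ for the smallest possible $q$.
   Formalization: The excessive-bias restriction is taken with q<n instead of q≤n: for C_s≥1, q=n admits every vector, and θ_0=0 would get p̃=n and τ_n(n)=0, so the event has probability 0. Exactly the vectors whose only admissible q is n are removed. *)

theory Defs
  imports "HOL-Probability.Probability" "HOL-Library.Landau_Symbols"
begin

text \<open>
  Vectors in $R^n$ are extensional functions on \<open>{1..n}\<close>, since the dimension varies
  in the statements.
\<close>

definition data_space :: "nat \<Rightarrow> (nat \<Rightarrow> real) measure" where
  "data_space n = PiM {1..n} (\<lambda>_. borel)"

definition data_law :: "nat \<Rightarrow> (nat \<Rightarrow> real) \<Rightarrow> (nat \<Rightarrow> real) measure" where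
  "data_law n \<theta> = PiM {1..n} (\<lambda>i. density lborel (normal_density (\<theta> i) 1))"

definition nearly_black :: "nat \<Rightarrow> nat \<Rightarrow> (nat \<Rightarrow> real) set" where
  "nearly_black n p = {\<theta> \<in> {1..n} \<rightarrow>\<^sub>E UNIV. card {i \<in> {1..n}. \<theta> i \<noteq> 0} \<le> p}"

definition tau_rate :: "nat \<Rightarrow> nat \<Rightarrow> real" where
  "tau_rate n p = real p / real n * sqrt (ln (real n / real p))"

text \<open>
  The mixture integral diverges at \<open>\<theta> = 0\<close>, where the Lebesgue integral below returns 0. This single
  point does not affect the marginal likelihood.
\<close>

definition horseshoe_density :: "real \<Rightarrow> real \<Rightarrow> real" where
  "horseshoe_density \<tau> \<theta> =
     (LBINT l:{0<..}. std_normal_density (\<theta> / (l * \<tau>)) * (1 / (l * \<tau>)) * (2 / (pi * (1 + l\<^sup>2))))"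

definition marginal_likelihood :: "nat \<Rightarrow> (nat \<Rightarrow> real) \<Rightarrow> real \<Rightarrow> real" where
  "marginal_likelihood n Y \<tau> =
     (\<Prod>i = 1..n. (LBINT \<theta>. std_normal_density (Y i - \<theta>) * horseshoe_density \<tau> \<theta>))"

text \<open>
  Uniqueness of the maximiser is not assumed: an MMLE is any estimator (that is, any measurable
  function of the data, for each sample size) that always selects a maximiser.
\<close>

definition is_MMLE :: "(nat \<Rightarrow> (nat \<Rightarrow> real) \<Rightarrow> real) \<Rightarrow> bool" where
  "is_MMLE T \<longleftrightarrow> (\<forall>n\<ge>1. T n \<in> borel_measurable (data_space n) \<and>
     (\<forall>Y\<in>space (data_space n).
        is_arg_max (marginal_likelihood n Y) (\<lambda>\<tau>. \<tau> \<in> {1 / real n..1}) (T n Y)))"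

definition signal_threshold :: "real \<Rightarrow> nat \<Rightarrow> nat \<Rightarrow> real" where
  "signal_threshold A n q = A * sqrt (2 * ln (real n / real q))"

definition num_signals :: "real \<Rightarrow> nat \<Rightarrow> (nat \<Rightarrow> real) \<Rightarrow> nat \<Rightarrow> nat" where
  "num_signals A n \<theta> q = card {i \<in> {1..n}. \<bar>\<theta> i\<bar> \<ge> signal_threshold A n q}"

text \<open>
  The value \<open>q = n\<close> is excluded. There the threshold and the bound on the sum are both 0, so every
  coordinate, even a zero one, counts as a signal; for \<open>Cs \<ge> 1\<close> the two inequalities then hold for
  all vectors, and \<open>\<theta> = 0\<close> would get \<open>n\<close> signals and the rate \<open>tau_rate n n = 0\<close>. For \<open>Cs < 1\<close>
  no vector satisfies the second inequality with \<open>q = n\<close>, so nothing is lost.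
\<close>

definition excessive_bias_at ::
  "real \<Rightarrow> real \<Rightarrow> real \<Rightarrow> nat \<Rightarrow> (nat \<Rightarrow> real) \<Rightarrow> nat \<Rightarrow> bool" where
  "excessive_bias_at A Cs Cb n \<theta> q \<longleftrightarrow> 1 \<le> q \<and> q < n \<and>
     (\<Sum>i | i \<in> {1..n} \<and> \<bar>\<theta> i\<bar> < signal_threshold A n q. (\<theta> i)\<^sup>2)
       \<le> Cb * real q * ln (real n / real q) \<and>
     real (num_signals A n \<theta> q) \<ge> real q / Cs"

definition Theta :: "real \<Rightarrow> real \<Rightarrow> real \<Rightarrow> nat \<Rightarrow> nat \<Rightarrow> (nat \<Rightarrow> real) set" where
  "Theta A Cs Cb n p = {\<theta> \<in> nearly_black n p. \<exists>q. excessive_bias_at A Cs Cb n \<theta> q}"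

definition p_tilde :: "real \<Rightarrow> real \<Rightarrow> real \<Rightarrow> nat \<Rightarrow> (nat \<Rightarrow> real) \<Rightarrow> nat" where
  "p_tilde A Cs Cb n \<theta> = num_signals A n \<theta> (LEAST q. excessive_bias_at A Cs Cb n \<theta> q)"

end

theory Submission imports Defs "HOL-Real_Asymp.Real_Asymp" begin

text \<open>
  Write $k$ for the number of signals \<open>p_tilde\<close> and $\tau_0 = \tau_n(k)$. An observation $y$ has marginal density
  $\phi(y) R_\tau(y)$, where $R_\tau(y)$ (\<open>hs_lr\<close>) averages the likelihood ratio of $N(0, 1 + s^2)$ to $N(0, 1)$ over a
  half-Cauchy scale $s$ of size $\tau$. As $\tau \to 0$ this ratio is almost linear in $\tau$, namely
  $R_\tau = 1 + \tau (J - 1) + O(\tau^2 J)$ with $J(y)$ (\<open>lr_slope\<close>) of the order $e^{y^2/2}/(1 + y^2)$, so the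
  log-likelihood is concave in $\tau$ up to a negligible error and the score at the single point $\tau_0$
  controls it everywhere below a small power of $k/n$. Under the null the score $\tau (J - 1)/(1 + \tau (J - 1))$
  has mean of exact order $- \tau / \sqrt{\log (1/\tau)}$ and a second moment of smaller order, so by
  Chebyshev's inequality the near-null coordinates contribute about $- (r - 1) k$ to the log-likelihood ratio
  of $r \tau_0$ to $\tau_0$, even when $k$ is bounded. The $O(k)$ large coordinates contribute at most
  $O(k \log r)$ for $r > 1$, and the $k$ signals contribute at most $- c k \log (1/r)$ for $r < 1$; the excessive-bias
  restriction makes the remaining coordinates negligible. Hence every maximiser lies within a constant factor
  of $\tau_0$. For $\tau$ above a small power of $k/n$ the affinity $E \sqrt{R_\tau} \le 1 - c \tau^2$ and a union
  bound over a grid suffice.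
\<close>

section \<open>The marginal likelihood ratio of one observation\<close>

text \<open>The obstacle is that J has mean 1 under the null but no second moment: phi J decays only
  like 1/y^2, so sums of J cannot be controlled by their variance. The score x/(1 + x) with x = tau
  (J - 1) caps J near |y| = sqrt 2 L, where L^2 = log (n/k). The cap removes the tail of 1/y^2, so
  the mean is of order -tau_0/L = -k/n, while the second moment is at most of order (k/n)/sqrt L.
  Chebyshev's inequality then fails with probability of order 1/(k sqrt L), which vanishes even for
  k = 1 because L grows.

  The coordinates are split at exp(-L^2/50) and L/10. The exponents are tied together: moving the
  mean by the null radius must be negligible against exp(-L^2/100), the squared level at which the
  union bound begins; the middle class, of size up to k L^2 exp(L^2/25), must stay harmless although
  a member may contribute tau exp(L^2/8); and noise above 2L/5, of probability about exp(-2 L^2/25),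
  must be rare in it. All estimates hold for large L uniformly in n and theta, since L depends on
  theta through k.\<close>

definition half_cauchy :: "real \<Rightarrow> real \<Rightarrow> real" where
  "half_cauchy \<tau> s = (if 0 < s then 2 / pi * \<tau> / (\<tau>\<^sup>2 + s\<^sup>2) else 0)"

text \<open>Given the scale s, the posterior mean of theta is
  \<open>shrinkage s * y\<close>.\<close>

definition shrinkage :: "real \<Rightarrow> real" where
  "shrinkage s = s\<^sup>2 / (1 + s\<^sup>2)"

definition normal_lr :: "real \<Rightarrow> real \<Rightarrow> real" where
  "normal_lr s y = exp (y\<^sup>2 * shrinkage s / 2) / sqrt (1 + s\<^sup>2)"

definition hs_lr :: "real \<Rightarrow> real \<Rightarrow> real" where
  "hs_lr \<tau> y = (LBINT s. normal_lr s y * half_cauchy \<tau> s)"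

text \<open>Since 1/(1 + s^2) has half-Cauchy mean 1/(1 + tau), \<open>hs_lr \<tau> y\<close> is
  1/(1 + tau) plus the half-Cauchy mean of the remainder \<open>normal_lr s y\<close> - 1/(1 + s^2).
  Replacing tau/(tau^2 + s^2) by its limit form tau/s^2 in the latter gives tau times the integral
  of this function. Subtracting 1/(1 + s^2) rather than 1 keeps the integrand nonnegative.\<close>

definition slope_integrand :: "real \<Rightarrow> real \<Rightarrow> real" where
  "slope_integrand y s = (if 0 < s then 2 / pi * (normal_lr s y - 1 / (1 + s\<^sup>2)) / s\<^sup>2 else 0)"

definition lr_slope :: "real \<Rightarrow> real" where
  "lr_slope y = (LBINT s. slope_integrand y s)"

lemma half_cauchy_measurable [measurable]:
  "(\<lambda>x. half_cauchy \<tau> (f x)) \<in> borel_measurable M" if [measurable]: "f \<in> borel_measurable M"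
  unfolding half_cauchy_def by measurable

lemma shrinkage_measurable [measurable]: "shrinkage \<in> borel_measurable borel"
  unfolding shrinkage_def by measurable

lemma normal_lr_measurable [measurable]:
  "(\<lambda>x. normal_lr (f x) (g x)) \<in> borel_measurable M"
  if [measurable]: "f \<in> borel_measurable M" "g \<in> borel_measurable M"
  unfolding normal_lr_def shrinkage_def by measurable

lemma slope_integrand_measurable [measurable]:
  "(\<lambda>x. slope_integrand (g x) (f x)) \<in> borel_measurable M"
  if [measurable]: "f \<in> borel_measurable M" "g \<in> borel_measurable M"
  unfolding slope_integrand_def by measurable

lemma hs_lr_measurable [measurable]: "hs_lr \<tau> \<in> borel_measurable borel"
  unfolding hs_lr_def by measurable

lemma lr_slope_measurable [measurable]: "lr_slope \<in> borel_measurable borel"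
  unfolding lr_slope_def by measurable

section \<open>The half-Cauchy mixing density and the integrability of the slope\<close>

lemma half_cauchy_nonneg: "0 \<le> half_cauchy \<tau> s" if "0 \<le> \<tau>"
  using that by (simp add: half_cauchy_def)

lemma arctan_scaled_has_derivative:
  assumes "0 < \<tau>"
  shows "((\<lambda>s. arctan (s / \<tau>)) has_real_derivative \<tau> / (\<tau>\<^sup>2 + s\<^sup>2)) (at s)"
proof -
  have "((\<lambda>s. arctan (s / \<tau>)) has_real_derivative inverse (1 + (s / \<tau>)\<^sup>2) * (1 / \<tau>)) (at s)"
    using assms by (auto intro!: derivative_eq_intros)
  also have "inverse (1 + (s / \<tau>)\<^sup>2) * (1 / \<tau>) = \<tau> / (\<tau>\<^sup>2 + s\<^sup>2)"
  proof -
    have "1 + (s / \<tau>)\<^sup>2 = (\<tau>\<^sup>2 + s\<^sup>2) / \<tau>\<^sup>2" using assms by (simp add: power_divide add_divide_distrib)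
    then show ?thesis using assms by (simp add: power2_eq_square)
  qed
  finally show ?thesis .
qed

lemma nn_integral_cauchy_atLeast:
  assumes "0 < \<tau>"
  shows "(\<integral>\<^sup>+s. ennreal (2 / pi * \<tau> / (\<tau>\<^sup>2 + s\<^sup>2)) * indicator {a..} s \<partial>lborel) = 1 - 2 / pi * arctan (a / \<tau>)"
proof -
  have "(\<integral>\<^sup>+s. ennreal (2 / pi * \<tau> / (\<tau>\<^sup>2 + s\<^sup>2)) * indicator {a..} s \<partial>lborel)
      = 2 / pi * (pi / 2) - 2 / pi * arctan (a / \<tau>)"
  proof (rule nn_integral_FTC_atLeast[where F = "\<lambda>s. 2 / pi * arctan (s / \<tau>)"])
    show "((\<lambda>s. 2 / pi * arctan (s / \<tau>)) has_real_derivative 2 / pi * \<tau> / (\<tau>\<^sup>2 + s\<^sup>2)) (at s)" for s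
      using DERIV_cmult[OF arctan_scaled_has_derivative[of \<tau> s], of "2 / pi"] assms by simp
    show "((\<lambda>s. 2 / pi * arctan (s / \<tau>)) \<longlongrightarrow> 2 / pi * (pi / 2)) at_top"
      using assms
      by (intro tendsto_intros filterlim_compose[OF tendsto_arctan_at_top]
          filterlim_at_top_mult_tendsto_pos[of "\<lambda>_. 1/\<tau>" "1/\<tau>", simplified] filterlim_ident) auto
  qed (use assms in \<open>auto intro!: divide_nonneg_nonneg mult_nonneg_nonneg\<close>)
  then show ?thesis by simp
qed

lemma nn_integral_half_cauchy_atLeast:
  assumes "0 < \<tau>" "0 < a"
  shows "(\<integral>\<^sup>+s. ennreal (half_cauchy \<tau> s) * indicator {a..} s \<partial>lborel) = 1 - 2 / pi * arctan (a / \<tau>)"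
  unfolding nn_integral_cauchy_atLeast[OF assms(1), symmetric]
  using assms by (intro nn_integral_cong) (auto simp: half_cauchy_def split: split_indicator)

lemma half_cauchy_integral:
  assumes "0 < \<tau>"
  shows "integrable lborel (half_cauchy \<tau>)" "(LBINT s. half_cauchy \<tau> s) = 1"
proof -
  have "(\<integral>\<^sup>+s. ennreal (half_cauchy \<tau> s) \<partial>lborel)
      = (\<integral>\<^sup>+s. ennreal (2 / pi * \<tau> / (\<tau>\<^sup>2 + s\<^sup>2)) * indicator {0..} s \<partial>lborel)"
    using assms by (intro nn_integral_cong_AE AE_I[where N="{0}"])
      (auto simp: half_cauchy_def split: split_indicator_asm if_splits)
  also have "\<dots> = ennreal 1" using nn_integral_cauchy_atLeast[OF assms, of 0] by simp
  finally have nn: "(\<integral>\<^sup>+s. ennreal (half_cauchy \<tau> s) \<partial>lborel) = ennreal 1" .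
  have "has_bochner_integral lborel (half_cauchy \<tau>) 1"
    by (rule has_bochner_integral_nn_integral) (use nn assms in \<open>auto simp: half_cauchy_nonneg\<close>)
  then show "integrable lborel (half_cauchy \<tau>)" "(LBINT s. half_cauchy \<tau> s) = 1"
    by (auto simp: has_bochner_integral_iff)
qed

lemma inverse_le_inverse_sqrt: "1 / (1 + s\<^sup>2) \<le> 1 / sqrt (1 + s\<^sup>2)" for s :: real
proof -
  have "sqrt (1 + s\<^sup>2) \<le> sqrt ((1 + s\<^sup>2)\<^sup>2)"
    using power_increasing[of 1 2 "1 + s\<^sup>2"] by (intro real_sqrt_le_mono) auto
  then show ?thesis by (simp add: divide_simps)
qed

lemma normal_lr_nonneg [simp]: "0 \<le> normal_lr s y"
  by (simp add: normal_lr_def)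

lemma shrinkage_nonneg: "0 \<le> shrinkage s"
  by (simp add: shrinkage_def)

lemma shrinkage_le_one: "shrinkage s \<le> 1"
  by (simp add: shrinkage_def divide_simps add_pos_nonneg)

lemma shrinkage_compl: "1 / (1 + s\<^sup>2) = 1 - shrinkage s"
  by (simp add: shrinkage_def divide_simps add_nonneg_eq_0_iff)

lemma normal_lr_ge: "1 / (1 + s\<^sup>2) \<le> normal_lr s y"
proof -
  have "1 / (1 + s\<^sup>2) \<le> 1 / sqrt (1 + s\<^sup>2)" by (rule inverse_le_inverse_sqrt)
  also have "\<dots> \<le> normal_lr s y"
    unfolding normal_lr_def by (intro divide_right_mono) (auto simp: shrinkage_nonneg)
  finally show ?thesis .
qed

lemma normal_lr_le_exp: "normal_lr s y \<le> exp (y\<^sup>2 * shrinkage s / 2)"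
proof -
  have "exp (y\<^sup>2 * shrinkage s / 2) / sqrt (1 + s\<^sup>2) \<le> exp (y\<^sup>2 * shrinkage s / 2) / 1"
    by (intro divide_left_mono) (auto simp: add_pos_nonneg)
  then show ?thesis by (simp add: normal_lr_def)
qed

lemma normal_lr_le: "normal_lr s y \<le> exp (y\<^sup>2 / 2)"
proof -
  have "y\<^sup>2 * shrinkage s \<le> y\<^sup>2 * 1"
    by (intro mult_left_mono shrinkage_le_one) auto
  then show ?thesis by (intro order_trans[OF normal_lr_le_exp]) simp
qed

lemma exp_le_one_plus_mult_exp: "exp t \<le> 1 + t * exp t" for t :: real
proof -
  have "1 - t \<le> exp (- t)" using exp_ge_add_one_self[of "-t"] by simp
  then have "(1 - t) * exp t \<le> exp (- t) * exp t" by (intro mult_right_mono) auto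
  also have "\<dots> = 1" by (simp flip: exp_add)
  finally show ?thesis by (simp add: algebra_simps)
qed

text \<open>The factor \<open>shrinkage s\<close> is of order s^2 at 0 and cancels the singularity
  1/s^2 in \<open>slope_integrand\<close>.\<close>

lemma normal_lr_excess_le:
  "normal_lr s y - 1 / (1 + s\<^sup>2)
     \<le> (1 + y\<^sup>2 / 2 * exp (y\<^sup>2 * shrinkage s / 2)) * shrinkage s"
proof -
  have "normal_lr s y \<le> 1 + y\<^sup>2 * shrinkage s / 2 * exp (y\<^sup>2 * shrinkage s / 2)"
    by (rule order_trans[OF normal_lr_le_exp exp_le_one_plus_mult_exp])
  then show ?thesis unfolding shrinkage_compl by (simp add: algebra_simps)
qed

lemma slope_integrand_nonneg: "0 \<le> slope_integrand y s"
  using normal_lr_ge[of s y] by (auto simp: slope_integrand_def intro!: divide_nonneg_nonneg)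

text \<open>The parameter c serves two regimes: c = 1 is allowed for all s and gives integrability,
  while c = 1/2 is allowed for s up to 1 and leaves only the growth exp(y^2/4).\<close>

lemma slope_integrand_le:
  assumes "shrinkage s \<le> c"
  shows "slope_integrand y s \<le> (1 + y\<^sup>2 / 2 * exp (y\<^sup>2 * c / 2)) * half_cauchy 1 s"
proof (cases "0 < s")
  case True
  have "normal_lr s y - 1 / (1 + s\<^sup>2) \<le> (1 + y\<^sup>2 / 2 * exp (y\<^sup>2 * c / 2)) * shrinkage s"
    using assms by (intro order_trans[OF normal_lr_excess_le] mult_right_mono add_left_mono mult_left_mono)
      (auto intro!: mult_left_mono simp: shrinkage_nonneg)
  then have "slope_integrand y s \<le> 2 / pi * ((1 + y\<^sup>2 / 2 * exp (y\<^sup>2 * c / 2)) * shrinkage s) / s\<^sup>2"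
    using True unfolding slope_integrand_def by (simp add: divide_right_mono mult_left_mono)
  also have "\<dots> = (1 + y\<^sup>2 / 2 * exp (y\<^sup>2 * c / 2)) * half_cauchy 1 s"
    using True by (simp add: half_cauchy_def shrinkage_def)
  finally show ?thesis .
qed (simp add: slope_integrand_def half_cauchy_def)

lemma slope_integrand_integrable: "integrable lborel (slope_integrand y)"
proof (rule Bochner_Integration.integrable_bound)
  show "integrable lborel (\<lambda>s. (1 + y\<^sup>2 / 2 * exp (y\<^sup>2 * 1 / 2)) * half_cauchy 1 s)"
    by (intro integrable_mult_right half_cauchy_integral) simp
  show "AE s in lborel. norm (slope_integrand y s) \<le> norm ((1 + y\<^sup>2 / 2 * exp (y\<^sup>2 * 1 / 2)) * half_cauchy 1 s)"
    using slope_integrand_le[OF shrinkage_le_one, of y] slope_integrand_nonneg[of y]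
      order_trans[OF slope_integrand_nonneg slope_integrand_le[OF shrinkage_le_one], of y]
    by auto
qed simp

lemma hs_lr_integrable:
  assumes "0 < \<tau>"
  shows "integrable lborel (\<lambda>s. normal_lr s y * half_cauchy \<tau> s)"
proof (rule Bochner_Integration.integrable_bound)
  show "integrable lborel (\<lambda>s. exp (y\<^sup>2 / 2) * half_cauchy \<tau> s)"
    using assms by (intro integrable_mult_right half_cauchy_integral) simp
  show "AE s in lborel. norm (normal_lr s y * half_cauchy \<tau> s) \<le> norm (exp (y\<^sup>2 / 2) * half_cauchy \<tau> s)"
    using assms normal_lr_le[of _ y] half_cauchy_nonneg[of \<tau>] by (auto simp: abs_mult intro!: mult_right_mono)
qed simp

section \<open>Linear expansion of the likelihood ratio and the size of its slope\<close>

lemma lr_slope_nonneg: "0 \<le> lr_slope y"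
  unfolding lr_slope_def by (intro integral_nonneg_AE AE_I2 slope_integrand_nonneg)

text \<open>For each s the quotient \<open>half_cauchy \<tau> s / \<tau>\<close> decreases in tau.
  The resulting bound is uniform in y, so it serves coordinates of any size.\<close>

lemma hs_lr_scale:
  assumes "0 < \<tau>'" "\<tau>' \<le> \<tau>"
  shows "hs_lr \<tau> y \<le> \<tau> / \<tau>' * hs_lr \<tau>' y"
proof -
  have "half_cauchy \<tau> s \<le> \<tau> / \<tau>' * half_cauchy \<tau>' s" for s
  proof (cases "0 < s")
    case True
    have "1 / (\<tau>\<^sup>2 + s\<^sup>2) \<le> 1 / (\<tau>'\<^sup>2 + s\<^sup>2)"
      using assms True by (intro divide_left_mono add_right_mono power_mono) (auto intro!: mult_pos_pos add_pos_pos)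
    then have "2 / pi * \<tau> * (1 / (\<tau>\<^sup>2 + s\<^sup>2)) \<le> 2 / pi * \<tau> * (1 / (\<tau>'\<^sup>2 + s\<^sup>2))"
      using assms by (intro mult_left_mono) auto
    then show ?thesis using True assms by (simp add: half_cauchy_def mult.commute)
  qed (simp add: half_cauchy_def)
  then have "normal_lr s y * half_cauchy \<tau> s \<le> \<tau> / \<tau>' * (normal_lr s y * half_cauchy \<tau>' s)" for s
    using mult_left_mono[of "half_cauchy \<tau> s" "\<tau> / \<tau>' * half_cauchy \<tau>' s" "normal_lr s y"] by (simp add: mult_ac)
  then have "hs_lr \<tau> y \<le> (LBINT s. \<tau> / \<tau>' * (normal_lr s y * half_cauchy \<tau>' s))"
    unfolding hs_lr_def using assms
    by (intro integral_mono hs_lr_integrable integrable_mult_right) auto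
  then show ?thesis unfolding hs_lr_def by simp
qed

lemma hs_lr_upper:
  assumes "0 < \<tau>"
  shows "hs_lr \<tau> y \<le> 1 - \<tau> + \<tau>\<^sup>2 + \<tau> * lr_slope y"
proof -
  have "normal_lr s y * half_cauchy \<tau> s
      \<le> half_cauchy \<tau> s - \<tau> * half_cauchy 1 s + \<tau>\<^sup>2 * half_cauchy \<tau> s + \<tau> * slope_integrand y s" for s
  proof (cases "0 < s")
    case True
    define a where "a = 2 / pi * \<tau>"
    define e where "e = normal_lr s y - 1 / (1 + s\<^sup>2)"
    have pos: "0 < s\<^sup>2" "0 < 1 + s\<^sup>2" "0 < \<tau>\<^sup>2 + s\<^sup>2" "0 < a" using True assms by (auto simp: a_def add_pos_nonneg add_nonneg_pos)
    have e: "0 \<le> e" using normal_lr_ge[of s y] by (simp add: e_def)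
    have "e * a / (\<tau>\<^sup>2 + s\<^sup>2) \<le> e * a / s\<^sup>2"
      using e pos by (intro divide_left_mono) auto
    \<comment> \<open>A pointwise form of 1/(1 + tau) <= 1 - tau + tau^2, so that only half-Cauchy
      masses have to be integrated.\<close>
    moreover have "1 / (1 + s\<^sup>2) * (a / (\<tau>\<^sup>2 + s\<^sup>2)) \<le> a / (\<tau>\<^sup>2 + s\<^sup>2) - a / (1 + s\<^sup>2) + \<tau>\<^sup>2 * (a / (\<tau>\<^sup>2 + s\<^sup>2))"
    proof -
      have "a / (\<tau>\<^sup>2 + s\<^sup>2) - a / (1 + s\<^sup>2) + \<tau>\<^sup>2 * (a / (\<tau>\<^sup>2 + s\<^sup>2)) - 1 / (1 + s\<^sup>2) * (a / (\<tau>\<^sup>2 + s\<^sup>2))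
        = a * (\<tau>\<^sup>2 * s\<^sup>2) / ((1 + s\<^sup>2) * (\<tau>\<^sup>2 + s\<^sup>2))"
        using pos by (simp add: divide_simps) (simp add: algebra_simps power2_eq_square)
      also have "\<dots> \<ge> 0" using pos by auto
      finally show ?thesis by simp
    qed
    moreover have "normal_lr s y * half_cauchy \<tau> s = e * a / (\<tau>\<^sup>2 + s\<^sup>2) + 1 / (1 + s\<^sup>2) * (a / (\<tau>\<^sup>2 + s\<^sup>2))"
      using True by (simp add: e_def a_def half_cauchy_def algebra_simps add_divide_distrib diff_divide_distrib)
    moreover have "\<tau> * slope_integrand y s = e * a / s\<^sup>2" "\<tau> * half_cauchy 1 s = a / (1 + s\<^sup>2)"
        "half_cauchy \<tau> s = a / (\<tau>\<^sup>2 + s\<^sup>2)"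
      using True by (simp_all add: slope_integrand_def e_def a_def half_cauchy_def)
    ultimately show ?thesis by simp
  qed (simp add: half_cauchy_def slope_integrand_def)
  then have "hs_lr \<tau> y \<le> (LBINT s. half_cauchy \<tau> s - \<tau> * half_cauchy 1 s + \<tau>\<^sup>2 * half_cauchy \<tau> s + \<tau> * slope_integrand y s)"
    unfolding hs_lr_def using assms
    by (intro integral_mono hs_lr_integrable integrable_mult_right Bochner_Integration.integrable_add
        Bochner_Integration.integrable_diff half_cauchy_integral slope_integrand_integrable) auto
  also have "\<dots> = 1 - \<tau> + \<tau>\<^sup>2 + \<tau> * lr_slope y"
    using assms by (simp add: half_cauchy_integral slope_integrand_integrable lr_slope_def)
  finally show ?thesis .
qed

text \<open>Scales between a and 2a, with a of the order of 1 + |y|, suffice: there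
  \<open>y\<^sup>2 * shrinkage s\<close> is within 1 of y^2, and the integrand is of order
  exp(y^2/2)/a^3 on an interval of length a.\<close>

lemma lr_slope_lower: "exp (y\<^sup>2 / 2) / (1000 * (1 + y\<^sup>2)) \<le> lr_slope y"
proof -
  \<comment> \<open>The 3 makes sqrt(1 + s^2) at least 2, so that the subtracted 1/(1 + s^2) is at
    most half of \<open>normal_lr s y\<close>.\<close>
  define a where "a = sqrt (3 + y\<^sup>2)"
  have a2: "a\<^sup>2 = 3 + y\<^sup>2" by (simp add: a_def add_nonneg_nonneg)
  have a: "0 < a" by (simp add: a_def add_pos_nonneg)
  define c where "c = exp (y\<^sup>2 / 2) / (36 * pi * a ^ 3) * (1/2)"
  have c0: "0 \<le> c" using a by (simp add: c_def)
  have pt: "c * indicator {a..2 * a} s \<le> slope_integrand y s" for s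
  proof (cases "s \<in> {a..2 * a}")
    case True
    then have s: "a \<le> s" "s \<le> 2 * a" "0 < s" using a by auto
    have s2: "a\<^sup>2 \<le> s\<^sup>2" "s\<^sup>2 \<le> 4 * a\<^sup>2"
      using s a power_mono[of a s 2] power_mono[of s "2*a" 2] by (auto simp: power_mult_distrib)
    define q where "q = sqrt (1 + s\<^sup>2)"
    have q2: "q\<^sup>2 = 1 + s\<^sup>2" by (simp add: q_def add_nonneg_nonneg)
    have "3 \<le> s\<^sup>2" using s2 a2 zero_le_power2[of y] by linarith
    then have q4: "2 \<le> q" unfolding q_def by (intro real_le_rsqrt) auto
    have "1 + s\<^sup>2 \<le> 9 * a\<^sup>2" using s2 a2 zero_le_power2[of y] by linarith
    then have q9: "q \<le> 3 * a" unfolding q_def using a by (intro real_le_lsqrt) (auto simp: power_mult_distrib)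
    have "y\<^sup>2 * shrinkage s = y\<^sup>2 - y\<^sup>2 / (1 + s\<^sup>2)"
      by (simp add: shrinkage_def divide_simps add_nonneg_eq_0_iff) (simp add: algebra_simps)
    moreover have "y\<^sup>2 / (1 + s\<^sup>2) \<le> 1" using s2 a2 by (simp add: divide_simps add_pos_nonneg)
    ultimately have "y\<^sup>2 / 2 - 1 / 2 \<le> y\<^sup>2 * shrinkage s / 2" by simp
    then have ex: "exp (y\<^sup>2 / 2 - 1 / 2) \<le> exp (y\<^sup>2 * shrinkage s / 2)" by simp
    have "1 / q\<^sup>2 \<le> 1 / q * (1 / 2)" using q4 by (simp add: divide_simps power2_eq_square)
    also have "\<dots> \<le> 1 / q * (normal_lr s y * q / 2)"
    proof -
      have "1 \<le> exp (y\<^sup>2 * shrinkage s / 2)" by (simp add: shrinkage_nonneg)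
      then show ?thesis using q4 by (simp add: normal_lr_def flip: q_def) (simp add: divide_simps)
    qed
    finally have "1 / (1 + s\<^sup>2) \<le> normal_lr s y / 2" using q4 q2 by simp
    then have half: "normal_lr s y / 2 \<le> normal_lr s y - 1 / (1 + s\<^sup>2)" by simp
    have e12: "(1::real) / 2 \<le> exp (- (1 / 2))" using exp_ge_add_one_self[of "-1/2"] by simp
    have "exp (y\<^sup>2 / 2) * (1 / 2) / (3 * a) \<le> exp (y\<^sup>2 / 2) * exp (- (1/2)) / q"
      using q4 q9 a e12 by (intro frac_le mult_left_mono) auto
    also have "\<dots> = exp (y\<^sup>2 / 2 - 1 / 2) / q" by (simp flip: exp_add)
    also have "\<dots> \<le> normal_lr s y" unfolding normal_lr_def q_def using ex by (intro divide_right_mono) auto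
    finally have lr: "exp (y\<^sup>2 / 2) / (12 * a) \<le> normal_lr s y / 2" by (simp add: field_simps)
    have "c * 1 \<le> 2 / pi * (exp (y\<^sup>2 / 2) / (12 * a)) / (4 * a\<^sup>2)"
      using a by (simp add: c_def divide_simps power2_eq_square power3_eq_cube)
    also have "\<dots> \<le> 2 / pi * (normal_lr s y - 1 / (1 + s\<^sup>2)) / s\<^sup>2"
      using a s2 s order_trans[OF lr half] normal_lr_ge[of s y]
      by (intro frac_le mult_left_mono mult_nonneg_nonneg) auto
    finally show ?thesis using True s by (simp add: slope_integrand_def)
  qed (use slope_integrand_nonneg in auto)
  have "c * a = (LBINT s. c * indicator {a..2 * a} s)" using a by simp
  also have "\<dots> \<le> lr_slope y" unfolding lr_slope_def
    using pt slope_integrand_integrable a by (intro integral_mono) auto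
  finally have 1: "c * a \<le> lr_slope y" .
  have "exp (y\<^sup>2 / 2) / (1000 * (1 + y\<^sup>2)) \<le> c * a"
  proof -
    have eq: "c * a = exp (y\<^sup>2 / 2) / (72 * pi * a\<^sup>2)" using a by (simp add: c_def divide_simps power2_eq_square power3_eq_cube)
    have "72 * pi * a\<^sup>2 \<le> 288 * (3 * (1 + y\<^sup>2))"
      using a2 pi_less_4 by (intro mult_mono) auto
    also have "\<dots> = 864 * (1 + y\<^sup>2)" by simp
    also have "\<dots> \<le> 1000 * (1 + y\<^sup>2)" by (intro mult_right_mono) auto
    finally have "72 * pi * a\<^sup>2 \<le> 1000 * (1 + y\<^sup>2)" .
    then show ?thesis unfolding eq using a sum_power2_gt_zero_iff[of 1 y] by (intro divide_left_mono mult_pos_pos) simp_all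
  qed
  with 1 show ?thesis by simp
qed

lemma one_plus_le_exp: "1 + t \<le> 8 * exp (t / 8)" for t :: real
  using exp_ge_add_one_self[of "t / 8"] by linarith

text \<open>The left side is the factor that scales up to 1 produce in
  \<open>slope_integrand_le\<close>; it is dominated by the true order of the slope. The 40 is (1 +
  4) * 8, each polynomial factor being traded for exp(y^2/8) by
  \<open>one_plus_le_exp\<close>.\<close>

lemma small_scale_le: "1 + y\<^sup>2 / 2 * exp (y\<^sup>2 / 4) \<le> 40 * (exp (y\<^sup>2 / 2) / (1 + y\<^sup>2))" for y :: real
proof -
  define t where "t = y\<^sup>2"
  have t: "0 \<le> t" by (simp add: t_def)
  have "(1 + t / 2 * exp (t / 4)) * (1 + t) \<le> (exp (3 * t / 8) + 4 * exp (t / 8) * exp (t / 4)) * (8 * exp (t / 8))"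
  proof (intro mult_mono add_mono)
    show "t / 2 \<le> 4 * exp (t / 8)" using one_plus_le_exp[of t] by simp
  qed (use t one_plus_le_exp[of t] in auto)
  also have "\<dots> = 40 * exp (t / 2)" by (simp add: algebra_simps flip: exp_add)
  finally have "1 + t / 2 * exp (t / 4) \<le> 40 * exp (t / 2) / (1 + t)" using t by (simp add: pos_le_divide_eq)
  then show ?thesis by (simp add: t_def)
qed

text \<open>Replacing tau^2 + s^2 by s^2 in the denominator costs a relative error tau^2/(tau^2 +
  s^2). For s >= 1 this is at most tau^2, which gives the cubic term; for s < 1 the excess of
  \<open>normal_lr\<close> divided by s^2 is at most \<open>Q\<close>, and the half-Cauchy mass 1
  gives Q tau^2.\<close>

lemma hs_lr_lower:
  assumes "0 < \<tau>"
  shows "1 - \<tau> + \<tau> * lr_slope y - (\<tau> ^ 3 + 40000 * \<tau>\<^sup>2) * lr_slope y \<le> hs_lr \<tau> y"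
proof -
  define Q where "Q = 1 + y\<^sup>2 / 2 * exp (y\<^sup>2 / 4)"
  have "half_cauchy \<tau> s - \<tau> * half_cauchy 1 s + \<tau> * slope_integrand y s
      - (\<tau> ^ 3 * slope_integrand y s + Q * \<tau>\<^sup>2 * half_cauchy \<tau> s) \<le> normal_lr s y * half_cauchy \<tau> s" for s
  proof (cases "0 < s")
    case True
    define a where "a = 2 / pi * \<tau>"
    define e where "e = normal_lr s y - 1 / (1 + s\<^sup>2)"
    define d where "d = \<tau>\<^sup>2 + s\<^sup>2"
    have pos: "0 < s\<^sup>2" "0 < 1 + s\<^sup>2" "0 < d" "0 < a" "0 < pi" using True assms by (auto simp: a_def d_def add_pos_nonneg add_nonneg_pos)
    have e: "0 \<le> e" using normal_lr_ge[of s y] by (simp add: e_def)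
    have Q: "0 \<le> Q" by (simp add: Q_def)
    have "a / d - a / (1 + s\<^sup>2) \<le> 1 / (1 + s\<^sup>2) * (a / d)"
    proof -
      have "1 / (1 + s\<^sup>2) * (a / d) - (a / d - a / (1 + s\<^sup>2)) = a * \<tau>\<^sup>2 / ((1 + s\<^sup>2) * d)"
        using pos by (simp add: divide_simps) (simp add: d_def algebra_simps power2_eq_square)
      also have "\<dots> \<ge> 0" using pos by auto
      finally show ?thesis by simp
    qed
    moreover have "e * a / s\<^sup>2 - e * a / d = e * a * \<tau>\<^sup>2 / (s\<^sup>2 * d)"
      using pos by (simp add: divide_simps) (simp add: d_def algebra_simps)
    moreover have "e * a * \<tau>\<^sup>2 / (s\<^sup>2 * d) \<le> \<tau>\<^sup>2 * (e * a / s\<^sup>2) + Q * \<tau>\<^sup>2 * (a / d)"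
    proof (cases "1 \<le> s")
      case True
      then have "1 \<le> d" using one_le_power[of s 2] by (simp add: d_def add_increasing)
      then have "e * a * \<tau>\<^sup>2 / (s\<^sup>2 * d) \<le> e * a * \<tau>\<^sup>2 / (s\<^sup>2 * 1)"
        using pos e by (intro divide_left_mono mult_left_mono) auto
      moreover have "0 \<le> Q * \<tau>\<^sup>2 * (a / d)" using Q pos by auto
      ultimately show ?thesis by (simp add: mult.commute)
    next
      case False
      have "shrinkage s \<le> 1 / 2" using False True power_le_one[of s 2]
        by (simp add: shrinkage_def divide_simps add_pos_nonneg)
      from slope_integrand_le[OF this, of y]
      have "2 / pi * e / s\<^sup>2 \<le> Q * half_cauchy 1 s" using True
        by (simp add: slope_integrand_def e_def Q_def)
      also have "\<dots> \<le> Q * (2 / pi)" using True Q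
        by (intro mult_left_mono) (auto simp: half_cauchy_def divide_simps add_pos_nonneg)
      finally have "e / s\<^sup>2 \<le> Q" using pos by (simp add: field_simps)
      then have "e / s\<^sup>2 * (\<tau>\<^sup>2 * (a / d)) \<le> Q * (\<tau>\<^sup>2 * (a / d))"
        using pos by (intro mult_right_mono) auto
      moreover have "0 \<le> \<tau>\<^sup>2 * (e * a / s\<^sup>2)" using e pos by auto
      ultimately show ?thesis by (simp add: mult_ac)
    qed
    moreover have "normal_lr s y * half_cauchy \<tau> s = e * a / d + 1 / (1 + s\<^sup>2) * (a / d)"
      using True by (simp add: e_def a_def d_def half_cauchy_def algebra_simps add_divide_distrib diff_divide_distrib)
    moreover have "\<tau> * slope_integrand y s = e * a / s\<^sup>2" "\<tau> * half_cauchy 1 s = a / (1 + s\<^sup>2)"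
        "half_cauchy \<tau> s = a / d"
      using True by (simp_all add: slope_integrand_def e_def a_def d_def half_cauchy_def)
    moreover have "\<tau> ^ 3 * slope_integrand y s = \<tau>\<^sup>2 * (e * a / s\<^sup>2)"
      using calculation(5) by (simp add: power3_eq_cube power2_eq_square mult.assoc)
    ultimately show ?thesis by simp
  qed (simp add: half_cauchy_def slope_integrand_def)
  then have "(LBINT s. half_cauchy \<tau> s - \<tau> * half_cauchy 1 s + \<tau> * slope_integrand y s
      - (\<tau> ^ 3 * slope_integrand y s + Q * \<tau>\<^sup>2 * half_cauchy \<tau> s)) \<le> hs_lr \<tau> y"
    unfolding hs_lr_def using assms
    by (intro integral_mono hs_lr_integrable integrable_mult_right Bochner_Integration.integrable_add
        Bochner_Integration.integrable_diff half_cauchy_integral slope_integrand_integrable) auto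
  also have "(LBINT s. half_cauchy \<tau> s - \<tau> * half_cauchy 1 s + \<tau> * slope_integrand y s
      - (\<tau> ^ 3 * slope_integrand y s + Q * \<tau>\<^sup>2 * half_cauchy \<tau> s))
     = 1 - \<tau> + \<tau> * lr_slope y - (\<tau> ^ 3 * lr_slope y + Q * \<tau>\<^sup>2)"
    using assms by (simp add: half_cauchy_integral slope_integrand_integrable lr_slope_def)
  finally have 1: "1 - \<tau> + \<tau> * lr_slope y - (\<tau> ^ 3 * lr_slope y + Q * \<tau>\<^sup>2) \<le> hs_lr \<tau> y" .
  \<comment> \<open>40000 is 40 * 1000, from \<open>small_scale_le\<close> and
    \<open>lr_slope_lower\<close>.\<close>
  have "Q \<le> 40000 * lr_slope y"
  proof -
    define E where "E = exp (y\<^sup>2 / 2) / (1 + y\<^sup>2)"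
    have eq: "exp (y\<^sup>2 / 2) / (1000 * (1 + y\<^sup>2)) = E / 1000" by (simp add: E_def)
    have "E / 1000 \<le> lr_slope y" using lr_slope_lower[of y] unfolding eq .
    moreover have "Q \<le> 40 * E" using small_scale_le[of y] by (simp add: Q_def E_def)
    ultimately show ?thesis by linarith
  qed
  then have "Q * \<tau>\<^sup>2 \<le> 40000 * lr_slope y * \<tau>\<^sup>2" by (intro mult_right_mono) auto
  with 1 show ?thesis by (simp add: algebra_simps)
qed

text \<open>For |y| > 1 the scales below 1 contribute at most \<open>Q\<close>, and those above 1 at
  most the integral of \<open>g\<close>, which is an exact derivative: (2/y^2) exp(-y^2/(4 s^2)) has
  derivative s^(-3) exp(-y^2/(4 s^2)).\<close>

lemma lr_slope_upper: "lr_slope y \<le> 60 * (exp (y\<^sup>2 / 2) / (1 + y\<^sup>2))"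
proof (cases "\<bar>y\<bar> \<le> 1")
  case True
  then have y: "y\<^sup>2 \<le> 1" by (simp add: abs_square_le_1)
  have "lr_slope y \<le> (LBINT s. (1 + y\<^sup>2 / 2 * exp (y\<^sup>2 * 1 / 2)) * half_cauchy 1 s)"
    unfolding lr_slope_def by (intro integral_mono slope_integrand_integrable integrable_mult_right
      half_cauchy_integral slope_integrand_le shrinkage_le_one) auto
  also have "\<dots> = 1 + y\<^sup>2 / 2 * exp (y\<^sup>2 / 2)" by (simp add: half_cauchy_integral)
  also have "\<dots> \<le> exp (y\<^sup>2 / 2) + 1 / 2 * exp (y\<^sup>2 / 2)"
    using y by (intro add_mono mult_right_mono) auto
  also have "\<dots> \<le> 60 * (exp (y\<^sup>2 / 2) / 2)" by simp
  also have "\<dots> \<le> 60 * (exp (y\<^sup>2 / 2) / (1 + y\<^sup>2))"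
    using y by (intro mult_left_mono divide_left_mono) (auto simp: add_pos_nonneg)
  finally show ?thesis .
next
  case False
  then have y: "1 \<le> y\<^sup>2" using abs_square_le_1[of y] by simp
  define Q where "Q = 1 + y\<^sup>2 / 2 * exp (y\<^sup>2 / 4)"
  define g where "g s = exp (y\<^sup>2 / 2) * (s powr (- 3) * exp (- y\<^sup>2 / (4 * s\<^sup>2)))" for s :: real
  have pt: "slope_integrand y s \<le> Q * half_cauchy 1 s + g s * indicator {1..} s" for s
  proof (cases "1 \<le> s")
    case True
    then have s: "0 < s" "1 \<le> s\<^sup>2" by auto
    have "slope_integrand y s \<le> 2 / pi * normal_lr s y / s\<^sup>2"
      using s unfolding slope_integrand_def by (auto intro!: divide_right_mono mult_left_mono)
    also have "\<dots> \<le> 1 * normal_lr s y / s\<^sup>2"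
      using pi_gt3 by (intro divide_right_mono mult_right_mono) auto
    also have "\<dots> \<le> g s"
    proof -
      have "y\<^sup>2 / (4 * s\<^sup>2) \<le> y\<^sup>2 * (1 / (1 + s\<^sup>2)) / 2"
        using s by (simp add: divide_simps mult_left_mono add_pos_nonneg)
      then have "exp (y\<^sup>2 * shrinkage s / 2) \<le> exp (y\<^sup>2 / 2 + - y\<^sup>2 / (4 * s\<^sup>2))"
        unfolding shrinkage_compl by (simp add: algebra_simps diff_divide_distrib)
      moreover have "s \<le> sqrt (1 + s\<^sup>2)" using s by (intro real_le_rsqrt) auto
      ultimately have "normal_lr s y \<le> exp (y\<^sup>2 / 2 + - y\<^sup>2 / (4 * s\<^sup>2)) / s"
        unfolding normal_lr_def using s by (intro frac_le) auto
      then have "normal_lr s y / s\<^sup>2 \<le> exp (y\<^sup>2 / 2 + - y\<^sup>2 / (4 * s\<^sup>2)) / s / s\<^sup>2"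
        by (intro divide_right_mono) auto
      also have "\<dots> = g s" unfolding g_def exp_add using s
        by (simp add: powr_minus field_simps power3_eq_cube power2_eq_square)
      finally show ?thesis by simp
    qed
    moreover have "0 \<le> Q * half_cauchy 1 s" by (simp add: Q_def half_cauchy_nonneg)
    ultimately show ?thesis using True by simp
  next
    case False
    then have "slope_integrand y s \<le> Q * half_cauchy 1 s"
    proof (cases "0 < s")
      case True
      then have "shrinkage s \<le> 1 / 2" using False power_le_one[of s 2]
        by (simp add: shrinkage_def divide_simps add_pos_nonneg)
      from slope_integrand_le[OF this, of y] show ?thesis by (simp add: Q_def)
    qed (simp add: slope_integrand_def half_cauchy_def)
    then show ?thesis using False by simp
  qed
  have g: "has_bochner_integral lborel (\<lambda>s. g s * indicator {1..} s) (exp (y\<^sup>2 / 2) * (2 / y\<^sup>2) * (1 - exp (- y\<^sup>2 / 4)))"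
  proof (rule has_bochner_integral_nn_integral)
    have "(\<integral>\<^sup>+s. ennreal (g s * indicator {1..} s) \<partial>lborel) = (\<integral>\<^sup>+s. ennreal (g s) * indicator {1..} s \<partial>lborel)"
      by (intro nn_integral_cong) (auto split: split_indicator)
    also have "\<dots> = ennreal (exp (y\<^sup>2 / 2) * (2 / y\<^sup>2 * exp 0)
        - exp (y\<^sup>2 / 2) * (2 / y\<^sup>2 * exp (- y\<^sup>2 / (4 * 1\<^sup>2))))"
    proof (rule nn_integral_FTC_atLeast[where F = "\<lambda>s. exp (y\<^sup>2 / 2) * (2 / y\<^sup>2 * exp (- y\<^sup>2 / (4 * s\<^sup>2)))"])
      fix s :: real assume "1 \<le> s"
      then show "((\<lambda>s. exp (y\<^sup>2 / 2) * (2 / y\<^sup>2 * exp (- y\<^sup>2 / (4 * s\<^sup>2)))) has_real_derivative g s) (at s)"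
        using y unfolding g_def
        by (auto intro!: derivative_eq_intros simp: powr_minus field_simps power2_eq_square power3_eq_cube power4_eq_xxxx)
      show "0 \<le> g s" by (simp add: g_def)
    next
      have "((\<lambda>s::real. - y\<^sup>2 / (4 * s\<^sup>2)) \<longlongrightarrow> 0) at_top" by real_asymp
      then show "((\<lambda>s. exp (y\<^sup>2 / 2) * (2 / y\<^sup>2 * exp (- y\<^sup>2 / (4 * s\<^sup>2)))) \<longlongrightarrow> exp (y\<^sup>2 / 2) * (2 / y\<^sup>2 * exp 0)) at_top"
        by (intro tendsto_intros)
    qed (simp add: g_def)
    finally show "(\<integral>\<^sup>+s. ennreal (g s * indicator {1..} s) \<partial>lborel)
       = ennreal (exp (y\<^sup>2 / 2) * (2 / y\<^sup>2) * (1 - exp (- y\<^sup>2 / 4)))" by (simp add: right_diff_distrib mult.assoc)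
  qed (auto simp: g_def)
  have "lr_slope y \<le> (LBINT s. Q * half_cauchy 1 s + g s * indicator {1..} s)"
    unfolding lr_slope_def using pt g
    by (intro integral_mono slope_integrand_integrable integrable_mult_right Bochner_Integration.integrable_add
      half_cauchy_integral) (auto simp: has_bochner_integral_iff)
  also have "\<dots> = Q + exp (y\<^sup>2 / 2) * (2 / y\<^sup>2) * (1 - exp (- y\<^sup>2 / 4))"
    using g by (subst Bochner_Integration.integral_add) (auto simp: has_bochner_integral_iff half_cauchy_integral)
  also have "\<dots> \<le> 40 * (exp (y\<^sup>2 / 2) / (1 + y\<^sup>2)) + exp (y\<^sup>2 / 2) * (4 / (1 + y\<^sup>2)) * 1"
    using y small_scale_le[of y]
    by (intro add_mono mult_mono) (auto simp: Q_def divide_simps add_pos_nonneg)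
  also have "\<dots> \<le> 60 * (exp (y\<^sup>2 / 2) / (1 + y\<^sup>2))" by (simp add: divide_simps add_pos_nonneg)
  finally show ?thesis .
qed

section \<open>The marginal density as a normal scale mixture\<close>

lemma std_normal_times_normal_lr:
  "std_normal_density y * normal_lr s y = normal_density 0 (sqrt (1 + s\<^sup>2)) y"
proof -
  have "- y\<^sup>2 / 2 + y\<^sup>2 * shrinkage s / 2 = - (y\<^sup>2 * (1 / (1 + s\<^sup>2)) / 2)"
    unfolding shrinkage_compl by (simp add: algebra_simps diff_divide_distrib)
  then have "exp (- y\<^sup>2 / 2) * exp (y\<^sup>2 * shrinkage s / 2) = exp (- (y\<^sup>2 * (1 / (1 + s\<^sup>2)) / 2))"
    by (simp flip: exp_add)
  then show ?thesis
    by (simp add: std_normal_density_def normal_lr_def normal_density_def add_nonneg_nonneg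
        ac_simps flip: real_sqrt_mult)
qed

lemma nn_hs_lr:
  assumes "0 < \<tau>"
  shows "ennreal (hs_lr \<tau> y) = (\<integral>\<^sup>+s. ennreal (normal_lr s y * half_cauchy \<tau> s) \<partial>lborel)"
  unfolding hs_lr_def using assms
  by (intro nn_integral_eq_integral[symmetric] hs_lr_integrable) (auto simp: half_cauchy_nonneg)

lemma hs_lr_nonneg: "0 < \<tau> \<Longrightarrow> 0 \<le> hs_lr \<tau> y"
  unfolding hs_lr_def by (intro integral_nonneg_AE AE_I2) (simp add: half_cauchy_nonneg)

lemma hs_lr_mean:
  assumes "0 < \<tau>"
  shows "has_bochner_integral lborel (\<lambda>y. std_normal_density y * hs_lr \<tau> y) 1"
proof (rule has_bochner_integral_nn_integral)
  have "(\<integral>\<^sup>+y. ennreal (std_normal_density y * hs_lr \<tau> y) \<partial>lborel)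
      = (\<integral>\<^sup>+y. \<integral>\<^sup>+s. ennreal (std_normal_density y) * ennreal (normal_lr s y * half_cauchy \<tau> s) \<partial>lborel \<partial>lborel)"
    using assms by (intro nn_integral_cong)
      (simp add: ennreal_mult' hs_lr_nonneg nn_hs_lr nn_integral_cmult)
  also have "\<dots> = (\<integral>\<^sup>+s. \<integral>\<^sup>+y. ennreal (std_normal_density y) * ennreal (normal_lr s y * half_cauchy \<tau> s) \<partial>lborel \<partial>lborel)"
    by (rule lborel_pair.Fubini') measurable
  also have "\<dots> = (\<integral>\<^sup>+s. \<integral>\<^sup>+y. ennreal (half_cauchy \<tau> s) * ennreal (normal_density 0 (sqrt (1 + s\<^sup>2)) y) \<partial>lborel \<partial>lborel)"
    using assms by (intro nn_integral_cong)
      (simp add: half_cauchy_nonneg mult_ac flip: ennreal_mult' std_normal_times_normal_lr)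
  also have "\<dots> = (\<integral>\<^sup>+s. ennreal (half_cauchy \<tau> s) \<partial>lborel)"
  proof (intro nn_integral_cong)
    fix s :: real
    have "0 < sqrt (1 + s\<^sup>2)" by (simp add: add_pos_nonneg)
    then have "(\<integral>\<^sup>+y. ennreal (normal_density 0 (sqrt (1 + s\<^sup>2)) y) \<partial>lborel) = ennreal 1"
      by (subst nn_integral_eq_integral) auto
    then show "(\<integral>\<^sup>+y. ennreal (half_cauchy \<tau> s) * ennreal (normal_density 0 (sqrt (1 + s\<^sup>2)) y) \<partial>lborel) = ennreal (half_cauchy \<tau> s)"
      by (simp add: nn_integral_cmult)
  qed
  also have "\<dots> = ennreal 1"
    using assms half_cauchy_integral[OF assms]
    by (subst nn_integral_eq_integral) (auto simp: half_cauchy_nonneg)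
  finally show "(\<integral>\<^sup>+y. ennreal (std_normal_density y * hs_lr \<tau> y) \<partial>lborel) = ennreal 1" .
qed (use assms in \<open>auto simp: hs_lr_nonneg\<close>)

text \<open>For |y| <= 1/2 widening the normal density only lowers it: with kappa =
  \<open>shrinkage s\<close>, the factor sqrt(1 - kappa) <= exp(-kappa/2) beats exp(kappa/8). Scales
  s >= 1 lose a factor 9/10 and have half-Cauchy mass at least tau/2, whence tau/20. This separates
  the likelihood ratio from 1 on a set of fixed probability.\<close>

lemma hs_lr_center:
  assumes "0 < \<tau>" "\<tau> \<le> 1" "\<bar>y\<bar> \<le> 1 / 2"
  shows "hs_lr \<tau> y \<le> 1 - \<tau> / 20"
proof -
  have y: "y\<^sup>2 \<le> 1 / 4" using abs_le_square_iff[of y "1/2"] assms by (simp add: power_divide)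
  have lr: "normal_lr s y \<le> exp (- (3 / 8 * shrinkage s))" for s
  proof -
    have "1 + s\<^sup>2 = 1 / (1 - shrinkage s)" by (simp flip: shrinkage_compl)
    have w: "0 < 1 / (1 + s\<^sup>2)" by (simp add: add_pos_nonneg)
    have "1 / (1 + s\<^sup>2) \<le> exp (- shrinkage s)"
      unfolding shrinkage_compl using exp_ge_add_one_self[of "- shrinkage s"] by simp
    then have "sqrt (1 / (1 + s\<^sup>2)) \<le> sqrt (exp (- shrinkage s))" by simp
    also have "\<dots> = exp (- shrinkage s / 2)"
      by (rule real_sqrt_unique) (auto simp flip: exp_double)
    finally have "1 / sqrt (1 + s\<^sup>2) \<le> exp (- shrinkage s / 2)" by (simp add: real_sqrt_divide)
    moreover have "exp (y\<^sup>2 * shrinkage s / 2) \<le> exp (1 / 4 * shrinkage s / 2)"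
      using mult_right_mono[OF y shrinkage_nonneg[of s]] by (simp add: mult_ac)
    ultimately have "exp (y\<^sup>2 * shrinkage s / 2) * (1 / sqrt (1 + s\<^sup>2)) \<le> exp (1 / 4 * shrinkage s / 2) * exp (- shrinkage s / 2)"
      by (intro mult_mono) auto
    also have "\<dots> = exp (- (3 / 8 * shrinkage s))" by (simp flip: exp_add)
    finally show ?thesis by (simp add: normal_lr_def)
  qed
  have pt: "normal_lr s y * half_cauchy \<tau> s \<le> half_cauchy \<tau> s - 1 / 10 * (\<tau> * (half_cauchy 1 s * indicator {1..} s))" for s
  proof (cases "1 \<le> s")
    case True
    then have s: "1 \<le> s\<^sup>2" "0 < s" by auto
    have "1 / 2 \<le> shrinkage s" using s by (simp add: shrinkage_def divide_simps add_pos_nonneg)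
    then have "normal_lr s y \<le> exp (- (3 / 16))" by (intro order_trans[OF lr]) simp
    also have "\<dots> \<le> 9 / 10"
    proof -
      have "(10::real) / 9 \<le> exp (3 / 16)" using exp_ge_add_one_self[of "3/16 :: real"] by simp
      then show ?thesis by (simp add: exp_minus divide_simps)
    qed
    finally have "normal_lr s y * half_cauchy \<tau> s \<le> 9 / 10 * half_cauchy \<tau> s"
      using assms by (intro mult_right_mono) (auto simp: half_cauchy_nonneg)
    moreover have "\<tau> * half_cauchy 1 s \<le> half_cauchy \<tau> s"
    proof -
      have "2 / pi * \<tau> / (1 + s\<^sup>2) \<le> 2 / pi * \<tau> / (\<tau>\<^sup>2 + s\<^sup>2)"
        using assms s power_le_one[of \<tau> 2] by (intro divide_left_mono) (auto intro!: mult_pos_pos add_pos_pos)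
      then show ?thesis using s assms by (simp add: half_cauchy_def mult.commute)
    qed
    ultimately show ?thesis using True by simp
  next
    case False
    have "normal_lr s y * half_cauchy \<tau> s \<le> 1 * half_cauchy \<tau> s"
      using assms by (intro mult_right_mono order_trans[OF lr]) (auto simp: half_cauchy_nonneg shrinkage_nonneg)
    then show ?thesis using False by simp
  qed
  have tail: "has_bochner_integral lborel (\<lambda>s. half_cauchy 1 s * indicator {1..} s) (1 / 2)"
  proof (rule has_bochner_integral_nn_integral)
    have "(\<integral>\<^sup>+s. ennreal (half_cauchy 1 s * indicator {1..} s) \<partial>lborel) = (\<integral>\<^sup>+s. ennreal (half_cauchy 1 s) * indicator {1..} s \<partial>lborel)"
      by (intro nn_integral_cong) (auto split: split_indicator)
    also have "\<dots> = ennreal (1 / 2)"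
      by (subst nn_integral_half_cauchy_atLeast) (auto simp: arctan_one)
    finally show "(\<integral>\<^sup>+s. ennreal (half_cauchy 1 s * indicator {1..} s) \<partial>lborel) = ennreal (1 / 2)" .
  qed (auto simp: half_cauchy_nonneg)
  have "hs_lr \<tau> y \<le> (LBINT s. half_cauchy \<tau> s - 1 / 10 * (\<tau> * (half_cauchy 1 s * indicator {1..} s)))"
    unfolding hs_lr_def using pt assms tail
    by (intro integral_mono hs_lr_integrable integrable_mult_right Bochner_Integration.integrable_diff
      half_cauchy_integral) (auto simp: has_bochner_integral_iff)
  also have "\<dots> = 1 - \<tau> / 20"
    using tail assms by (subst Bochner_Integration.integral_diff) (auto simp: has_bochner_integral_iff half_cauchy_integral)
  finally show ?thesis .
qed

text \<open>With s = tau lambda the horseshoe density is the half-Cauchy mixture of N(0, s^2), and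
  convolution with the noise turns this into N(0, 1 + s^2).\<close>

lemma horseshoe_marginal:
  assumes "0 < \<tau>"
  shows "(LBINT \<theta>. std_normal_density (y - \<theta>) * horseshoe_density \<tau> \<theta>) = std_normal_density y * hs_lr \<tau> y"
proof -
  define G where "G \<theta> l = (if 0 < l then normal_density 0 (l * \<tau>) \<theta> * half_cauchy 1 l else 0)" for \<theta> l
  have G0: "0 \<le> G \<theta> l" for \<theta> l by (simp add: G_def half_cauchy_nonneg)
  have [measurable]: "(\<lambda>(\<theta>, l). G \<theta> l) \<in> borel_measurable (lborel \<Otimes>\<^sub>M lborel)"
    unfolding G_def normal_density_def by measurable
  have [measurable]: "(\<lambda>l. G \<theta> l) \<in> borel_measurable lborel" "(\<lambda>\<theta>. G \<theta> l) \<in> borel_measurable lborel" for \<theta> l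
    unfolding G_def normal_density_def by measurable
  define I where "I \<theta> = (\<integral>\<^sup>+l. ennreal (G \<theta> l) \<partial>lborel)" for \<theta>
  have [measurable]: "I \<in> borel_measurable lborel" unfolding I_def by measurable
  \<comment> \<open>The inner integral \<open>I\<close> is infinite at theta = 0, where
    \<open>enn2real\<close> and the Lebesgue integral both return 0.\<close>
  have hs: "horseshoe_density \<tau> \<theta> = enn2real (I \<theta>)" for \<theta>
  proof -
    have "horseshoe_density \<tau> \<theta> = (LBINT l. G \<theta> l)"
      unfolding horseshoe_density_def set_lebesgue_integral_def
    proof (intro Bochner_Integration.integral_cong refl)
      fix l :: real
      have "std_normal_density (\<theta> / (l * \<tau>)) * (1 / (l * \<tau>)) = normal_density 0 (l * \<tau>) \<theta>" if "0 < l"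
        using that assms by (simp add: normal_density_def power_divide real_sqrt_mult)
      then have "0 < l \<Longrightarrow> std_normal_density (\<theta> / (l * \<tau>)) * (1 / (l * \<tau>)) * (2 / (pi * (1 + l\<^sup>2)))
        = normal_density 0 (l * \<tau>) \<theta> * (2 / (pi * (1 + l\<^sup>2)))" by metis
      then show "indicat_real {0<..} l *\<^sub>R (std_normal_density (\<theta> / (l * \<tau>)) * (1 / (l * \<tau>)) * (2 / (pi * (1 + l\<^sup>2)))) = G \<theta> l"
        by (simp add: G_def half_cauchy_def)
    qed
    then show ?thesis unfolding I_def using G0 by (subst (asm) integral_eq_nn_integral) auto
  qed
  have "(\<integral>\<^sup>+\<theta>. ennreal (std_normal_density (y - \<theta>)) * I \<theta> \<partial>lborel)
     = (\<integral>\<^sup>+\<theta>. \<integral>\<^sup>+l. ennreal (std_normal_density (y - \<theta>)) * ennreal (G \<theta> l) \<partial>lborel \<partial>lborel)"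
    unfolding I_def by (intro nn_integral_cong) (simp add: nn_integral_cmult)
  also have "\<dots> = (\<integral>\<^sup>+l. \<integral>\<^sup>+\<theta>. ennreal (std_normal_density (y - \<theta>)) * ennreal (G \<theta> l) \<partial>lborel \<partial>lborel)"
    by (rule lborel_pair.Fubini') measurable
  also have "\<dots> = (\<integral>\<^sup>+l. ennreal (std_normal_density y) * (ennreal \<tau> * ennreal (normal_lr (0 + \<tau> * l) y * half_cauchy \<tau> (0 + \<tau> * l))) \<partial>lborel)"
  proof (intro nn_integral_cong)
    fix l :: real
    show "(\<integral>\<^sup>+\<theta>. ennreal (std_normal_density (y - \<theta>)) * ennreal (G \<theta> l) \<partial>lborel)
       = ennreal (std_normal_density y) * (ennreal \<tau> * ennreal (normal_lr (0 + \<tau> * l) y * half_cauchy \<tau> (0 + \<tau> * l)))"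
    proof (cases "0 < l")
      case True
      have "(\<integral>\<^sup>+\<theta>. ennreal (std_normal_density (y - \<theta>)) * ennreal (G \<theta> l) \<partial>lborel)
         = (\<integral>\<^sup>+\<theta>. ennreal (half_cauchy 1 l) * ennreal (normal_density 0 1 (y - \<theta>) * normal_density 0 (l * \<tau>) \<theta>) \<partial>lborel)"
        using True by (intro nn_integral_cong) (simp add: G_def half_cauchy_nonneg mult_ac flip: ennreal_mult')
      also have "\<dots> = ennreal (half_cauchy 1 l) * ennreal (normal_density 0 (sqrt (1 + (l * \<tau>)\<^sup>2)) y)"
        using True assms fun_cong[OF conv_normal_density_zero_mean[of 1 "l * \<tau>"], of y]
        by (simp add: nn_integral_cmult)
      also have "half_cauchy 1 l = \<tau> * half_cauchy \<tau> (\<tau> * l)"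
      proof -
        have "\<tau>\<^sup>2 + (\<tau> * l)\<^sup>2 = \<tau>\<^sup>2 * (1 + l\<^sup>2)" by (simp add: algebra_simps power_mult_distrib)
        then show ?thesis using True assms by (simp add: half_cauchy_def power2_eq_square[of \<tau>])
      qed
      finally show ?thesis using assms
        by (simp add: half_cauchy_nonneg mult_ac flip: ennreal_mult' std_normal_times_normal_lr)
    qed (use assms in \<open>auto simp: G_def half_cauchy_def zero_less_mult_iff\<close>)
  qed
  also have "\<dots> = ennreal (std_normal_density y) * (ennreal \<tau> * (\<integral>\<^sup>+l. ennreal (normal_lr (0 + \<tau> * l) y * half_cauchy \<tau> (0 + \<tau> * l)) \<partial>lborel))"
    by (simp add: nn_integral_cmult)
  also have "ennreal \<tau> * (\<integral>\<^sup>+l. ennreal (normal_lr (0 + \<tau> * l) y * half_cauchy \<tau> (0 + \<tau> * l)) \<partial>lborel) = ennreal (hs_lr \<tau> y)"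
    using assms by (subst nn_hs_lr) (auto simp: nn_integral_real_affine[of "\<lambda>s. ennreal (normal_lr s y * half_cauchy \<tau> s)" \<tau> 0])
  finally have T: "(\<integral>\<^sup>+\<theta>. ennreal (std_normal_density (y - \<theta>)) * I \<theta> \<partial>lborel) = ennreal (std_normal_density y * hs_lr \<tau> y)"
    using assms by (simp add: ennreal_mult' hs_lr_nonneg)
  \<comment> \<open>A positive Gaussian weight times \<open>I\<close> has a finite integral, so
    \<open>I\<close> is finite almost everywhere and \<open>enn2real\<close> loses nothing.\<close>
  have "AE \<theta> in lborel. ennreal (std_normal_density (y - \<theta>)) * I \<theta> \<noteq> \<infinity>"
    by (rule nn_integral_noteq_infinite) (auto simp: T)
  then have fin: "AE \<theta> in lborel. ennreal (std_normal_density (y - \<theta>) * enn2real (I \<theta>)) = ennreal (std_normal_density (y - \<theta>)) * I \<theta>"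
  proof eventually_elim
    case (elim \<theta>)
    have "0 < std_normal_density (y - \<theta>)" by (rule normal_density_pos) simp
    then have "I \<theta> \<noteq> \<infinity>" using elim by (auto simp: ennreal_mult_top)
    then show ?case by (simp add: ennreal_mult' less_top)
  qed
  have "(LBINT \<theta>. std_normal_density (y - \<theta>) * horseshoe_density \<tau> \<theta>)
    = enn2real (\<integral>\<^sup>+\<theta>. ennreal (std_normal_density (y - \<theta>) * enn2real (I \<theta>)) \<partial>lborel)"
    unfolding hs by (rule integral_eq_nn_integral) auto
  also have "\<dots> = std_normal_density y * hs_lr \<tau> y"
    using assms by (subst nn_integral_cong_AE[OF fin]) (simp add: T hs_lr_nonneg)
  finally show ?thesis .
qed

section \<open>The score under the null\<close>

abbreviation normal_mean :: "real \<Rightarrow> (real \<Rightarrow> real) \<Rightarrow> real" where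
  "normal_mean \<mu> g \<equiv> (LBINT y. normal_density \<mu> 1 y * g y)"

section \<open>The mean of the slope\<close>

lemma integrable_inverse_square: "integrable lborel (\<lambda>y::real. 1 / (1 + y\<^sup>2))"
proof (rule integrable_cong_AE_imp)
  show "integrable lborel (\<lambda>y. pi / 2 * (half_cauchy 1 y + half_cauchy 1 (0 + -1 * y)))"
    by (intro integrable_mult_right Bochner_Integration.integrable_add half_cauchy_integral
      lborel_integrable_real_affine) auto
  show "AE y in lborel. pi / 2 * (half_cauchy 1 y + half_cauchy 1 (0 + -1 * y)) = 1 / (1 + y\<^sup>2)"
    by (rule AE_I[where N="{0}"]) (auto simp: half_cauchy_def split: if_splits)
qed simp

lemma std_normal_density_le: "std_normal_density y \<le> 1 / 2 * exp (- y\<^sup>2 / 2)"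
proof -
  have "2 \<le> sqrt (2 * pi)" using pi_gt3 by (intro real_le_rsqrt) auto
  then have "1 / sqrt (2 * pi) \<le> 1 / 2" by (simp add: divide_simps)
  then show ?thesis unfolding std_normal_density_def by (intro mult_right_mono) auto
qed

lemma std_normal_density_nonneg [simp]: "0 \<le> std_normal_density y"
  by simp

text \<open>The exponentials cancel and a Cauchy tail remains, just light enough for a mean.\<close>

lemma density_lr_slope_le: "std_normal_density y * lr_slope y \<le> 30 * (1 / (1 + y\<^sup>2))"
proof -
  have "std_normal_density y * lr_slope y \<le> 1 / 2 * exp (- y\<^sup>2 / 2) * (60 * (exp (y\<^sup>2 / 2) / (1 + y\<^sup>2)))"
    by (intro mult_mono std_normal_density_le lr_slope_upper) (auto simp: lr_slope_nonneg)
  also have "\<dots> = 30 * (exp (- y\<^sup>2 / 2) * exp (y\<^sup>2 / 2) / (1 + y\<^sup>2))" by simp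
  also have "exp (- y\<^sup>2 / 2) * exp (y\<^sup>2 / 2) = 1" by (simp flip: exp_add)
  finally show ?thesis by simp
qed

lemma lr_slope_integrable: "integrable lborel (\<lambda>y. std_normal_density y * lr_slope y)"
proof (rule Bochner_Integration.integrable_bound)
  show "integrable lborel (\<lambda>y::real. 30 * (1 / (1 + y\<^sup>2)))"
    by (intro integrable_mult_right integrable_inverse_square)
  show "AE y in lborel. norm (std_normal_density y * lr_slope y) \<le> norm (30 * (1 / (1 + y\<^sup>2)))"
    using density_lr_slope_le by (auto simp: lr_slope_nonneg abs_mult)
qed simp

text \<open>
  The mean is read off from \<open>hs_lr_mean\<close> and the two linear bounds as \<open>\<tau>\<close> tends to 0, which avoids a
  second application of Fubini's theorem.
\<close>

lemma lr_slope_mean: "normal_mean 0 lr_slope = 1"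
proof -
  define m where "m = normal_mean 0 lr_slope"
  have lin: "normal_mean 0 (\<lambda>y. (a + b * lr_slope y)) = a + b * m"
    "integrable lborel (\<lambda>y. std_normal_density y * (a + b * lr_slope y))" for a b
  proof -
    have eq: "(\<lambda>y. std_normal_density y * (a + b * lr_slope y))
       = (\<lambda>y. a * std_normal_density y + b * (std_normal_density y * lr_slope y))" by (simp add: algebra_simps)
    show "integrable lborel (\<lambda>y. std_normal_density y * (a + b * lr_slope y))"
      unfolding eq by (intro Bochner_Integration.integrable_add integrable_mult_right lr_slope_integrable) simp
    show "normal_mean 0 (\<lambda>y. (a + b * lr_slope y)) = a + b * m"
      unfolding eq m_def by (subst Bochner_Integration.integral_add) (auto simp: lr_slope_integrable)
  qed
  have lo: "1 \<le> 1 - \<tau> + \<tau>\<^sup>2 + \<tau> * m" and hi: "1 - \<tau> + (\<tau> - (\<tau> ^ 3 + 40000 * \<tau>\<^sup>2)) * m \<le> 1" if "0 < \<tau>" for \<tau>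
  proof -
    have R: "integrable lborel (\<lambda>y. std_normal_density y * hs_lr \<tau> y)"
       "normal_mean 0 (hs_lr \<tau>) = 1"
      using hs_lr_mean[OF that] by (auto simp: has_bochner_integral_iff)
    have "normal_mean 0 (hs_lr \<tau>)
      \<le> normal_mean 0 (\<lambda>y. ((1 - \<tau> + \<tau>\<^sup>2) + \<tau> * lr_slope y))"
      using hs_lr_upper[OF that] by (intro integral_mono R lin mult_left_mono) auto
    then show "1 \<le> 1 - \<tau> + \<tau>\<^sup>2 + \<tau> * m" unfolding R lin .
    have "normal_mean 0 (\<lambda>y. ((1 - \<tau>) + (\<tau> - (\<tau> ^ 3 + 40000 * \<tau>\<^sup>2)) * lr_slope y))
      \<le> normal_mean 0 (hs_lr \<tau>)"
      using hs_lr_lower[OF that] by (intro integral_mono R lin mult_left_mono) (auto simp: algebra_simps)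
    then show "1 - \<tau> + (\<tau> - (\<tau> ^ 3 + 40000 * \<tau>\<^sup>2)) * m \<le> 1" unfolding R lin .
  qed
  have lo': "1 - \<tau> \<le> m" if "0 < \<tau>" for \<tau>
  proof -
    have "\<tau> * (1 - \<tau>) \<le> \<tau> * m" using lo[OF that] by (simp add: algebra_simps power2_eq_square)
    then show ?thesis using that by simp
  qed
  have hi': "(1 - (\<tau>\<^sup>2 + 40000 * \<tau>)) * m \<le> 1" if "0 < \<tau>" for \<tau>
  proof -
    have "\<tau> * ((1 - (\<tau>\<^sup>2 + 40000 * \<tau>)) * m) \<le> \<tau> * 1"
      using hi[OF that] by (simp add: algebra_simps power2_eq_square power3_eq_cube)
    then show ?thesis using that by (simp only: mult_le_cancel_left_pos)
  qed
  have "1 \<le> m"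
  proof (rule tendsto_upperbound)
    show "((\<lambda>\<tau>::real. 1 - \<tau>) \<longlongrightarrow> 1) (at_right 0)" by real_asymp
    show "\<forall>\<^sub>F \<tau> in at_right 0. 1 - \<tau> \<le> m" using lo' by (auto simp: eventually_at_filter)
  qed simp
  moreover have "m \<le> 1"
  proof (rule tendsto_upperbound)
    have "((\<lambda>\<tau>::real. 1 - (\<tau>\<^sup>2 + 40000 * \<tau>)) \<longlongrightarrow> 1) (at_right 0)" by real_asymp
    then show "((\<lambda>\<tau>::real. (1 - (\<tau>\<^sup>2 + 40000 * \<tau>)) * m) \<longlongrightarrow> m) (at_right 0)"
      using tendsto_mult_right[of _ 1 _ m] by fastforce
    show "\<forall>\<^sub>F \<tau> in at_right 0. (1 - (\<tau>\<^sup>2 + 40000 * \<tau>)) * m \<le> 1" using hi' by (auto simp: eventually_at_filter)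
  qed simp
  ultimately show ?thesis by (simp add: m_def)
qed

section \<open>The linearised likelihood ratio and its score\<close>

definition linear_lr :: "real \<Rightarrow> real \<Rightarrow> real" where
  "linear_lr \<tau> y = 1 - \<tau> + \<tau> * lr_slope y"

text \<open>This is tau times the derivative in tau of the logarithm of
  \<open>linear_lr \<tau> y\<close>.\<close>

definition score :: "real \<Rightarrow> real \<Rightarrow> real" where
  "score \<tau> y = \<tau> * (lr_slope y - 1) / linear_lr \<tau> y"

text \<open>The relative error in \<open>hs_lr_ge_linear\<close>; 50000 absorbs the 40000 + tau of
  \<open>hs_lr_lower\<close>. Being relative, it is at most 50000 tau for every y, because tau J
  does not exceed \<open>linear_lr\<close>.\<close>

definition lr_error :: "real \<Rightarrow> real \<Rightarrow> real" where
  "lr_error \<tau> y = 50000 * \<tau>\<^sup>2 * lr_slope y / linear_lr \<tau> y"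

lemma linear_lr_measurable [measurable]: "linear_lr \<tau> \<in> borel_measurable borel"
  unfolding linear_lr_def by measurable

lemma score_measurable [measurable]: "score \<tau> \<in> borel_measurable borel"
  unfolding score_def by measurable

lemma lr_error_measurable [measurable]: "lr_error \<tau> \<in> borel_measurable borel"
  unfolding lr_error_def by measurable

context
  fixes \<tau> :: real
  assumes \<tau>: "0 < \<tau>" "\<tau> \<le> 1 / 2"
begin

lemma linear_lr_ge: "1 / 2 \<le> linear_lr \<tau> y"
proof -
  have "0 \<le> \<tau> * lr_slope y" using \<tau> lr_slope_nonneg by simp
  then show ?thesis using \<tau> by (simp add: linear_lr_def)
qed

lemma linear_lr_pos: "0 < linear_lr \<tau> y"
  using linear_lr_ge[of y] by simp

lemma score_le_one: "score \<tau> y \<le> 1"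
  unfolding score_def using linear_lr_pos[of y] by (simp add: linear_lr_def algebra_simps)

lemma abs_score_le: "\<bar>score \<tau> y\<bar> \<le> 2 * \<tau> * \<bar>lr_slope y - 1\<bar>"
proof -
  have "\<bar>score \<tau> y\<bar> = \<tau> * \<bar>lr_slope y - 1\<bar> / linear_lr \<tau> y"
    unfolding score_def using linear_lr_pos[of y] \<tau> by (simp add: abs_mult)
  also have "\<dots> \<le> \<tau> * \<bar>lr_slope y - 1\<bar> / (1 / 2)"
    using linear_lr_ge[of y] \<tau> by (intro divide_left_mono) auto
  finally show ?thesis by simp
qed

text \<open>The score is x/(1 + x) with x = tau (J - 1) >= -1/2. Its boundedness admits
  second-moment arguments although J has no variance.\<close>

lemma abs_score_le_one: "\<bar>score \<tau> y\<bar> \<le> 1"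
proof (cases "1 \<le> lr_slope y")
  case True
  then have "0 \<le> score \<tau> y" unfolding score_def using linear_lr_pos[of y] \<tau> by simp
  then show ?thesis using score_le_one[of y] by simp
next
  case False
  then have "2 * \<tau> * \<bar>lr_slope y - 1\<bar> \<le> 1 * 1" using \<tau> lr_slope_nonneg[of y] by (intro mult_mono) auto
  then show ?thesis using abs_score_le[of y] by simp
qed

lemma lr_error_nonneg: "0 \<le> lr_error \<tau> y"
  unfolding lr_error_def using linear_lr_pos[of y] lr_slope_nonneg[of y] by simp

lemma lr_error_le: "lr_error \<tau> y \<le> 50000 * \<tau>"
proof -
  have "\<tau> * lr_slope y \<le> linear_lr \<tau> y" using \<tau> by (simp add: linear_lr_def)
  then have "\<tau> * lr_slope y / linear_lr \<tau> y \<le> 1" using linear_lr_pos[of y] by simp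
  then have "50000 * \<tau> * (\<tau> * lr_slope y / linear_lr \<tau> y) \<le> 50000 * \<tau> * 1"
    using \<tau> by (intro mult_left_mono) auto
  then show ?thesis by (simp add: lr_error_def power2_eq_square mult.assoc)
qed

lemma lr_error_le_slope: "lr_error \<tau> y \<le> 100000 * \<tau>\<^sup>2 * lr_slope y"
proof -
  have "50000 * \<tau>\<^sup>2 * lr_slope y / linear_lr \<tau> y \<le> 50000 * \<tau>\<^sup>2 * lr_slope y / (1 / 2)"
    using linear_lr_ge[of y] \<tau> lr_slope_nonneg[of y] by (intro divide_left_mono) auto
  then show ?thesis by (simp add: lr_error_def)
qed

lemma hs_lr_le_linear: "hs_lr \<tau> y \<le> linear_lr \<tau> y + \<tau>\<^sup>2"
  using hs_lr_upper[of \<tau> y] \<tau> by (simp add: linear_lr_def)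

lemma hs_lr_ge_linear: "linear_lr \<tau> y * (1 - lr_error \<tau> y) \<le> hs_lr \<tau> y"
proof -
  have "\<tau> ^ 3 \<le> \<tau>\<^sup>2" using \<tau> by (intro power_decreasing) auto
  then have "(\<tau> ^ 3 + 40000 * \<tau>\<^sup>2) * lr_slope y \<le> 50000 * \<tau>\<^sup>2 * lr_slope y"
    using lr_slope_nonneg[of y] zero_le_power2[of \<tau>] by (intro mult_right_mono) linarith+
  moreover have "linear_lr \<tau> y * lr_error \<tau> y = 50000 * \<tau>\<^sup>2 * lr_slope y"
    using linear_lr_pos[of y] by (simp add: lr_error_def)
  ultimately show ?thesis using hs_lr_lower[OF \<tau>(1), of y] by (simp add: linear_lr_def algebra_simps)
qed

end

section \<open>Gaussian tails and shifts of the mean\<close>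

lemma gaussian_tail:
  assumes "0 \<le> w"
  shows "normal_mean \<theta> (indicator {y. w < \<bar>y - \<theta>\<bar>}) \<le> 2 * exp (- w\<^sup>2 / 2)"
proof -
  \<comment> \<open>For y beyond theta + w the cross term in (y - theta)^2 = (y - theta - w)^2 + 2w
    (y - theta - w) + w^2 is nonnegative, so the density is at most exp(-w^2/2) times the one
    centred at theta + w; symmetrically below theta - w.\<close>
  have pt: "normal_density \<theta> 1 y * indicator {y. w < \<bar>y - \<theta>\<bar>} y
     \<le> exp (- w\<^sup>2 / 2) * (normal_density (\<theta> + w) 1 y + normal_density (\<theta> - w) 1 y)" for y
  proof (cases "w < \<bar>y - \<theta>\<bar>")
    case True
    define e where "e = (if \<theta> < y then \<theta> + w else \<theta> - w)"
    have "(y - e)\<^sup>2 + w\<^sup>2 \<le> (y - \<theta>)\<^sup>2"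
    proof (cases "\<theta> < y")
      case T: True
      then have "w * w \<le> w * (y - \<theta>)" using assms True by (intro mult_left_mono) auto
      then show ?thesis using T by (simp add: e_def power2_eq_square algebra_simps)
    next
      case F: False
      then have "w * w \<le> w * (\<theta> - y)" using assms True by (intro mult_left_mono) auto
      then show ?thesis using F by (simp add: e_def power2_eq_square algebra_simps)
    qed
    then have "exp (- (y - \<theta>)\<^sup>2 / 2) \<le> exp (- w\<^sup>2 / 2 + - (y - e)\<^sup>2 / 2)" by simp
    then have "normal_density \<theta> 1 y \<le> exp (- w\<^sup>2 / 2) * normal_density e 1 y"
      unfolding exp_add by (simp add: normal_density_def divide_right_mono)
    also have "\<dots> \<le> exp (- w\<^sup>2 / 2) * (normal_density (\<theta> + w) 1 y + normal_density (\<theta> - w) 1 y)"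
      by (intro mult_left_mono) (auto simp: e_def)
    finally show ?thesis using True by simp
  qed simp
  have "normal_mean \<theta> (indicator {y. w < \<bar>y - \<theta>\<bar>})
     \<le> (LBINT y. exp (- w\<^sup>2 / 2) * (normal_density (\<theta> + w) 1 y + normal_density (\<theta> - w) 1 y))"
    using pt by (intro integral_mono integrable_mult_right Bochner_Integration.integrable_add
        integrable_real_mult_indicator) auto
  then show ?thesis by simp
qed

lemma normal_density_bounded_integrable:
  assumes [measurable]: "g \<in> borel_measurable borel" and "\<And>y. \<bar>g y\<bar> \<le> B"
  shows "integrable lborel (\<lambda>y. normal_density \<theta> 1 y * g y)"
proof (rule Bochner_Integration.integrable_bound)
  show "integrable lborel (\<lambda>y. B * normal_density \<theta> 1 y)" by simp
  show "AE y in lborel. norm (normal_density \<theta> 1 y * g y) \<le> norm (B * normal_density \<theta> 1 y)"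
  proof (rule AE_I2)
    fix y
    have "0 \<le> B" using assms(2)[of y] by linarith
    then show "norm (normal_density \<theta> 1 y * g y) \<le> norm (B * normal_density \<theta> 1 y)"
      using assms(2)[of y] by (simp add: abs_mult mult.commute[of B] mult_left_mono)
  qed
qed simp

lemma abs_exp_minus_one_le: "\<bar>exp t - 1\<bar> \<le> 2 * \<bar>t\<bar>" if "\<bar>t\<bar> \<le> 1" for t :: real
proof -
  have "exp t - 1 \<le> 2 * \<bar>t\<bar>"
  proof (cases "0 \<le> t")
    case True
    have "exp t \<le> 1 + t + t\<^sup>2" using True that by (intro exp_bound) auto
    also have "t\<^sup>2 \<le> t * 1" unfolding power2_eq_square using True that by (intro mult_left_mono) auto
    finally show ?thesis using True by simp
  next
    case False
    then have "exp t \<le> 1" by simp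
    then show ?thesis using abs_ge_zero[of t] by linarith
  qed
  moreover have "1 - exp t \<le> 2 * \<bar>t\<bar>" using exp_ge_add_one_self[of t] by linarith
  ultimately show ?thesis by linarith
qed

text \<open>The error has to be relative to the null mean of |g|, which is exponentially small in
  the applications; a total variation bound of order |theta| would be far too large. On |y| <= 3L
  the density ratio is exp(t) with |t| <= 4L|theta|, and the rest is Gaussian tail.\<close>

lemma normal_shift:
  assumes [measurable]: "g \<in> borel_measurable borel" and g: "\<And>y. \<bar>g y\<bar> \<le> 1"
    and L: "1 \<le> L" and \<theta>: "4 * L * \<bar>\<theta>\<bar> \<le> 1"
  shows "\<bar>normal_mean \<theta> g - normal_mean 0 g\<bar>
     \<le> 8 * L * \<bar>\<theta>\<bar> * normal_mean 0 (\<lambda>y. \<bar>g y\<bar>) + 4 * exp (- 2 * L\<^sup>2)"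
proof -
  define S where "S \<mu> y = normal_density \<mu> 1 y * indicator {y. 2 * L < \<bar>y - \<mu>\<bar>} y" for \<mu> y :: real
  have \<theta>1: "\<bar>\<theta>\<bar> \<le> 1"
  proof -
    have "1 * \<bar>\<theta>\<bar> \<le> 4 * L * \<bar>\<theta>\<bar>" using L by (intro mult_right_mono) auto
    then show ?thesis using \<theta> by simp
  qed
  have pt: "\<bar>normal_density \<theta> 1 y - std_normal_density y\<bar> \<le> 8 * L * \<bar>\<theta>\<bar> * std_normal_density y + (S \<theta> y + S 0 y)" for y
  \<comment> \<open>Beyond 3L the distance to both means exceeds 2L, since |theta| <= 1 <= L; the
    tails are then of order exp(-2 L^2), well below exp(-L^2).\<close>
  proof (cases "\<bar>y\<bar> \<le> 3 * L")
    case True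
    define t where "t = \<theta> * y - \<theta>\<^sup>2 / 2"
    have "\<bar>\<theta>\<bar> * \<bar>y\<bar> \<le> \<bar>\<theta>\<bar> * (3 * L)" using True by (intro mult_left_mono) auto
    then have "\<bar>\<theta> * y\<bar> \<le> 3 * (L * \<bar>\<theta>\<bar>)" by (simp add: abs_mult mult_ac)
    moreover have "\<theta>\<^sup>2 / 2 \<le> L * \<bar>\<theta>\<bar>"
    proof -
      have "\<bar>\<theta>\<bar> * \<bar>\<theta>\<bar> \<le> \<bar>\<theta>\<bar> * (2 * L)" using \<theta>1 L by (intro mult_left_mono) auto
      then show ?thesis by (simp add: power2_eq_square mult_ac)
    qed
    moreover have "0 \<le> \<theta>\<^sup>2 / 2" by simp
    ultimately have "\<bar>t\<bar> \<le> 4 * (L * \<bar>\<theta>\<bar>)" unfolding t_def by linarith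
    then have t: "\<bar>t\<bar> \<le> 4 * L * \<bar>\<theta>\<bar>" by (simp add: mult.assoc)
    have "normal_density \<theta> 1 y = std_normal_density y * exp t"
      by (simp add: normal_density_def t_def power2_eq_square algebra_simps diff_divide_distrib add_divide_distrib flip: exp_add)
    then have "\<bar>normal_density \<theta> 1 y - std_normal_density y\<bar> = std_normal_density y * \<bar>exp t - 1\<bar>"
      by (simp add: right_diff_distrib flip: abs_mult[of "std_normal_density y" "exp t - 1", simplified])
    also have "\<dots> \<le> std_normal_density y * (2 * (4 * L * \<bar>\<theta>\<bar>))"
      using t \<theta> abs_exp_minus_one_le[of t] by (intro mult_left_mono) auto
    finally show ?thesis by (simp add: S_def mult_ac add_increasing2)
  next
    case False
    have "0 \<le> normal_density \<theta> 1 y" "0 \<le> std_normal_density y" by simp_all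
    moreover have "S \<theta> y = normal_density \<theta> 1 y" "S 0 y = std_normal_density y"
      using False \<theta>1 L by (auto simp: S_def)
    moreover have "0 \<le> 8 * L * \<bar>\<theta>\<bar> * std_normal_density y" using L by simp
    ultimately show ?thesis by linarith
  qed
  have int: "integrable lborel (\<lambda>y. normal_density \<mu> 1 y * g y)" "integrable lborel (\<lambda>y. normal_density \<mu> 1 y * \<bar>g y\<bar>)"
    "integrable lborel (S \<mu>)" for \<mu>
    unfolding S_def by (auto intro!: normal_density_bounded_integrable[where B=1] g integrable_real_mult_indicator)
  have "\<bar>normal_mean \<theta> g - normal_mean 0 g\<bar>
     = \<bar>\<integral>y. (normal_density \<theta> 1 y - std_normal_density y) * g y \<partial>lborel\<bar>"
    using int by (simp add: left_diff_distrib)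
  also have "\<dots> \<le> (LBINT y. \<bar>(normal_density \<theta> 1 y - std_normal_density y) * g y\<bar>)"
    by (rule integral_abs_bound)
  also have "\<dots> \<le> (LBINT y. 8 * L * \<bar>\<theta>\<bar> * (std_normal_density y * \<bar>g y\<bar>) + (S \<theta> y + S 0 y))"
  proof (intro integral_mono)
    show "integrable lborel (\<lambda>y. \<bar>(normal_density \<theta> 1 y - std_normal_density y) * g y\<bar>)"
      using int[of \<theta>] int[of 0] by (simp add: left_diff_distrib)
    show "integrable lborel (\<lambda>y. 8 * L * \<bar>\<theta>\<bar> * (std_normal_density y * \<bar>g y\<bar>) + (S \<theta> y + S 0 y))"
      by (intro Bochner_Integration.integrable_add integrable_mult_right int)
    fix y
    have "\<bar>(normal_density \<theta> 1 y - std_normal_density y) * g y\<bar> \<le> (8 * L * \<bar>\<theta>\<bar> * std_normal_density y + (S \<theta> y + S 0 y)) * \<bar>g y\<bar>"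
      unfolding abs_mult using pt by (intro mult_right_mono) auto
    also have "\<dots> \<le> 8 * L * \<bar>\<theta>\<bar> * (std_normal_density y * \<bar>g y\<bar>) + (S \<theta> y + S 0 y) * 1"
      using mult_left_mono[OF g[of y], of "S \<theta> y + S 0 y"] by (simp add: algebra_simps S_def)
    finally show "\<bar>(normal_density \<theta> 1 y - std_normal_density y) * g y\<bar>
       \<le> 8 * L * \<bar>\<theta>\<bar> * (std_normal_density y * \<bar>g y\<bar>) + (S \<theta> y + S 0 y)" by simp
  qed
  also have "\<dots> = 8 * L * \<bar>\<theta>\<bar> * normal_mean 0 (\<lambda>y. \<bar>g y\<bar>) + ((LBINT y. S \<theta> y) + (LBINT y. S 0 y))"
    using int by simp
  also have "(LBINT y. S \<theta> y) + (LBINT y. S 0 y) \<le> 2 * exp (- (2 * L)\<^sup>2 / 2) + 2 * exp (- (2 * L)\<^sup>2 / 2)"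
    unfolding S_def using L by (intro add_mono gaussian_tail) auto
  also have "\<dots> = 4 * exp (- 2 * L\<^sup>2)" by (simp add: power_mult_distrib)
  finally show ?thesis by simp
qed

text \<open>
  \<open>L\<close> stands for the square root of \<open>ln (n / k)\<close>, where \<open>k\<close> is the number of signals. Then \<open>k = n * exp (- L\<^sup>2)\<close>,
  and \<open>ref_tau L\<close> is \<open>tau_rate n k\<close>.
\<close>

definition ref_tau :: "real \<Rightarrow> real" where
  "ref_tau L = L * exp (- L\<^sup>2)"

section \<open>Moments of the score at the reference scale\<close>

definition fluct :: "real \<Rightarrow> real \<Rightarrow> real" where
  "fluct \<tau> y = (\<tau> * (lr_slope y - 1))\<^sup>2 / linear_lr \<tau> y"

lemma fluct_measurable [measurable]: "fluct \<tau> \<in> borel_measurable borel"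
  unfolding fluct_def by measurable

text \<open>With x = tau (J - 1) this is x/(1 + x) = x - x^2/(1 + x). As x has null mean 0, the mean
  of the score is minus that of \<open>fluct\<close>, which has a fixed sign and can be bounded
  without cancellation.\<close>

lemma score_eq:
  assumes "0 < \<tau>" "\<tau> \<le> 1 / 2"
  shows "score \<tau> y = \<tau> * (lr_slope y - 1) - fluct \<tau> y"
proof -
  have "linear_lr \<tau> y \<noteq> 0" using linear_lr_pos[OF assms, of y] by simp
  then have "score \<tau> y * linear_lr \<tau> y = (\<tau> * (lr_slope y - 1) - fluct \<tau> y) * linear_lr \<tau> y"
    by (simp add: score_def fluct_def left_diff_distrib) (simp add: linear_lr_def power2_eq_square algebra_simps)
  then show ?thesis using \<open>linear_lr \<tau> y \<noteq> 0\<close> by simp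
qed

lemma score_integrable:
  assumes "0 < \<tau>" "\<tau> \<le> 1 / 2"
  shows "integrable lborel (\<lambda>y. normal_density \<theta> 1 y * score \<tau> y)"
  using abs_score_le_one[OF assms] by (intro normal_density_bounded_integrable) auto

lemma score_mean:
  assumes "0 < \<tau>" "\<tau> \<le> 1 / 2"
  shows "integrable lborel (\<lambda>y. std_normal_density y * fluct \<tau> y)"
    and "normal_mean 0 (score \<tau>) = - normal_mean 0 (fluct \<tau>)"
proof -
  have eq: "(\<lambda>y. std_normal_density y * fluct \<tau> y)
      = (\<lambda>y. \<tau> * (std_normal_density y * lr_slope y) - \<tau> * std_normal_density y - std_normal_density y * score \<tau> y)"
    unfolding score_eq[OF assms] by (simp add: algebra_simps fun_eq_iff)
  show "integrable lborel (\<lambda>y. std_normal_density y * fluct \<tau> y)"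
    unfolding eq using score_integrable[OF assms, of 0]
    by (intro Bochner_Integration.integrable_diff integrable_mult_right lr_slope_integrable) auto
  show "normal_mean 0 (score \<tau>) = - normal_mean 0 (fluct \<tau>)"
    unfolding eq using score_integrable[OF assms, of 0]
    by (simp add: lr_slope_integrable lr_slope_mean)
qed

lemma fluct_nonneg:
  assumes "0 < \<tau>" "\<tau> \<le> 1 / 2"
  shows "0 \<le> fluct \<tau> y"
  unfolding fluct_def using linear_lr_pos[OF assms, of y] by simp

text \<open>For y between 2L and 4L, tau J is exponentially large, so \<open>fluct\<close> is at
  least tau J/2, and phi tau J is of order tau/L^2. The interval has length 2L, which yields the
  order tau/L = exp(-L^2).\<close>

lemma fluct_mean_lower:
  "\<forall>\<^sub>F L in at_top. exp (- L\<^sup>2) / 60000 \<le> normal_mean 0 (fluct (ref_tau L))"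
proof -
  have "\<forall>\<^sub>F L::real in at_top. 4 \<le> exp (L\<^sup>2) / (17000 * L)" by real_asymp
  moreover have "\<forall>\<^sub>F L::real in at_top. 0 < L * exp (- L\<^sup>2) \<and> L * exp (- L\<^sup>2) \<le> 1 / 2" by (intro eventually_conj; real_asymp)
  ultimately show ?thesis using eventually_ge_at_top[of 1]
  proof eventually_elim
    case (elim L)
    define \<tau> where "\<tau> = ref_tau L"
    have \<tau>: "0 < \<tau>" "\<tau> \<le> 1 / 2" using elim by (auto simp: \<tau>_def ref_tau_def)
    \<comment> \<open>102000 is 3 * 2 * 17000: sqrt(2 pi) <= 3, \<open>fluct\<close> is at least
      half of tau J, and 1000 (1 + y^2) <= 17000 L^2 for y up to 4L.\<close>
    define c where "c = \<tau> / (102000 * L\<^sup>2)"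
    have pt: "c * indicator {2 * L..4 * L} y \<le> std_normal_density y * fluct \<tau> y" for y
    proof (cases "y \<in> {2 * L..4 * L}")
      case True
      define E where "E = exp (y\<^sup>2 / 2)"
      have y2: "(2 * L)\<^sup>2 \<le> y\<^sup>2" "y\<^sup>2 \<le> (4 * L)\<^sup>2" using True elim power_mono[of "2 * L" y 2] power_mono[of y "4 * L" 2] by auto
      have L2: "1 \<le> L\<^sup>2" using elim by simp
      have "E / (17000 * L\<^sup>2) \<le> E / (1000 * (1 + y\<^sup>2))"
        using y2 L2 by (intro divide_left_mono) (auto simp: E_def power_mult_distrib intro!: mult_pos_pos add_pos_nonneg)
      also have "\<dots> \<le> lr_slope y" unfolding E_def by (rule lr_slope_lower)
      finally have J: "\<tau> * (E / (17000 * L\<^sup>2)) \<le> \<tau> * lr_slope y" using \<tau> by (intro mult_left_mono) auto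
      have "exp (2 * L\<^sup>2) \<le> E" using y2 by (simp add: E_def power_mult_distrib)
      then have "\<tau> * (exp (2 * L\<^sup>2) / (17000 * L\<^sup>2)) \<le> \<tau> * (E / (17000 * L\<^sup>2))"
        using \<tau> by (intro mult_left_mono divide_right_mono) auto
      moreover have "\<tau> * (exp (2 * L\<^sup>2) / (17000 * L\<^sup>2)) = exp (L\<^sup>2) / (17000 * L)"
      proof -
        have "exp (2 * L\<^sup>2) = exp (L\<^sup>2) * exp (L\<^sup>2)" by (simp flip: exp_add)
        then show ?thesis using elim by (simp add: \<tau>_def ref_tau_def exp_minus field_simps power2_eq_square)
      qed
      ultimately have J4: "4 \<le> \<tau> * lr_slope y" using J elim by linarith
      define X where "X = \<tau> * (lr_slope y - 1)"
      have X: "3 / 4 * (\<tau> * lr_slope y) \<le> X" "3 \<le> X" unfolding X_def right_diff_distrib using J4 \<tau> by (auto simp only: mult_1_right)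
      have D: "linear_lr \<tau> y = 1 + X" by (simp add: linear_lr_def X_def algebra_simps)
      have "X * 3 * (1 + X) \<le> X * X * 4" using X by (simp add: algebra_simps)
      then have "X * (3 / 4) \<le> X\<^sup>2 / (1 + X)" using X by (simp add: pos_le_divide_eq power2_eq_square algebra_simps)
      then have "\<tau> * lr_slope y / 2 \<le> fluct \<tau> y" unfolding fluct_def D X_def[symmetric] using X by linarith
      then have fl: "\<tau> * (E / (34000 * L\<^sup>2)) \<le> fluct \<tau> y" using J by simp
      have "sqrt (2 * pi) \<le> 3" using pi_less_4 by (intro real_le_lsqrt) auto
      then have "1 / 3 \<le> 1 / sqrt (2 * pi)" by (intro divide_left_mono) auto
      then have "1 / 3 * (1 / E) \<le> 1 / sqrt (2 * pi) * (1 / E)" by (intro mult_right_mono) (auto simp: E_def)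
      also have "\<dots> = std_normal_density y"
        unfolding std_normal_density_def E_def by (simp add: exp_minus inverse_eq_divide)
      finally have "1 / 3 * (1 / E) \<le> std_normal_density y" .
      then have "1 / 3 * (1 / E) * (\<tau> * (E / (34000 * L\<^sup>2))) \<le> std_normal_density y * fluct \<tau> y"
        using fl \<tau> by (intro mult_mono) (auto simp: E_def)
      also have "1 / 3 * (1 / E) * (\<tau> * (E / (34000 * L\<^sup>2))) = c" by (simp add: c_def E_def)
      finally show ?thesis using True by simp
    qed (use fluct_nonneg[OF \<tau>] in simp)
    have "exp (- L\<^sup>2) / 60000 \<le> c * (2 * L)"
      using elim by (simp add: c_def \<tau>_def ref_tau_def field_simps power2_eq_square)
    also have "\<dots> = (LBINT y. c * indicator {2 * L..4 * L} y)" using elim by simp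
    also have "\<dots> \<le> normal_mean 0 (fluct \<tau>)"
      using pt score_mean[OF \<tau>] elim by (intro integral_mono) auto
    finally show ?case by (simp add: \<tau>_def)
  qed
qed

text \<open>
  The factor \<open>sqrt L\<close> in \<open>exp ((cutoff L)\<^sup>2 / 2) = exp (L\<^sup>2) * sqrt L\<close> makes both the Gaussian tail beyond the cutoff
  and the squared slope below it smaller than \<open>exp (- L\<^sup>2)\<close>, which is the order of the mean of the score.
\<close>

definition cutoff :: "real \<Rightarrow> real" where
  "cutoff L = sqrt (2 * L\<^sup>2 + ln L)"

text \<open>A bound for phi J^2 on |y| <= W, split at |y| = W/2. The 1800 is 60^2/2, from
  \<open>lr_slope_upper\<close> and \<open>std_normal_density_le\<close>.\<close>

definition slope_sq_bound :: "real \<Rightarrow> real" where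
  "slope_sq_bound W = 1800 * (exp (W\<^sup>2 / 8) + 16 * exp (W\<^sup>2 / 2) / W ^ 4)"

lemma density_slope_sq_le:
  assumes "\<bar>y\<bar> \<le> W" "0 < W"
  shows "std_normal_density y * (lr_slope y)\<^sup>2 \<le> slope_sq_bound W"
proof -
  have y2: "y\<^sup>2 \<le> W\<^sup>2" using assms by (simp add: abs_le_square_iff[symmetric])
  have "(lr_slope y)\<^sup>2 \<le> (60 * (exp (y\<^sup>2 / 2) / (1 + y\<^sup>2)))\<^sup>2"
    by (intro power_mono lr_slope_upper lr_slope_nonneg)
  then have "std_normal_density y * (lr_slope y)\<^sup>2 \<le> 1 / 2 * exp (- y\<^sup>2 / 2) * (60 * (exp (y\<^sup>2 / 2) / (1 + y\<^sup>2)))\<^sup>2"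
    by (intro mult_mono std_normal_density_le) auto
  also have "\<dots> = 1800 * (exp (y\<^sup>2 / 2) / (1 + y\<^sup>2)\<^sup>2)"
    by (simp add: power_mult_distrib power_divide exp_minus field_simps) (simp add: power2_eq_square)
  also have "\<dots> \<le> slope_sq_bound W"
  proof (cases "y\<^sup>2 \<le> W\<^sup>2 / 4")
    case True
    have "exp (y\<^sup>2 / 2) / (1 + y\<^sup>2)\<^sup>2 \<le> exp (W\<^sup>2 / 8) / 1"
      using True by (intro frac_le) (auto simp: one_le_power)
    moreover have "0 \<le> 16 * exp (W\<^sup>2 / 2) / W ^ 4" using assms by simp
    ultimately show ?thesis unfolding slope_sq_bound_def by (intro mult_left_mono) linarith+
  next
    case False
    have "(W\<^sup>2 / 4)\<^sup>2 \<le> (1 + y\<^sup>2)\<^sup>2" using False by (intro power_mono) auto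
    then have "exp (y\<^sup>2 / 2) / (1 + y\<^sup>2)\<^sup>2 \<le> exp (W\<^sup>2 / 2) / (W\<^sup>2 / 4)\<^sup>2"
      using y2 assms by (intro frac_le) auto
    also have "\<dots> = 16 * exp (W\<^sup>2 / 2) / W ^ 4" using assms by (simp add: power_divide field_simps)
    also have "\<dots> \<le> exp (W\<^sup>2 / 8) + 16 * exp (W\<^sup>2 / 2) / W ^ 4" by simp
    finally show ?thesis unfolding slope_sq_bound_def by (rule mult_left_mono) simp
  qed
  finally show ?thesis .
qed

lemma integral_inverse_square_tail:
  fixes W :: real
  assumes "0 < W"
  shows "(LBINT y. 1 / (1 + y\<^sup>2) * indicator {y. W < \<bar>y\<bar>} y) \<le> 2 / W"
proof -
  define h :: "real \<Rightarrow> real" where "h y = half_cauchy 1 y * indicator {W..} y" for y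
  have h: "integrable lborel h" unfolding h_def
    by (intro integrable_real_mult_indicator half_cauchy_integral) auto
  have "ennreal (LBINT y. h y) = (\<integral>\<^sup>+y. ennreal (half_cauchy 1 y) * indicator {W..} y \<partial>lborel)"
    using h by (subst nn_integral_eq_integral[symmetric])
      (auto simp: h_def half_cauchy_nonneg intro!: nn_integral_cong split: split_indicator)
  also have "\<dots> = ennreal (1 - 2 / pi * arctan W)" using assms by (subst nn_integral_half_cauchy_atLeast) auto
  finally have "ennreal (LBINT y. h y) = ennreal (1 - 2 / pi * arctan W)" .
  moreover have "0 \<le> 1 - 2 / pi * arctan W" using arctan_ubound[of W] by (simp add: field_simps)
  moreover have "0 \<le> (LBINT y. h y)"
    by (intro integral_nonneg_AE AE_I2) (simp add: h_def half_cauchy_nonneg)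
  ultimately have I: "(LBINT y. h y) = 1 - 2 / pi * arctan W" by simp
  have "arctan (1 / W) \<le> 1 / W" using assms by (intro arctan_le_self) auto
  moreover have "arctan (1 / W) = pi / 2 - arctan W" using assms arctan_inverse[of W] by (simp add: sgn_if inverse_eq_divide)
  ultimately have "pi / 2 * (LBINT y. h y) \<le> 1 / W" unfolding I by (simp add: right_diff_distrib)
  then have "pi * (LBINT y. h y) \<le> 2 / W" by (simp add: field_simps)
  moreover have "(LBINT y. h (0 + -1 * y)) = (LBINT y. h y)"
    using lborel_integral_real_affine[of "-1" h 0] by simp
  moreover have "(LBINT y. 1 / (1 + y\<^sup>2) * indicator {y. W < \<bar>y\<bar>} y) \<le> (LBINT y. pi / 2 * (h y + h (0 + -1 * y)))"
  proof (intro integral_mono)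
    show "integrable lborel (\<lambda>y. 1 / (1 + y\<^sup>2) * indicator {y. W < \<bar>y\<bar>} y)"
      by (intro integrable_real_mult_indicator integrable_inverse_square) auto
    show "integrable lborel (\<lambda>y. pi / 2 * (h y + h (0 + -1 * y)))"
      by (intro integrable_mult_right Bochner_Integration.integrable_add h lborel_integrable_real_affine) auto
    show "1 / (1 + y\<^sup>2) * indicator {y. W < \<bar>y\<bar>} y \<le> pi / 2 * (h y + h (0 + -1 * y))" for y
      using assms by (auto simp: h_def half_cauchy_def split: split_indicator)
  qed
  ultimately show ?thesis using h lborel_integrable_real_affine[OF h, of "-1" 0] by simp
qed

lemma cutoff_bounds: "\<forall>\<^sub>F L::real in at_top. L \<le> cutoff L \<and> cutoff L \<le> 2 * L \<and> exp ((cutoff L)\<^sup>2 / 2) = exp (L\<^sup>2) * sqrt L"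
  using eventually_ge_at_top[of 1]
proof eventually_elim
  case (elim L)
  have ln: "0 \<le> ln L" "ln L \<le> L" using elim ln_bound[of L] by auto
  have "L \<le> L\<^sup>2" using elim self_le_power[of L 2] by simp
  then have "2 * L\<^sup>2 + ln L \<le> (2 * L)\<^sup>2" using ln by (simp add: power_mult_distrib)
  moreover have "L\<^sup>2 \<le> 2 * L\<^sup>2 + ln L" using ln by simp
  moreover have "exp ((cutoff L)\<^sup>2 / 2) = exp (L\<^sup>2) * sqrt L"
  proof -
    have "(cutoff L)\<^sup>2 = 2 * L\<^sup>2 + ln L" using ln by (simp add: cutoff_def)
    then have "exp ((cutoff L)\<^sup>2 / 2) = exp (L\<^sup>2 + ln (sqrt L))" using elim by (simp add: add_divide_distrib ln_sqrt)
    then show ?thesis using elim by (simp add: exp_add)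
  qed
  ultimately show ?case using elim unfolding cutoff_def
    by (auto intro!: real_le_rsqrt real_le_lsqrt)
qed

text \<open>With W of order L and exp(W^2/2) = exp(L^2) sqrt L, the leading term tau^2
  exp(W^2/2)/W^3 is of order exp(-L^2)/sqrt L. The inner half of the interval grows only like
  exp(W^2/8) and is exponentially smaller.\<close>

lemma slope_sq_bound_asymp:
  "\<forall>\<^sub>F L in at_top. (ref_tau L)\<^sup>2 * (2 * cutoff L * slope_sq_bound (cutoff L)) \<le> 100000 * (exp (- L\<^sup>2) / sqrt L)"
proof -
  have "\<forall>\<^sub>F L::real in at_top. L\<^sup>2 * exp (- 2 * L\<^sup>2) * (1800 * (4 * L * exp (L\<^sup>2 / 2) + 32 * (exp (L\<^sup>2) * sqrt L) / L ^ 3))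
      \<le> 100000 * (exp (- L\<^sup>2) / sqrt L)" by real_asymp
  with cutoff_bounds show ?thesis using eventually_ge_at_top[of 1]
  proof eventually_elim
    case (elim L)
    define W where "W = cutoff L"
    have W: "L \<le> W" "W \<le> 2 * L" "exp (W\<^sup>2 / 2) = exp (L\<^sup>2) * sqrt L" "1 \<le> L" "0 < W" using elim by (auto simp: W_def)
    have "W\<^sup>2 \<le> (2 * L)\<^sup>2" using W by (intro power_mono) auto
    then have "exp (W\<^sup>2 / 8) \<le> exp (L\<^sup>2 / 2)" by (simp add: power_mult_distrib)
    then have "2 * W * exp (W\<^sup>2 / 8) \<le> 2 * (2 * L) * exp (L\<^sup>2 / 2)" using W by (intro mult_mono) auto
    moreover have "2 * W * (16 * exp (W\<^sup>2 / 2) / W ^ 4) \<le> 32 * (exp (L\<^sup>2) * sqrt L) / L ^ 3"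
    proof -
      have "2 * W * (16 * exp (W\<^sup>2 / 2) / W ^ 4) = 32 * (exp (L\<^sup>2) * sqrt L) / W ^ 3"
        using W by (simp add: power4_eq_xxxx power3_eq_cube)
      also have "\<dots> \<le> 32 * (exp (L\<^sup>2) * sqrt L) / L ^ 3"
        using W by (intro divide_left_mono power_mono) auto
      finally show ?thesis .
    qed
    ultimately have "2 * W * (exp (W\<^sup>2 / 8) + 16 * exp (W\<^sup>2 / 2) / W ^ 4)
        \<le> 4 * L * exp (L\<^sup>2 / 2) + 32 * (exp (L\<^sup>2) * sqrt L) / L ^ 3" by (simp add: distrib_left)
    then have "1800 * (2 * W * (exp (W\<^sup>2 / 8) + 16 * exp (W\<^sup>2 / 2) / W ^ 4)) \<le> 1800 * (4 * L * exp (L\<^sup>2 / 2) + 32 * (exp (L\<^sup>2) * sqrt L) / L ^ 3)"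
      by (intro mult_left_mono) auto
    then have "2 * W * slope_sq_bound W \<le> 1800 * (4 * L * exp (L\<^sup>2 / 2) + 32 * (exp (L\<^sup>2) * sqrt L) / L ^ 3)"
      unfolding slope_sq_bound_def by (simp only: mult_ac)
    then have "(ref_tau L)\<^sup>2 * (2 * W * slope_sq_bound W)
       \<le> (ref_tau L)\<^sup>2 * (1800 * (4 * L * exp (L\<^sup>2 / 2) + 32 * (exp (L\<^sup>2) * sqrt L) / L ^ 3))"
      by (intro mult_left_mono) auto
    also have "\<dots> = L\<^sup>2 * exp (- 2 * L\<^sup>2) * (1800 * (4 * L * exp (L\<^sup>2 / 2) + 32 * (exp (L\<^sup>2) * sqrt L) / L ^ 3))"
      by (simp add: ref_tau_def power_mult_distrib flip: exp_of_nat_mult)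
    also have "\<dots> \<le> 100000 * (exp (- L\<^sup>2) / sqrt L)" using elim by blast
    finally show ?case by (simp add: W_def)
  qed
qed
lemma ref_tau_sq_asymp: "\<forall>\<^sub>F L::real in at_top. (ref_tau L)\<^sup>2 \<le> exp (- L\<^sup>2) / sqrt L"
  unfolding ref_tau_def by real_asymp

lemma exp_cutoff_asymp: "\<forall>\<^sub>F L::real in at_top. exp (- (cutoff L)\<^sup>2 / 2) = exp (- L\<^sup>2) / sqrt L"
  using cutoff_bounds by eventually_elim (simp add: exp_minus inverse_eq_divide)

lemma ref_tau_div_cutoff_asymp: "\<forall>\<^sub>F L::real in at_top. ref_tau L / cutoff L \<le> exp (- L\<^sup>2)"
  using cutoff_bounds eventually_ge_at_top[of 1]
  by eventually_elim (simp add: ref_tau_def pos_divide_le_eq mult.commute)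

lemma ref_tau_pos_small: "0 < \<epsilon> \<Longrightarrow> \<forall>\<^sub>F L::real in at_top. 0 < ref_tau L \<and> ref_tau L \<le> \<epsilon>"
  unfolding ref_tau_def by (rule eventually_conj, real_asymp, real_asymp)

text \<open>Below W the function is treated as quadratic in J, beyond W as linear: there x^2/(1 + x)
  <= x for x >= 0 keeps the integrable Cauchy tail instead of the divergent square. In the mean the
  linear part is the larger one, with tau/W of order exp(-L^2).\<close>

lemma fluct_le:
  assumes \<tau>: "0 < \<tau>" "\<tau> \<le> 1 / 2" and W: "0 < W"
  shows "std_normal_density y * fluct \<tau> y \<le> 2 * \<tau>\<^sup>2 * std_normal_density y
     + 2 * \<tau>\<^sup>2 * slope_sq_bound W * indicator {- W..W} y + 30 * \<tau> * (1 / (1 + y\<^sup>2) * indicator {y. W < \<bar>y\<bar>} y)"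
proof -
  define H where "H = lr_slope y - 1"
  define p where "p = std_normal_density y"
  have J: "0 \<le> lr_slope y" by (rule lr_slope_nonneg)
  have p: "0 \<le> p" by (simp add: p_def)
  have H2: "H\<^sup>2 \<le> 1 + (lr_slope y)\<^sup>2" using J by (simp add: H_def power2_diff)
  have "fluct \<tau> y \<le> (\<tau> * H)\<^sup>2 / (1 / 2)"
    unfolding fluct_def H_def using linear_lr_ge[OF \<tau>, of y] by (intro divide_left_mono) auto
  also have "\<dots> \<le> 2 * \<tau>\<^sup>2 + 2 * \<tau>\<^sup>2 * (lr_slope y)\<^sup>2"
    using mult_left_mono[OF H2, of "2 * \<tau>\<^sup>2"] by (simp add: power_mult_distrib algebra_simps)
  finally have f1: "fluct \<tau> y \<le> 2 * \<tau>\<^sup>2 + 2 * \<tau>\<^sup>2 * (lr_slope y)\<^sup>2" .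
  have pos: "0 \<le> slope_sq_bound W" using W by (simp add: slope_sq_bound_def)
  show ?thesis
  proof (cases "W < \<bar>y\<bar>")
    case False
    then have "p * (lr_slope y)\<^sup>2 \<le> slope_sq_bound W" unfolding p_def using W by (intro density_slope_sq_le) auto
    then have "2 * \<tau>\<^sup>2 * (p * (lr_slope y)\<^sup>2) \<le> 2 * \<tau>\<^sup>2 * slope_sq_bound W" by (intro mult_left_mono) auto
    moreover have "p * fluct \<tau> y \<le> p * (2 * \<tau>\<^sup>2 + 2 * \<tau>\<^sup>2 * (lr_slope y)\<^sup>2)" using f1 p by (intro mult_left_mono)
    moreover have "y \<in> {- W..W}" using False by auto
    ultimately show ?thesis using False by (simp add: p_def algebra_simps)
  next
    case True
    have "fluct \<tau> y \<le> 2 * \<tau>\<^sup>2 + \<tau> * lr_slope y"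
    proof (cases "0 \<le> H")
      case True
      have "(\<tau> * H)\<^sup>2 / linear_lr \<tau> y \<le> \<tau> * H"
      proof -
        have "\<tau> * H * (\<tau> * H) \<le> \<tau> * H * linear_lr \<tau> y"
          using True \<tau> by (intro mult_left_mono) (auto simp: linear_lr_def H_def algebra_simps)
        then show ?thesis using linear_lr_pos[OF \<tau>, of y] by (simp add: pos_divide_le_eq power2_eq_square)
      qed
      also have "\<dots> \<le> 2 * \<tau>\<^sup>2 + \<tau> * lr_slope y" using \<tau> zero_le_power2[of \<tau>] unfolding H_def right_diff_distrib by linarith
      finally show ?thesis by (simp add: fluct_def H_def)
    next
      case False
      then have "\<bar>H\<bar> \<le> 1" using J by (auto simp: H_def)
      then have "H\<^sup>2 \<le> 1" by (simp add: abs_square_le_1)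
      then have "(\<tau> * H)\<^sup>2 / (1 / 2) \<le> 2 * \<tau>\<^sup>2" using mult_left_mono[of "H\<^sup>2" 1 "2 * \<tau>\<^sup>2"] by (simp add: power_mult_distrib mult.commute)
      moreover have "fluct \<tau> y \<le> (\<tau> * H)\<^sup>2 / (1 / 2)"
        unfolding fluct_def H_def using linear_lr_ge[OF \<tau>, of y] by (intro divide_left_mono) auto
      moreover have "0 \<le> \<tau> * lr_slope y" using J \<tau> by simp
      ultimately show ?thesis by linarith
    qed
    then have "p * fluct \<tau> y \<le> p * (2 * \<tau>\<^sup>2 + \<tau> * lr_slope y)" using p by (intro mult_left_mono)
    also have "\<dots> = 2 * \<tau>\<^sup>2 * p + \<tau> * (p * lr_slope y)" by (simp add: algebra_simps)
    also have "\<dots> \<le> 2 * \<tau>\<^sup>2 * p + \<tau> * (30 * (1 / (1 + y\<^sup>2)))"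
      unfolding p_def using \<tau> density_lr_slope_le[of y] by (intro add_left_mono mult_left_mono) auto
    finally have "p * fluct \<tau> y \<le> 2 * \<tau>\<^sup>2 * p + \<tau> * (30 * (1 / (1 + y\<^sup>2)))" .
    moreover have "0 \<le> 2 * \<tau>\<^sup>2 * slope_sq_bound W * indicator {- W..W} y" using pos by simp
    moreover have "30 * \<tau> * (1 / (1 + y\<^sup>2) * indicator {y. W < \<bar>y\<bar>} y) = \<tau> * (30 * (1 / (1 + y\<^sup>2)))" using True by simp
    ultimately show ?thesis unfolding p_def by linarith
  qed
qed

lemma integral_linear_two:
  fixes f g :: "'a \<Rightarrow> real"
  assumes "integrable M f" "integrable M g"
  shows "(\<integral>x. a * f x + b * g x \<partial>M) = a * (\<integral>x. f x \<partial>M) + b * (\<integral>x. g x \<partial>M)"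
  using assms by simp

lemma integral_linear_three:
  fixes f g h :: "'a \<Rightarrow> real"
  assumes "integrable M f" "integrable M g" "integrable M h"
  shows "(\<integral>x. a * f x + b * g x + c * h x \<partial>M) = a * (\<integral>x. f x \<partial>M) + b * (\<integral>x. g x \<partial>M) + c * (\<integral>x. h x \<partial>M)"
  using assms by simp

lemma fluct_mean_upper:
  "\<forall>\<^sub>F L in at_top. normal_mean 0 (fluct (ref_tau L)) \<le> 300000 * exp (- L\<^sup>2)"
  using slope_sq_bound_asymp ref_tau_sq_asymp ref_tau_div_cutoff_asymp cutoff_bounds
    ref_tau_pos_small[of "1/2", simplified] eventually_ge_at_top[of 1]
proof eventually_elim
  case (elim L)
  define \<tau> W where "\<tau> = ref_tau L" and "W = cutoff L"
  have \<tau>: "0 < \<tau>" "\<tau> \<le> 1 / 2" and W: "0 < W" using elim by (auto simp: \<tau>_def W_def)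
  have int: "integrable lborel (\<lambda>y::real. 1 / (1 + y\<^sup>2) * indicator {y. W < \<bar>y\<bar>} y)"
      by (intro integrable_real_mult_indicator integrable_inverse_square) auto
  have "normal_mean 0 (fluct \<tau>)
     \<le> (LBINT y. 2 * \<tau>\<^sup>2 * std_normal_density y + 2 * \<tau>\<^sup>2 * slope_sq_bound W * indicator {- W..W} y
          + 30 * \<tau> * (1 / (1 + y\<^sup>2) * indicator {y. W < \<bar>y\<bar>} y))"
    using fluct_le[OF \<tau> W] W score_mean[OF \<tau>] int
    by (intro integral_mono Bochner_Integration.integrable_add integrable_mult_right) auto
  also have "\<dots> = 2 * \<tau>\<^sup>2 + 2 * \<tau>\<^sup>2 * slope_sq_bound W * (2 * W)
      + 30 * \<tau> * (LBINT y. 1 / (1 + y\<^sup>2) * indicator {y. W < \<bar>y\<bar>} y)"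
    using W int by (subst integral_linear_three) auto
  also have "\<dots> \<le> 2 * \<tau>\<^sup>2 + 2 * \<tau>\<^sup>2 * slope_sq_bound W * (2 * W) + 30 * \<tau> * (2 / W)"
    using integral_inverse_square_tail[OF W] \<tau> by (intro add_left_mono mult_left_mono) auto
  also have "\<dots> = 2 * \<tau>\<^sup>2 + 2 * (\<tau>\<^sup>2 * (2 * W * slope_sq_bound W)) + 60 * (\<tau> / W)" by (simp add: mult_ac)
  also have "\<dots> \<le> 2 * exp (- L\<^sup>2) + 2 * (100000 * exp (- L\<^sup>2)) + 60 * exp (- L\<^sup>2)"
  proof -
    have "exp (- L\<^sup>2) / sqrt L \<le> exp (- L\<^sup>2) / 1" using elim by (intro divide_left_mono) auto
    moreover have "\<tau>\<^sup>2 * (2 * W * slope_sq_bound W) \<le> 100000 * (exp (- L\<^sup>2) / sqrt L)"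
       "\<tau>\<^sup>2 \<le> exp (- L\<^sup>2) / sqrt L" "\<tau> / W \<le> exp (- L\<^sup>2)" using elim by (simp_all add: \<tau>_def W_def)
    ultimately show ?thesis by linarith
  qed
  also have "\<dots> \<le> 300000 * exp (- L\<^sup>2)" by simp
  finally show ?case by (simp add: \<tau>_def)
qed

text \<open>Beyond the cutoff the score is at most 1 in size and only the Gaussian tail
  exp(-L^2)/sqrt L counts; below it the squared score is at most 4 tau^2 (J - 1)^2. The factor sqrt
  L gained over the mean is what makes Chebyshev's inequality work for a bounded number of
  signals.\<close>

lemma score_sq_mean:
  "\<forall>\<^sub>F L in at_top. normal_mean 0 (\<lambda>y. (score (ref_tau L) y)\<^sup>2) \<le> 500000 * (exp (- L\<^sup>2) / sqrt L)"
  using slope_sq_bound_asymp ref_tau_sq_asymp exp_cutoff_asymp cutoff_bounds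
    ref_tau_pos_small[of "1/2", simplified] eventually_ge_at_top[of 1]
proof eventually_elim
  case (elim L)
  define \<tau> W where "\<tau> = ref_tau L" and "W = cutoff L"
  have \<tau>: "0 < \<tau>" "\<tau> \<le> 1 / 2" and W: "0 < W" using elim by (auto simp: \<tau>_def W_def)
  have pos: "0 \<le> slope_sq_bound W" using W by (simp add: slope_sq_bound_def)
  have sq1: "(score \<tau> y)\<^sup>2 \<le> 1" for y using abs_score_le_one[OF \<tau>, of y] by (simp add: abs_square_le_1)
  have pt: "std_normal_density y * (score \<tau> y)\<^sup>2 \<le> 4 * \<tau>\<^sup>2 * std_normal_density y
     + 4 * \<tau>\<^sup>2 * slope_sq_bound W * indicator {- W..W} y + std_normal_density y * indicator {y. W < \<bar>y - 0\<bar>} y" for y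
  proof (cases "W < \<bar>y\<bar>")
    case False
    define p where "p = std_normal_density y"
    have "(score \<tau> y)\<^sup>2 \<le> (2 * \<tau> * \<bar>lr_slope y - 1\<bar>)\<^sup>2"
      using abs_score_le[OF \<tau>, of y] by (subst abs_le_square_iff[symmetric]) (use \<tau> in \<open>simp add: abs_mult\<close>)
    also have "\<dots> = 4 * \<tau>\<^sup>2 * (lr_slope y - 1)\<^sup>2" by (simp add: power_mult_distrib)
    also have "\<dots> \<le> 4 * \<tau>\<^sup>2 * (1 + (lr_slope y)\<^sup>2)"
      using lr_slope_nonneg[of y] by (intro mult_left_mono) (auto simp: power2_diff)
    finally have "p * (score \<tau> y)\<^sup>2 \<le> p * (4 * \<tau>\<^sup>2 * (1 + (lr_slope y)\<^sup>2))" by (intro mult_left_mono) (auto simp: p_def)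
    also have "\<dots> = 4 * \<tau>\<^sup>2 * p + 4 * \<tau>\<^sup>2 * (p * (lr_slope y)\<^sup>2)" by (simp add: algebra_simps)
    also have "\<dots> \<le> 4 * \<tau>\<^sup>2 * p + 4 * \<tau>\<^sup>2 * slope_sq_bound W"
      using False W unfolding p_def by (intro add_left_mono mult_left_mono density_slope_sq_le) auto
    finally show ?thesis using False by (auto simp: p_def split: split_indicator)
  next
    case True
    have "std_normal_density y * (score \<tau> y)\<^sup>2 \<le> std_normal_density y * 1" using sq1 by (intro mult_left_mono) auto
    moreover have "0 \<le> 4 * \<tau>\<^sup>2 * std_normal_density y" by simp
    moreover have "0 \<le> 4 * \<tau>\<^sup>2 * slope_sq_bound W * indicator {- W..W} y" using pos by simp
    moreover have "std_normal_density y * indicator {y. W < \<bar>y - 0\<bar>} y = std_normal_density y" using True by simp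
    ultimately show ?thesis unfolding mult_1_right by linarith
  qed
  have int: "integrable lborel (\<lambda>y. std_normal_density y * indicator {y. W < \<bar>y - 0\<bar>} y)"
    by (intro integrable_real_mult_indicator) auto
  have "normal_mean 0 (\<lambda>y. (score \<tau> y)\<^sup>2)
     \<le> (LBINT y. 4 * \<tau>\<^sup>2 * std_normal_density y + 4 * \<tau>\<^sup>2 * slope_sq_bound W * indicator {- W..W} y
          + 1 * (std_normal_density y * indicator {y. W < \<bar>y - 0\<bar>} y))"
    using pt W int sq1
    by (intro integral_mono Bochner_Integration.integrable_add integrable_mult_right
       normal_density_bounded_integrable[where B=1]) auto
  also have "\<dots> = 4 * \<tau>\<^sup>2 + 4 * \<tau>\<^sup>2 * slope_sq_bound W * (2 * W)
      + normal_mean 0 (indicator {y. W < \<bar>y - 0\<bar>})"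
    using W int by (subst integral_linear_three) auto
  also have "\<dots> \<le> 4 * \<tau>\<^sup>2 + 4 * \<tau>\<^sup>2 * slope_sq_bound W * (2 * W) + 2 * exp (- W\<^sup>2 / 2)"
    using W by (intro add_left_mono gaussian_tail) auto
  also have "\<dots> = 4 * \<tau>\<^sup>2 + 4 * (\<tau>\<^sup>2 * (2 * W * slope_sq_bound W)) + 2 * exp (- W\<^sup>2 / 2)" by (simp add: mult_ac)
  also have "\<dots> \<le> 4 * (exp (- L\<^sup>2) / sqrt L) + 4 * (100000 * (exp (- L\<^sup>2) / sqrt L)) + 2 * (exp (- L\<^sup>2) / sqrt L)"
    using elim unfolding \<tau>_def W_def by (intro add_mono mult_left_mono) auto
  also have "\<dots> = 400006 * (exp (- L\<^sup>2) / sqrt L)" by simp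
  also have "\<dots> \<le> 500000 * (exp (- L\<^sup>2) / sqrt L)" using elim by (intro mult_right_mono) auto
  finally show ?case by (simp add: \<tau>_def)
qed

text \<open>The bound exceeds the mean of the score by a factor of order L, which is harmless
  because \<open>normal_shift\<close> multiplies it by the exponentially small
  \<open>null_radius\<close>.\<close>

lemma abs_score_mean:
  assumes \<tau>: "0 < \<tau>" "\<tau> \<le> 1 / 2"
  shows "normal_mean 0 (\<lambda>y. \<bar>score \<tau> y\<bar>) \<le> 4 * \<tau>"
proof -
  have "std_normal_density y * \<bar>score \<tau> y\<bar> \<le> 2 * \<tau> * (std_normal_density y * lr_slope y) + 2 * \<tau> * std_normal_density y" for y
  proof -
    have "\<bar>lr_slope y - 1\<bar> \<le> lr_slope y + 1" using lr_slope_nonneg[of y] by linarith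
    then have "2 * \<tau> * \<bar>lr_slope y - 1\<bar> \<le> 2 * \<tau> * (lr_slope y + 1)" using \<tau> by (intro mult_left_mono) auto
    then have "std_normal_density y * \<bar>score \<tau> y\<bar> \<le> std_normal_density y * (2 * \<tau> * (lr_slope y + 1))"
      using abs_score_le[OF \<tau>, of y] by (intro mult_left_mono) auto
    then show ?thesis by (simp add: algebra_simps)
  qed
  then have "normal_mean 0 (\<lambda>y. \<bar>score \<tau> y\<bar>)
     \<le> (LBINT y. 2 * \<tau> * (std_normal_density y * lr_slope y) + 2 * \<tau> * std_normal_density y)"
    using abs_score_le_one[OF \<tau>]
    by (intro integral_mono Bochner_Integration.integrable_add integrable_mult_right lr_slope_integrable
      normal_density_bounded_integrable[where B=1]) auto
  also have "\<dots> = 4 * \<tau>" by (simp add: lr_slope_integrable lr_slope_mean)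
  finally show ?thesis .
qed

lemma lr_error_mean:
  assumes \<tau>: "0 < \<tau>" "\<tau> \<le> 1 / 50000"
  shows "normal_mean 0 (lr_error \<tau>) \<le> 100000 * \<tau>\<^sup>2"
proof -
  have \<tau>2: "\<tau> \<le> 1 / 2" using \<tau> by simp
  have "lr_error \<tau> y \<le> 1" for y using lr_error_le[OF \<tau>(1) \<tau>2, of y] \<tau> by simp
  then have "\<bar>lr_error \<tau> y\<bar> \<le> 1" for y using lr_error_nonneg[OF \<tau>(1) \<tau>2, of y] by simp
  then have "normal_mean 0 (lr_error \<tau>)
     \<le> (LBINT y. 100000 * \<tau>\<^sup>2 * (std_normal_density y * lr_slope y))"
    using mult_left_mono[OF lr_error_le_slope[OF \<tau>(1) \<tau>2], of "std_normal_density _"]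
    by (intro integral_mono integrable_mult_right lr_slope_integrable
      normal_density_bounded_integrable[where B=1]) (auto simp: mult_ac)
  then show ?thesis by (simp add: lr_slope_mean)
qed

text \<open>Any sufficiently small power of \<open>k / n = exp (- L\<^sup>2)\<close> would do.\<close>

definition null_radius :: "real \<Rightarrow> real" where
  "null_radius L = exp (- L\<^sup>2 / 50)"

text \<open>The null moments are transferred by \<open>normal_shift\<close> with d = 8 L |theta|.
  The constants balance: 1/60000 - 1/150000 = 1/100000 for the mean, and 500000 (1 + d) + 1 <=
  2000000 with d <= 2 for the second moment.\<close>

lemma near_null_score_moments:
  "\<forall>\<^sub>F L in at_top. \<forall>\<theta>. \<bar>\<theta>\<bar> \<le> null_radius L \<longrightarrow>
     normal_mean \<theta> (score (ref_tau L)) \<le> - (exp (- L\<^sup>2) / 100000) \<and>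
     - (400000 * exp (- L\<^sup>2)) \<le> normal_mean \<theta> (score (ref_tau L)) \<and>
     normal_mean \<theta> (\<lambda>y. (score (ref_tau L) y)\<^sup>2) \<le> 2000000 * (exp (- L\<^sup>2) / sqrt L) \<and>
     normal_mean \<theta> (lr_error (ref_tau L)) \<le> exp (- L\<^sup>2) / L"
proof -
  have as: "\<forall>\<^sub>F L in at_top. 4 * L * null_radius L \<le> 1"
    "\<forall>\<^sub>F L in at_top. 8 * L * null_radius L * (4 * ref_tau L) + 4 * exp (- 2 * L\<^sup>2) \<le> exp (- L\<^sup>2) / 150000"
    "\<forall>\<^sub>F L in at_top. 4 * exp (- 2 * L\<^sup>2) \<le> exp (- L\<^sup>2) / sqrt L"
    "\<forall>\<^sub>F L in at_top. 300000 * (ref_tau L)\<^sup>2 + 4 * exp (- 2 * L\<^sup>2) \<le> exp (- L\<^sup>2) / L"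
    unfolding null_radius_def ref_tau_def by real_asymp+
  show ?thesis
    using as fluct_mean_lower fluct_mean_upper score_sq_mean eventually_ge_at_top[of 1]
      ref_tau_pos_small[of "1/50000", simplified]
  proof eventually_elim
    case (elim L)
    define \<tau> where "\<tau> = ref_tau L"
    have \<tau>: "0 < \<tau>" "\<tau> \<le> 1 / 50000" and \<tau>2: "\<tau> \<le> 1 / 2" using elim by (auto simp: \<tau>_def)
    have err: "\<bar>lr_error \<tau> y\<bar> \<le> 1" for y
      using lr_error_le[OF \<tau>(1) \<tau>2, of y] lr_error_nonneg[OF \<tau>(1) \<tau>2, of y] \<tau> by simp
    have sq: "\<bar>(score \<tau> y)\<^sup>2\<bar> \<le> 1" for y using abs_score_le_one[OF \<tau>(1) \<tau>2, of y] by (simp add: abs_square_le_1)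
    show ?case
    proof (intro allI impI)
      fix \<theta> :: real assume \<theta>: "\<bar>\<theta>\<bar> \<le> null_radius L"
      have "4 * L * \<bar>\<theta>\<bar> \<le> 4 * L * null_radius L" using \<theta> elim by (intro mult_left_mono) auto
      then have 4: "4 * L * \<bar>\<theta>\<bar> \<le> 1" using elim by linarith
      define d where "d = 8 * L * \<bar>\<theta>\<bar>"
      have d: "0 \<le> d" "d \<le> 2" "d \<le> 8 * L * null_radius L" using 4 \<theta> elim by (auto simp: d_def intro!: mult_left_mono)
      note shift = normal_shift[OF _ _ _ 4, folded d_def]
      have 1: "\<bar>normal_mean \<theta> (score \<tau>) - normal_mean 0 (score \<tau>)\<bar>
         \<le> d * normal_mean 0 (\<lambda>y. \<bar>score \<tau> y\<bar>) + 4 * exp (- 2 * L\<^sup>2)"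
        using elim by (intro shift abs_score_le_one[OF \<tau>(1) \<tau>2]) auto
      also have "\<dots> \<le> 8 * L * null_radius L * (4 * \<tau>) + 4 * exp (- 2 * L\<^sup>2)"
        using d \<tau> abs_score_mean[OF \<tau>(1) \<tau>2] by (intro add_right_mono mult_mono) (auto intro!: integral_nonneg_AE)
      finally have s1: "\<bar>normal_mean \<theta> (score \<tau>) - normal_mean 0 (score \<tau>)\<bar>
         \<le> exp (- L\<^sup>2) / 150000" using elim by (simp add: \<tau>_def)
      have 2: "\<bar>normal_mean \<theta> (\<lambda>y. (score \<tau> y)\<^sup>2) - normal_mean 0 (\<lambda>y. (score \<tau> y)\<^sup>2)\<bar>
         \<le> d * normal_mean 0 (\<lambda>y. \<bar>(score \<tau> y)\<^sup>2\<bar>) + 4 * exp (- 2 * L\<^sup>2)"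
        using elim sq by (intro shift) auto
      have "d * normal_mean 0 (\<lambda>y. \<bar>(score \<tau> y)\<^sup>2\<bar>) \<le> 2 * (500000 * (exp (- L\<^sup>2) / sqrt L))"
        using d elim by (intro mult_mono) (auto simp: \<tau>_def intro!: integral_nonneg_AE)
      then have s2: "normal_mean \<theta> (\<lambda>y. (score \<tau> y)\<^sup>2) \<le> 2000000 * (exp (- L\<^sup>2) / sqrt L)"
        using 2 elim unfolding \<tau>_def[symmetric] by linarith
      have 3: "\<bar>normal_mean \<theta> (lr_error \<tau>) - normal_mean 0 (lr_error \<tau>)\<bar>
         \<le> d * normal_mean 0 (\<lambda>y. \<bar>lr_error \<tau> y\<bar>) + 4 * exp (- 2 * L\<^sup>2)"
        using elim err by (intro shift) auto
      have abs: "normal_mean 0 (\<lambda>y. \<bar>lr_error \<tau> y\<bar>) = normal_mean 0 (lr_error \<tau>)"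
        using lr_error_nonneg[OF \<tau>(1) \<tau>2] by simp
      have "d * normal_mean 0 (lr_error \<tau>) \<le> 2 * (100000 * \<tau>\<^sup>2)"
        using d lr_error_mean[OF \<tau>] lr_error_nonneg[OF \<tau>(1) \<tau>2] by (intro mult_mono) (auto intro!: integral_nonneg_AE)
      then have s3: "normal_mean \<theta> (lr_error \<tau>) \<le> exp (- L\<^sup>2) / L"
        using 3[unfolded abs] lr_error_mean[OF \<tau>] elim unfolding \<tau>_def[symmetric] by linarith
      have "normal_mean 0 (score \<tau>) = - normal_mean 0 (fluct \<tau>)"
        by (rule score_mean[OF \<tau>(1) \<tau>2])
      then show "normal_mean \<theta> (score (ref_tau L)) \<le> - (exp (- L\<^sup>2) / 100000) \<and>
         - (400000 * exp (- L\<^sup>2)) \<le> normal_mean \<theta> (score (ref_tau L)) \<and>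
         normal_mean \<theta> (\<lambda>y. (score (ref_tau L) y)\<^sup>2) \<le> 2000000 * (exp (- L\<^sup>2) / sqrt L) \<and>
         normal_mean \<theta> (lr_error (ref_tau L)) \<le> exp (- L\<^sup>2) / L"
        using s1 s2 s3 elim exp_ge_zero[of "- L\<^sup>2"] unfolding \<tau>_def[symmetric] by (intro conjI) linarith+
    qed
  qed
qed

section \<open>The affinity with the null density\<close>

lemma chi_square_shift:
  "has_bochner_integral lborel (\<lambda>y. (normal_density \<theta> 1 y - std_normal_density y)\<^sup>2 / std_normal_density y) (exp (\<theta>\<^sup>2) - 1)"
proof -
  have eq: "(normal_density \<theta> 1 y - std_normal_density y)\<^sup>2 / std_normal_density y
     = exp (\<theta>\<^sup>2) * normal_density (2 * \<theta>) 1 y - 2 * normal_density \<theta> 1 y + std_normal_density y" for y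
  proof -
    define p where "p = std_normal_density y"
    have p: "p > 0" unfolding p_def by (rule normal_density_pos) simp
    \<comment> \<open>Completing the square: the squared density of N(theta, 1) is exp(theta^2)
      times the product of the densities of N(2 theta, 1) and N(0, 1).\<close>
    have "normal_density \<theta> 1 y * normal_density \<theta> 1 y = exp (\<theta>\<^sup>2) * normal_density (2 * \<theta>) 1 y * p"
      by (simp add: normal_density_def p_def power2_eq_square algebra_simps flip: exp_add)
         (simp add: field_simps)
    then have "normal_density \<theta> 1 y * normal_density \<theta> 1 y / p = exp (\<theta>\<^sup>2) * normal_density (2 * \<theta>) 1 y" using p by simp
    moreover have "(N - p)\<^sup>2 / p = N * N / p - 2 * N + p" for N
    proof -
      have "(N - p)\<^sup>2 = (N * N / p - 2 * N + p) * p" using p by (simp add: power2_eq_square algebra_simps)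
      then show ?thesis using p by (simp only: nonzero_mult_div_cancel_right less_imp_neq[OF p, symmetric] not_False_eq_True)
    qed
    ultimately show ?thesis unfolding p_def[symmetric] by simp
  qed
  have "has_bochner_integral lborel (\<lambda>y. exp (\<theta>\<^sup>2) * normal_density (2 * \<theta>) 1 y - 2 * normal_density \<theta> 1 y + std_normal_density y)
     (exp (\<theta>\<^sup>2) * 1 - 2 * 1 + 1)"
    by (intro has_bochner_integral_add has_bochner_integral_diff has_bochner_integral_mult_right)
      (auto simp: has_bochner_integral_iff)
  then show ?thesis unfolding eq by simp
qed

lemma normal_density_sqrt_hs_lr_integrable:
  assumes "0 < a" "a \<le> 1"
  shows "integrable lborel (\<lambda>y. std_normal_density y * sqrt (hs_lr a y))"
    and "integrable lborel (\<lambda>y. (normal_density \<theta> 1 y - std_normal_density y) * sqrt (hs_lr a y))"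
proof -
  have R: "integrable lborel (\<lambda>y. std_normal_density y * hs_lr a y)"
    using hs_lr_mean[OF assms(1)] by (simp add: has_bochner_integral_iff)
  note nn = hs_lr_nonneg[OF assms(1)]
  have sq: "sqrt (hs_lr a y) \<le> 1 + hs_lr a y" for y
    using arith_geo_mean_sqrt[of 1 "hs_lr a y"] nn[of y] by simp
  show "integrable lborel (\<lambda>y. std_normal_density y * sqrt (hs_lr a y))"
  proof (rule Bochner_Integration.integrable_bound)
    show "integrable lborel (\<lambda>y. std_normal_density y + std_normal_density y * hs_lr a y)" using R by simp
    show "AE y in lborel. norm (std_normal_density y * sqrt (hs_lr a y)) \<le> norm (std_normal_density y + std_normal_density y * hs_lr a y)"
      using mult_left_mono[OF sq std_normal_density_nonneg] nn by (auto simp: distrib_left)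
  qed simp
  define d where "d y = normal_density \<theta> 1 y - std_normal_density y" for y
  have [measurable]: "d \<in> borel_measurable borel" unfolding d_def[abs_def] by measurable
  have "integrable lborel (\<lambda>y. d y * sqrt (hs_lr a y))"
  proof (rule Bochner_Integration.integrable_bound)
    show "integrable lborel (\<lambda>y. std_normal_density y * hs_lr a y + (d y)\<^sup>2 / std_normal_density y)"
      using R chi_square_shift[of \<theta>] by (simp add: d_def has_bochner_integral_iff)
    show "AE y in lborel. norm (d y * sqrt (hs_lr a y)) \<le> norm (std_normal_density y * hs_lr a y + (d y)\<^sup>2 / std_normal_density y)"
    proof (rule AE_I2)
      fix y
      define p where "p = std_normal_density y"
      have p: "p > 0" unfolding p_def by (rule normal_density_pos) simp
      define u v where "u = sqrt p * sqrt (hs_lr a y)" and "v = \<bar>d y\<bar> / sqrt p"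
      have "0 \<le> u * v" using p nn[of y] by (simp add: u_def v_def)
      then have "u * v \<le> u\<^sup>2 + v\<^sup>2" using sum_squares_bound[of u v] by linarith
      moreover have "u * v = \<bar>d y\<bar> * sqrt (hs_lr a y)" using p by (simp add: u_def v_def)
      moreover have "u\<^sup>2 = p * hs_lr a y" "v\<^sup>2 = (d y)\<^sup>2 / p" using p nn[of y]
        by (simp_all add: u_def v_def power_mult_distrib power_divide)
      ultimately show "norm (d y * sqrt (hs_lr a y)) \<le> norm (std_normal_density y * hs_lr a y + (d y)\<^sup>2 / std_normal_density y)"
        using p nn[of y] unfolding p_def[symmetric] by (simp add: abs_mult)
    qed
  qed simp
  then show "integrable lborel (\<lambda>y. (normal_density \<theta> 1 y - std_normal_density y) * sqrt (hs_lr a y))" by (simp add: d_def)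
qed

text \<open>From sqrt R = (1 + R)/2 - (1 - sqrt R)^2/2 and the null mean 1 of R, the affinity falls
  short of 1 by half the mean of (1 - sqrt R)^2. By \<open>hs_lr_center\<close>, 1 - sqrt R is at
  least a/40 on an interval of length 1 where phi >= 1/4.\<close>

lemma sqrt_hs_lr_mean:
  assumes a: "0 < a" "a \<le> 1"
  shows "normal_mean 0 (\<lambda>y. sqrt (hs_lr a y)) \<le> 1 - a\<^sup>2 / 20000"
proof -
  have R: "integrable lborel (\<lambda>y. std_normal_density y * hs_lr a y)" "normal_mean 0 (hs_lr a) = 1"
    using hs_lr_mean[OF a(1)] by (auto simp: has_bochner_integral_iff)
  note nn = hs_lr_nonneg[OF a(1)]
  have pt: "std_normal_density y * sqrt (hs_lr a y)
     \<le> 1 / 2 * std_normal_density y + 1 / 2 * (std_normal_density y * hs_lr a y) + (- (a\<^sup>2 / 12800)) * indicator {- (1/2)..1/2} y" for y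
  proof -
    define r where "r = sqrt (hs_lr a y)"
    define p where "p = std_normal_density y"
    have r: "0 \<le> r" "hs_lr a y = r\<^sup>2" using nn[of y] by (auto simp: r_def)
    have p: "0 \<le> p" by (simp add: p_def)
    have "p * r = 1 / 2 * p + 1 / 2 * (p * r\<^sup>2) - p * ((1 - r)\<^sup>2 / 2)" by (simp add: power2_eq_square field_simps)
    moreover have "a\<^sup>2 / 12800 * indicator {- (1/2)..1/2} y \<le> p * ((1 - r)\<^sup>2 / 2)"
    proof (cases "y \<in> {- (1/2)..1/2}")
      case True
      then have y: "\<bar>y\<bar> \<le> 1 / 2" by auto
      have r2: "r\<^sup>2 \<le> 1 - a / 20" using hs_lr_center[OF a y] r by simp
      then have "r \<le> 1" using a r by (intro power2_le_imp_le[of r 1]) auto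
      have "1 - r\<^sup>2 = (1 - r) * (1 + r)" by (simp add: power2_eq_square algebra_simps)
      also have "\<dots> \<le> (1 - r) * 2" using \<open>r \<le> 1\<close> by (intro mult_left_mono) auto
      finally have "a / 40 \<le> 1 - r" using r2 by simp
      then have "(a / 40)\<^sup>2 \<le> (1 - r)\<^sup>2" using a by (intro power_mono) auto
      then have 1: "a\<^sup>2 / 3200 \<le> (1 - r)\<^sup>2 / 2" by (simp add: power_divide)
      have "y\<^sup>2 \<le> 1 / 4" using abs_le_square_iff[of y "1/2"] y by (simp add: power_divide)
      then have "3 / 4 \<le> exp (- y\<^sup>2 / 2)" using exp_ge_add_one_self[of "- y\<^sup>2 / 2"] by simp
      moreover have "sqrt (2 * pi) \<le> 3" using pi_less_4 by (intro real_le_lsqrt) auto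
      then have "1 / 3 \<le> 1 / sqrt (2 * pi)" by (intro divide_left_mono) auto
      ultimately have "1 / 3 * (3 / 4) \<le> p" unfolding p_def std_normal_density_def by (intro mult_mono) auto
      then have "1 / 4 * (a\<^sup>2 / 3200) \<le> p * ((1 - r)\<^sup>2 / 2)" using 1 by (intro mult_mono) auto
      then show ?thesis using True by simp
    qed (use p in auto)
    ultimately show ?thesis unfolding r(2) p_def[symmetric] using r(1) by simp
  qed
  have "normal_mean 0 (\<lambda>y. sqrt (hs_lr a y))
    \<le> (LBINT y. 1 / 2 * std_normal_density y + 1 / 2 * (std_normal_density y * hs_lr a y) + (- (a\<^sup>2 / 12800)) * indicator {- (1/2)..1/2} y)"
    using normal_density_sqrt_hs_lr_integrable[OF a] R pt
    by (intro integral_mono Bochner_Integration.integrable_add integrable_mult_right) auto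
  also have "\<dots> = 1 / 2 + 1 / 2 + - (a\<^sup>2 / 12800)"
    using R by (subst integral_linear_three) auto
  also have "\<dots> \<le> 1 - a\<^sup>2 / 20000" using a by simp
  finally show ?thesis .
qed

text \<open>\<open>normal_shift\<close> does not apply because sqrt R is unbounded. The change is
  bounded by the arithmetic-geometric mean inequality with weight nu, playing the null mean 1 of R
  against the chi-square distance, which is at most 2 nu^2.\<close>

lemma sqrt_hs_lr_mean_near_null:
  assumes a: "0 < a" "a \<le> 1" and \<theta>: "\<bar>\<theta>\<bar> \<le> \<nu>" "0 < \<nu>" "\<nu> \<le> 1"
  shows "integrable lborel (\<lambda>y. normal_density \<theta> 1 y * sqrt (hs_lr a y))"
    and "normal_mean \<theta> (\<lambda>y. sqrt (hs_lr a y)) \<le> 1 - a\<^sup>2 / 20000 + 2 * \<nu>"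
proof -
  have R: "integrable lborel (\<lambda>y. std_normal_density y * hs_lr a y)" "normal_mean 0 (hs_lr a) = 1"
    using hs_lr_mean[OF a(1)] by (auto simp: has_bochner_integral_iff)
  note nn = hs_lr_nonneg[OF a(1)]
  define d where "d y = normal_density \<theta> 1 y - std_normal_density y" for y
  have X: "integrable lborel (\<lambda>y. (d y)\<^sup>2 / std_normal_density y)" "(LBINT y. (d y)\<^sup>2 / std_normal_density y) = exp (\<theta>\<^sup>2) - 1"
    using chi_square_shift[of \<theta>] by (auto simp: has_bochner_integral_iff d_def)
  have I: "integrable lborel (\<lambda>y. std_normal_density y * sqrt (hs_lr a y))" "integrable lborel (\<lambda>y. d y * sqrt (hs_lr a y))"
    using normal_density_sqrt_hs_lr_integrable[OF a] by (auto simp: d_def)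
  have eq: "(\<lambda>y. normal_density \<theta> 1 y * sqrt (hs_lr a y)) = (\<lambda>y. std_normal_density y * sqrt (hs_lr a y) + d y * sqrt (hs_lr a y))"
    by (simp add: d_def algebra_simps)
  show "integrable lborel (\<lambda>y. normal_density \<theta> 1 y * sqrt (hs_lr a y))" unfolding eq using I by simp
  have pt: "d y * sqrt (hs_lr a y) \<le> \<nu> / 2 * (std_normal_density y * hs_lr a y) + 1 / (2 * \<nu>) * ((d y)\<^sup>2 / std_normal_density y)" for y
  proof -
    define p where "p = std_normal_density y"
    have p: "p > 0" unfolding p_def by (rule normal_density_pos) simp
    define u v where "u = sqrt (\<nu> * p) * sqrt (hs_lr a y)" and "v = d y / sqrt (\<nu> * p)"
    have "2 * (u * v) \<le> u\<^sup>2 + v\<^sup>2" using sum_squares_bound[of u v] by simp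
    moreover have "u * v = d y * sqrt (hs_lr a y)" using p \<theta> by (simp add: u_def v_def)
    moreover have "u\<^sup>2 = \<nu> * (p * hs_lr a y)" "v\<^sup>2 = 1 / \<nu> * ((d y)\<^sup>2 / p)" using p nn[of y] \<theta>
      by (simp_all add: u_def v_def power_mult_distrib power_divide)
    ultimately show ?thesis unfolding p_def[symmetric] by simp
  qed
  have "(LBINT y. d y * sqrt (hs_lr a y))
     \<le> (LBINT y. \<nu> / 2 * (std_normal_density y * hs_lr a y) + 1 / (2 * \<nu>) * ((d y)\<^sup>2 / std_normal_density y))"
    using pt R X I by (intro integral_mono Bochner_Integration.integrable_add integrable_mult_right) auto
  also have "\<dots> = \<nu> / 2 + 1 / (2 * \<nu>) * (exp (\<theta>\<^sup>2) - 1)"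
    using integral_linear_two[OF R(1) X(1), of "\<nu> / 2" "1 / (2 * \<nu>)"] unfolding R(2) X(2) mult_1_right .
  also have "\<dots> \<le> \<nu> / 2 + 1 / (2 * \<nu>) * (2 * \<nu>\<^sup>2)"
  proof -
    have "\<theta>\<^sup>2 \<le> \<nu>\<^sup>2" using \<theta> by (metis abs_ge_zero power2_abs power_mono)
    moreover have "\<nu>\<^sup>2 \<le> 1" using \<theta> by (simp add: power_le_one)
    ultimately have "exp (\<theta>\<^sup>2) - 1 \<le> 2 * \<nu>\<^sup>2" using abs_exp_minus_one_le[of "\<theta>\<^sup>2"] by simp
    then show ?thesis using \<theta> by (intro add_left_mono mult_left_mono) auto
  qed
  also have "\<dots> \<le> 2 * \<nu>" using \<theta> by (simp add: power2_eq_square)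
  finally show "normal_mean \<theta> (\<lambda>y. sqrt (hs_lr a y)) \<le> 1 - a\<^sup>2 / 20000 + 2 * \<nu>"
    unfolding eq using I sqrt_hs_lr_mean[OF a] by simp
qed

section \<open>Sums and products of independent coordinates\<close>

lemma prob_space_data_law: "prob_space (data_law n \<theta>)"
  unfolding data_law_def by (intro prob_space_PiM prob_space_normal_density) simp

lemma sets_data_law [measurable_cong]: "sets (data_law n \<theta>) = sets (data_space n)"
  unfolding data_law_def data_space_def by (intro sets_PiM_cong) auto

lemma space_data_law: "space (data_law n \<theta>) = space (data_space n)"
  by (rule sets_eq_imp_space_eq[OF sets_data_law])

lemma data_law_component_measurable [measurable]:
  "i \<in> {1..n} \<Longrightarrow> (\<lambda>Y. Y i) \<in> borel_measurable (data_law n \<theta>)"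
  unfolding measurable_cong_sets[OF sets_data_law refl] data_space_def by measurable

lemma distr_data_law_component:
  assumes "i \<in> {1..n}"
  shows "distr (data_law n \<theta>) borel (\<lambda>Y. Y i) = density lborel (normal_density (\<theta> i) 1)"
proof -
  have "distr (data_law n \<theta>) (density lborel (normal_density (\<theta> i) 1)) (\<lambda>Y. Y i) = density lborel (normal_density (\<theta> i) 1)"
    unfolding data_law_def by (rule distr_PiM_component[OF prob_space_normal_density assms]) simp
  moreover have "distr (data_law n \<theta>) (density lborel (normal_density (\<theta> i) 1)) (\<lambda>Y. Y i) = distr (data_law n \<theta>) borel (\<lambda>Y. Y i)"
    by (intro distr_cong) auto
  ultimately show ?thesis by simp
qed

lemma data_law_component_integral:
  fixes g :: "real \<Rightarrow> real"
  assumes i: "i \<in> {1..n}" and [measurable]: "g \<in> borel_measurable borel"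
  shows "(\<integral>Y. g (Y i) \<partial>data_law n \<theta>) = normal_mean (\<theta> i) g"
    and "integrable (data_law n \<theta>) (\<lambda>Y. g (Y i)) \<longleftrightarrow> integrable lborel (\<lambda>y. normal_density (\<theta> i) 1 y * g y)"
proof -
  have m: "(\<lambda>Y. Y i) \<in> measurable (data_law n \<theta>) borel" using i by measurable
  show "(\<integral>Y. g (Y i) \<partial>data_law n \<theta>) = normal_mean (\<theta> i) g"
    using integral_distr[OF m, of g] unfolding distr_data_law_component[OF i] by (simp add: integral_density)
  show "integrable (data_law n \<theta>) (\<lambda>Y. g (Y i)) \<longleftrightarrow> integrable lborel (\<lambda>y. normal_density (\<theta> i) 1 y * g y)"
    using integrable_distr_eq[OF m, of g] unfolding distr_data_law_component[OF i] by (simp add: integrable_density)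
qed

lemma data_law_bounded_integrable:
  fixes g :: "real \<Rightarrow> real"
  assumes "i \<in> {1..n}" "g \<in> borel_measurable borel" "\<And>y. \<bar>g y\<bar> \<le> B"
  shows "integrable (data_law n \<theta>) (\<lambda>Y. g (Y i))"
  using assms by (subst data_law_component_integral) (auto intro: normal_density_bounded_integrable)

lemma data_law_sum_Markov:
  fixes g :: "nat \<Rightarrow> real \<Rightarrow> real" and m :: real
  assumes I: "I \<subseteq> {1..n}" and [measurable]: "\<And>i. g i \<in> borel_measurable borel"
    and g: "\<And>i y. 0 \<le> g i y" "\<And>i y. g i y \<le> 1"
    and m: "\<And>i. i \<in> I \<Longrightarrow> normal_mean (\<theta> i) (g i) \<le> m" and t: "0 < t"
  shows "measure (data_law n \<theta>) {Y \<in> space (data_law n \<theta>). t \<le> (\<Sum>i\<in>I. g i (Y i))} \<le> card I * m / t"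
proof -
  have fin: "finite I" using I finite_subset by blast
  have int: "integrable (data_law n \<theta>) (\<lambda>Y. g i (Y i))" if "i \<in> I" for i
    using that I g by (intro data_law_bounded_integrable[where B=1]) auto
  have "measure (data_law n \<theta>) {Y \<in> space (data_law n \<theta>). t \<le> (\<Sum>i\<in>I. g i (Y i))}
     \<le> (\<integral>Y. (\<Sum>i\<in>I. g i (Y i)) \<partial>data_law n \<theta>) / t"
    using int t g by (intro integral_Markov_inequality_measure[where A="{}"]) (auto intro!: sum_nonneg)
  also have "(\<integral>Y. (\<Sum>i\<in>I. g i (Y i)) \<partial>data_law n \<theta>) = (\<Sum>i\<in>I. normal_mean (\<theta> i) (g i))"
    using int I by (subst Bochner_Integration.integral_sum) (auto intro!: sum.cong data_law_component_integral)
  also have "\<dots> \<le> card I * m" using m by (rule sum_bounded_above)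
  finally show ?thesis using t by (simp add: divide_right_mono)
qed

lemma product_sigma_finite_normal: "product_sigma_finite (\<lambda>i. density lborel (normal_density (\<theta> i) 1))"
  by (intro product_sigma_finite.intro prob_space_imp_sigma_finite prob_space_normal_density) simp

lemma measure_normal_UNIV: "measure (density lborel (normal_density \<mu> 1)) UNIV = 1"
  using prob_space.prob_space[OF prob_space_normal_density[of 1 \<mu>]] by simp

lemma data_law_product_pair:
  fixes g h :: "real \<Rightarrow> real"
  assumes ij: "i \<in> {1..n}" "j \<in> {1..n}" "i \<noteq> j" and [measurable]: "g \<in> borel_measurable borel" "h \<in> borel_measurable borel"
    and b: "\<And>y. \<bar>g y\<bar> \<le> B" "\<And>y. \<bar>h y\<bar> \<le> B"
  shows "(\<integral>Y. g (Y i) * h (Y j) \<partial>data_law n \<theta>)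
     = normal_mean (\<theta> i) g * normal_mean (\<theta> j) h"
proof -
  let ?M = "\<lambda>i. density lborel (normal_density (\<theta> i) 1)"
  interpret product_sigma_finite ?M by (rule product_sigma_finite_normal)
  \<comment> \<open>The formula for integrals of products needs a factor at every coordinate, so the
    others get the constant 1.\<close>
  define f where "f k = (if k = i then g else if k = j then h else (\<lambda>_. 1))" for k
  have prod2: "(\<Prod>k\<in>{1..n}. F k) = F i * F j" if "\<And>k. k \<noteq> i \<Longrightarrow> k \<noteq> j \<Longrightarrow> F k = 1" for F :: "nat \<Rightarrow> real"
  proof -
    have "(\<Prod>k\<in>{1..n}. F k) = (\<Prod>k\<in>{i, j}. F k)"
      using ij that by (intro prod.mono_neutral_right) auto
    then show ?thesis using ij by simp
  qed
  have fint: "integrable (?M k) (f k)" for k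
  proof -
    have "integrable lborel (\<lambda>y. normal_density (\<theta> k) 1 y * f k y)"
    proof (rule normal_density_bounded_integrable)
      show "\<bar>f k y\<bar> \<le> max B 1" for y using b[of y] by (auto simp: f_def)
    qed (simp add: f_def)
    then show ?thesis by (subst integrable_density) (auto simp: f_def)
  qed
  have "(\<integral>Y. g (Y i) * h (Y j) \<partial>data_law n \<theta>) = (\<integral>Y. (\<Prod>k\<in>{1..n}. f k (Y k)) \<partial>data_law n \<theta>)"
    using ij by (subst prod2) (auto simp: f_def)
  also have "\<dots> = (\<Prod>k\<in>{1..n}. integral\<^sup>L (?M k) (f k))"
    unfolding data_law_def by (rule product_integral_prod) (auto intro: fint)
  also have "\<dots> = integral\<^sup>L (?M i) (f i) * integral\<^sup>L (?M j) (f j)"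
    by (rule prod2) (simp add: f_def measure_normal_UNIV)
  finally show ?thesis using ij by (simp add: f_def integral_density)
qed

text \<open>The centred terms of distinct coordinates are uncorrelated by
  \<open>data_law_product_pair\<close>, and each variance is at most the second moment.\<close>

lemma data_law_sum_Chebyshev:
  fixes g :: "real \<Rightarrow> real" and v :: real
  assumes I: "I \<subseteq> {1..n}" and [measurable]: "g \<in> borel_measurable borel" and g: "\<And>y. \<bar>g y\<bar> \<le> 1"
    and v: "\<And>i. i \<in> I \<Longrightarrow> normal_mean (\<theta> i) (\<lambda>y. (g y)\<^sup>2) \<le> v" and t: "0 < t"
  shows "measure (data_law n \<theta>) {Y \<in> space (data_law n \<theta>).
      t \<le> \<bar>(\<Sum>i\<in>I. g (Y i)) - (\<Sum>i\<in>I. normal_mean (\<theta> i) g)\<bar>} \<le> card I * v / t\<^sup>2"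
proof -
  interpret prob_space "data_law n \<theta>" by (rule prob_space_data_law)
  have fin: "finite I" using I finite_subset by blast
  define \<mu> where "\<mu> i = normal_mean (\<theta> i) g" for i
  define X where "X i y = g y - \<mu> i" for i y
  have [measurable]: "X i \<in> borel_measurable borel" for i unfolding X_def[abs_def] by measurable
  have sq: "\<bar>(g y)\<^sup>2\<bar> \<le> 1" for y using g[of y] by (simp add: abs_square_le_1)
  have gi: "integrable lborel (\<lambda>y. normal_density (\<theta> i) 1 y * g y)"
    "integrable lborel (\<lambda>y. normal_density (\<theta> i) 1 y * (g y)\<^sup>2)" for i
    using g sq by (auto intro!: normal_density_bounded_integrable[where B=1])
  have \<mu>1: "\<bar>\<mu> i\<bar> \<le> 1" for i
  proof -
    have "\<bar>\<mu> i\<bar> \<le> (LBINT y. \<bar>normal_density (\<theta> i) 1 y * g y\<bar>)" unfolding \<mu>_def by (rule integral_abs_bound)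
    also have "\<dots> \<le> (LBINT y. normal_density (\<theta> i) 1 y)"
      using g normal_density_bounded_integrable[of "\<lambda>y. \<bar>g y\<bar>" 1 "\<theta> i"]
      by (intro integral_mono) (auto simp: abs_mult mult_left_le)
    finally show ?thesis by simp
  qed
  have Xb: "\<bar>X i y\<bar> \<le> 2" for i y using g[of y] \<mu>1[of i] unfolding X_def by linarith
  have X0: "normal_mean (\<theta> i) (X i) = 0" for i
    using gi by (simp add: X_def right_diff_distrib \<mu>_def)
  have X2: "normal_mean (\<theta> i) (\<lambda>y. (X i y)\<^sup>2) \<le> v" if "i \<in> I" for i
  proof -
    have "normal_mean (\<theta> i) (\<lambda>y. (X i y)\<^sup>2)
      = (LBINT y. 1 * (normal_density (\<theta> i) 1 y * (g y)\<^sup>2) + (- 2 * \<mu> i) * (normal_density (\<theta> i) 1 y * g y) + (\<mu> i)\<^sup>2 * normal_density (\<theta> i) 1 y)"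
      by (intro Bochner_Integration.integral_cong) (auto simp: X_def power2_eq_square algebra_simps)
    also have "\<dots> = normal_mean (\<theta> i) (\<lambda>y. (g y)\<^sup>2) + (- 2 * \<mu> i) * \<mu> i + (\<mu> i)\<^sup>2"
      using gi by (subst integral_linear_three) (auto simp: \<mu>_def)
    also have "\<dots> \<le> normal_mean (\<theta> i) (\<lambda>y. (g y)\<^sup>2)" by (simp add: power2_eq_square)
    finally show ?thesis using v[OF that] by simp
  qed
  have XX: "integrable (data_law n \<theta>) (\<lambda>Y. X i (Y i) * X j (Y j))" if "i \<in> I" "j \<in> I" for i j
  proof (rule integrable_const_bound[where B = 4])
    show "AE Y in data_law n \<theta>. norm (X i (Y i) * X j (Y j)) \<le> 4"
    proof (rule AE_I2)
      fix Y
      have "\<bar>X i (Y i)\<bar> * \<bar>X j (Y j)\<bar> \<le> 2 * 2" using Xb by (intro mult_mono) auto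
      then show "norm (X i (Y i) * X j (Y j)) \<le> 4" by (simp add: abs_mult)
    qed
    have [measurable]: "i \<in> {1..n}" "j \<in> {1..n}" using that I by auto
    show "(\<lambda>Y. X i (Y i) * X j (Y j)) \<in> borel_measurable (data_law n \<theta>)" by measurable
  qed
  define S where "S Y = (\<Sum>i\<in>I. X i (Y i))" for Y
  have S2: "(S Y)\<^sup>2 = (\<Sum>i\<in>I. \<Sum>j\<in>I. X i (Y i) * X j (Y j))" for Y
    unfolding S_def power2_eq_square by (rule sum_product)
  have int: "integrable (data_law n \<theta>) (\<lambda>Y. (S Y)\<^sup>2)" unfolding S2 using XX by auto
  have "(\<integral>Y. (S Y)\<^sup>2 \<partial>data_law n \<theta>) = (\<Sum>i\<in>I. \<Sum>j\<in>I. \<integral>Y. X i (Y i) * X j (Y j) \<partial>data_law n \<theta>)"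
    unfolding S2 using XX by (simp add: Bochner_Integration.integral_sum)
  also have "\<dots> = (\<Sum>i\<in>I. normal_mean (\<theta> i) (\<lambda>y. (X i y)\<^sup>2))"
  proof (intro sum.cong refl)
    fix i assume i: "i \<in> I"
    have "(\<Sum>j\<in>I. \<integral>Y. X i (Y i) * X j (Y j) \<partial>data_law n \<theta>) = (\<Sum>j\<in>{i}. \<integral>Y. X i (Y i) * X j (Y j) \<partial>data_law n \<theta>)"
    proof (intro sum.mono_neutral_right ballI)
      fix j assume "j \<in> I - {i}"
      then show "(\<integral>Y. X i (Y i) * X j (Y j) \<partial>data_law n \<theta>) = 0"
        using i I by (subst data_law_product_pair[where B=2]) (auto simp: Xb X0)
    qed (use i fin in auto)
    also have "\<dots> = normal_mean (\<theta> i) (\<lambda>y. (X i y)\<^sup>2)"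
      using i I data_law_component_integral(1)[of i n "\<lambda>y. (X i y)\<^sup>2" \<theta>] by (auto simp: power2_eq_square)
    finally show "(\<Sum>j\<in>I. \<integral>Y. X i (Y i) * X j (Y j) \<partial>data_law n \<theta>) = normal_mean (\<theta> i) (\<lambda>y. (X i y)\<^sup>2)" .
  qed
  also have "\<dots> \<le> card I * v" using X2 by (rule sum_bounded_above)
  finally have var: "(\<integral>Y. (S Y)\<^sup>2 \<partial>data_law n \<theta>) \<le> card I * v" .
  have meas: "S \<in> borel_measurable (data_law n \<theta>)"
    unfolding S_def[abs_def] using I by (intro borel_measurable_sum) (auto intro!: measurable_compose[OF data_law_component_measurable])
  have "measure (data_law n \<theta>) {Y \<in> space (data_law n \<theta>). t \<le> \<bar>S Y\<bar>} \<le> (\<integral>Y. (S Y)\<^sup>2 \<partial>data_law n \<theta>) / t\<^sup>2"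
    using second_moment_method[OF meas int t] .
  also have "\<dots> \<le> card I * v / t\<^sup>2" using var by (intro divide_right_mono) auto
  finally show ?thesis by (simp add: S_def X_def sum_subtractf \<mu>_def)
qed

lemma data_law_prod_Markov:
  fixes g :: "real \<Rightarrow> real" and m :: real
  assumes I: "I \<subseteq> {1..n}" and [measurable]: "g \<in> borel_measurable borel" and g: "\<And>y. 0 \<le> g y"
    and int: "\<And>i. i \<in> I \<Longrightarrow> integrable lborel (\<lambda>y. normal_density (\<theta> i) 1 y * g y)"
    and m: "\<And>i. i \<in> I \<Longrightarrow> normal_mean (\<theta> i) g \<le> m" and c: "0 < c"
  shows "measure (data_law n \<theta>) {Y \<in> space (data_law n \<theta>). c \<le> (\<Prod>i\<in>I. g (Y i))} \<le> m ^ card I / c"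
proof -
  let ?M = "\<lambda>i. density lborel (normal_density (\<theta> i) 1)"
  interpret product_sigma_finite ?M by (rule product_sigma_finite_normal)
  have fin: "finite I" using I finite_subset by blast
  define f where "f k = (if k \<in> I then g else (\<lambda>_. 1))" for k
  have fint: "integrable (?M k) (f k)" for k
    using int by (subst integrable_density) (auto simp: f_def)
  have fI: "(\<Prod>k\<in>{1..n}. f k (Y k)) = (\<Prod>i\<in>I. g (Y i))" for Y
    using I by (simp add: f_def prod.If_cases Int_absorb1 if_distrib[of "\<lambda>h. h _"] cong: if_cong)
  have int': "integrable (data_law n \<theta>) (\<lambda>Y. \<Prod>i\<in>I. g (Y i))"
    unfolding fI[symmetric] data_law_def by (rule product_integrable_prod) (auto intro: fint)
  have "(\<integral>Y. (\<Prod>i\<in>I. g (Y i)) \<partial>data_law n \<theta>) = (\<Prod>k\<in>{1..n}. integral\<^sup>L (?M k) (f k))"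
    unfolding fI[symmetric] data_law_def by (rule product_integral_prod) (auto intro: fint)
  also have "\<dots> = (\<Prod>k\<in>I. integral\<^sup>L (?M k) g)"
    using I by (intro prod.mono_neutral_cong_right) (auto simp: f_def measure_normal_UNIV)
  also have "\<dots> = (\<Prod>i\<in>I. normal_mean (\<theta> i) g)" by (simp add: integral_density)
  also have "\<dots> \<le> (\<Prod>i\<in>I. m)" using m g by (intro prod_mono) (auto intro!: integral_nonneg_AE)
  finally have E: "(\<integral>Y. (\<Prod>i\<in>I. g (Y i)) \<partial>data_law n \<theta>) \<le> m ^ card I" by simp
  have "measure (data_law n \<theta>) {Y \<in> space (data_law n \<theta>). c \<le> (\<Prod>i\<in>I. g (Y i))}
     \<le> (\<integral>Y. (\<Prod>i\<in>I. g (Y i)) \<partial>data_law n \<theta>) / c"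
    using int' c g by (intro integral_Markov_inequality_measure[where A="{}"]) (auto intro!: prod_nonneg)
  also have "\<dots> \<le> m ^ card I / c" using E c by (intro divide_right_mono) auto
  finally show ?thesis .
qed

lemma marginal_likelihood_eq:
  assumes "0 < \<tau>"
  shows "marginal_likelihood n Y \<tau> = (\<Prod>i = 1..n. std_normal_density (Y i)) * (\<Prod>i = 1..n. hs_lr \<tau> (Y i))"
  unfolding marginal_likelihood_def using assms by (simp add: horseshoe_marginal prod.distrib)

section \<open>Location of the maximiser for typical data\<close>

abbreviation log_lr :: "real \<Rightarrow> real \<Rightarrow> real \<Rightarrow> real" where
  "log_lr \<tau> \<sigma> y \<equiv> ln (hs_lr \<tau> y) - ln (hs_lr \<sigma> y)"

lemma hs_lr_ge:
  assumes "0 < \<tau>"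
  shows "1 - \<tau> \<le> hs_lr \<tau> y"
proof -
  have "half_cauchy \<tau> s - \<tau> * half_cauchy 1 s \<le> normal_lr s y * half_cauchy \<tau> s" for s
  proof (cases "0 < s")
    case True
    define a d where "a = 2 / pi * \<tau>" and "d = \<tau>\<^sup>2 + s\<^sup>2"
    have pos: "0 < a" "0 < d" "0 < 1 + s\<^sup>2" using assms True by (auto simp: a_def d_def add_pos_nonneg)
    have "1 / (1 + s\<^sup>2) * (a / d) - (a / d - a / (1 + s\<^sup>2)) = a * \<tau>\<^sup>2 / ((1 + s\<^sup>2) * d)"
      using pos by (simp add: divide_simps) (simp add: d_def algebra_simps power2_eq_square)
    also have "\<dots> \<ge> 0" using pos by auto
    finally have "a / d - a / (1 + s\<^sup>2) \<le> 1 / (1 + s\<^sup>2) * (a / d)" by simp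
    also have "\<dots> \<le> normal_lr s y * (a / d)" using pos normal_lr_ge by (intro mult_right_mono) auto
    finally have "a / d - a / (1 + s\<^sup>2) \<le> normal_lr s y * (a / d)" .
    moreover have "half_cauchy \<tau> s = a / d" "\<tau> * half_cauchy 1 s = a / (1 + s\<^sup>2)"
      using True by (simp_all add: half_cauchy_def a_def d_def)
    ultimately show ?thesis by simp
  qed (simp add: half_cauchy_def)
  then have "(LBINT s. half_cauchy \<tau> s - \<tau> * half_cauchy 1 s) \<le> hs_lr \<tau> y"
    unfolding hs_lr_def using assms
    by (intro integral_mono hs_lr_integrable Bochner_Integration.integrable_diff integrable_mult_right half_cauchy_integral) auto
  then show ?thesis using assms by (simp add: half_cauchy_integral)
qed

text \<open>\<open>hs_lr_ge\<close> gives nothing at tau = 1, so positivity comes from the scales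
  between 1 and 2, where \<open>normal_lr\<close> is at least 1/5.\<close>

lemma hs_lr_pos:
  assumes "0 < \<tau>"
  shows "0 < hs_lr \<tau> y"
proof -
  define c where "c = 1 / 5 * (2 / pi * \<tau> / (\<tau>\<^sup>2 + 4))"
  have c: "0 < c" using assms by (auto simp: c_def intro!: divide_pos_pos mult_pos_pos add_pos_pos)
  have "c * indicator {1..2} s \<le> normal_lr s y * half_cauchy \<tau> s" for s :: real
  proof (cases "s \<in> {1..2}")
    case True
    then have s: "0 < s" "s\<^sup>2 \<le> 4" using power_mono[of s 2 2] by auto
    have "1 / 5 \<le> 1 / (1 + s\<^sup>2)" using s by (intro divide_left_mono) (auto simp: add_pos_nonneg)
    then have "1 / 5 \<le> normal_lr s y" using normal_lr_ge[of s y] by linarith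
    moreover have "2 / pi * \<tau> / (\<tau>\<^sup>2 + 4) \<le> half_cauchy \<tau> s"
      unfolding half_cauchy_def using s assms by (auto intro!: divide_left_mono mult_pos_pos add_pos_pos)
    ultimately have "c \<le> normal_lr s y * half_cauchy \<tau> s" unfolding c_def using assms by (intro mult_mono) auto
    then show ?thesis using True by simp
  qed (use assms half_cauchy_nonneg[of \<tau>] in auto)
  then have "(LBINT s. c * indicator {1..2::real} s) \<le> hs_lr \<tau> y"
    unfolding hs_lr_def using assms by (intro integral_mono hs_lr_integrable) auto
  then show ?thesis using c by simp
qed

section \<open>Comparison of one coordinate with the reference scale\<close>

context
  fixes \<tau>0 :: real
  assumes \<tau>0: "0 < \<tau>0" "\<tau>0 \<le> 1 / 100000"
begin

lemma tau0_half: "\<tau>0 \<le> 1 / 2"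
  using \<tau>0 by simp

lemma lr_error_le_half: "lr_error \<tau>0 y \<le> 1 / 2"
  using lr_error_le[OF \<tau>0(1) tau0_half, of y] \<tau>0 by simp

text \<open>The ratio of \<open>linear_lr\<close> at tau and at \<open>\<tau>0\<close> is exactly 1
  + (tau/\<open>\<tau>0\<close> - 1) \<open>score \<tau>0 y\<close>, and ln (1 + x) <= x; this works
  on both sides of \<open>\<tau>0\<close>. The remaining terms are the two linearisation
  errors.\<close>

lemma log_lr_diff_le:
  assumes \<tau>: "0 < \<tau>" "\<tau> \<le> 1 / 2"
  shows "log_lr \<tau> \<tau>0 y \<le> (\<tau> / \<tau>0 - 1) * score \<tau>0 y + 2 * \<tau>\<^sup>2 + 2 * lr_error \<tau>0 y"
proof -
  define D D0 u where "D = linear_lr \<tau> y" and "D0 = linear_lr \<tau>0 y" and "u = lr_error \<tau>0 y"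
  have D: "1 / 2 \<le> D" "1 / 2 \<le> D0" unfolding D_def D0_def using linear_lr_ge \<tau> \<tau>0(1) tau0_half by auto
  have u: "0 \<le> u" "u \<le> 1 / 2" unfolding u_def using lr_error_nonneg[OF \<tau>0(1) tau0_half] lr_error_le_half by auto
  have "D * (1 + \<tau>\<^sup>2 / D) = D + \<tau>\<^sup>2" using D by (simp add: distrib_left)
  then have "hs_lr \<tau> y \<le> D * (1 + \<tau>\<^sup>2 / D)" using hs_lr_le_linear[OF \<tau>, of y] by (simp add: D_def)
  then have "ln (hs_lr \<tau> y) \<le> ln (D * (1 + \<tau>\<^sup>2 / D))"
    using hs_lr_pos[OF \<tau>(1), of y] by (intro ln_mono) auto
  also have "\<dots> = ln D + ln (1 + \<tau>\<^sup>2 / D)" using D by (intro ln_mult_pos) (auto intro!: add_pos_nonneg divide_nonneg_pos)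
  also have "ln (1 + \<tau>\<^sup>2 / D) \<le> \<tau>\<^sup>2 / D" using D by (intro ln_add_one_self_le_self) auto
  also have "\<tau>\<^sup>2 / D \<le> \<tau>\<^sup>2 / (1 / 2)" using D by (intro divide_left_mono) auto
  finally have 1: "ln (hs_lr \<tau> y) \<le> ln D + 2 * \<tau>\<^sup>2" by simp
  have "ln D0 + ln (1 - u) = ln (D0 * (1 - u))" using D u by (subst ln_mult_pos) auto
  also have "\<dots> \<le> ln (hs_lr \<tau>0 y)" unfolding D0_def u_def using D u hs_lr_ge_linear[OF \<tau>0(1) tau0_half, of y]
    by (intro ln_mono) (auto simp: D0_def u_def intro!: mult_pos_pos)
  finally have 2: "ln D0 + ln (1 - u) \<le> ln (hs_lr \<tau>0 y)" .
  have "- u - 2 * u\<^sup>2 \<le> ln (1 - u)" using u by (intro ln_one_minus_pos_lower_bound) auto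
  moreover have "2 * u\<^sup>2 \<le> u" using mult_left_mono[OF u(2) u(1)] by (simp add: power2_eq_square)
  ultimately have 3: "- (2 * u) \<le> ln (1 - u)" by linarith
  have "D = D0 * (1 + (\<tau> / \<tau>0 - 1) * score \<tau>0 y)"
  proof -
    have "D0 * ((\<tau> / \<tau>0 - 1) * score \<tau>0 y) = (\<tau> / \<tau>0 - 1) * (\<tau>0 * (lr_slope y - 1))"
      using D by (simp add: score_def D0_def)
    also have "\<dots> = (\<tau> - \<tau>0) * (lr_slope y - 1)" using \<tau>0 by (simp add: field_simps)
    finally show ?thesis by (simp add: D_def D0_def linear_lr_def algebra_simps)
  qed
  then have e: "1 + (\<tau> / \<tau>0 - 1) * score \<tau>0 y = D / D0" using D by simp
  have "ln D - ln D0 = ln (D / D0)" using D by (simp add: ln_div)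
  also have "\<dots> \<le> D / D0 - 1" using D by (intro ln_le_minus_one) auto
  also have "\<dots> = (\<tau> / \<tau>0 - 1) * score \<tau>0 y" using e by simp
  finally show ?thesis using 1 2 3 unfolding u_def by linarith
qed

lemma hs_lr_ref_ge: "(1 + \<tau>0 * lr_slope y) / 4 \<le> hs_lr \<tau>0 y"
proof -
  define D0 where "D0 = linear_lr \<tau>0 y"
  have "0 \<le> \<tau>0 * lr_slope y" using \<tau>0 lr_slope_nonneg by simp
  then have D0: "(1 + \<tau>0 * lr_slope y) / 2 \<le> D0" using \<tau>0 by (simp add: D0_def linear_lr_def)
  have "D0 * (1 / 2) \<le> D0 * (1 - lr_error \<tau>0 y)"
    using lr_error_le_half[of y] linear_lr_pos[OF \<tau>0(1) tau0_half, of y] by (intro mult_left_mono) (auto simp: D0_def)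
  also have "\<dots> \<le> hs_lr \<tau>0 y" unfolding D0_def by (rule hs_lr_ge_linear[OF \<tau>0(1) tau0_half])
  finally show ?thesis using D0 by simp
qed

lemma hs_lr_le_one_plus:
  assumes "0 < \<tau>" "\<tau> \<le> 1"
  shows "hs_lr \<tau> y \<le> 1 + \<tau> * lr_slope y"
proof -
  have "\<tau>\<^sup>2 \<le> \<tau>" using assms by (simp add: power2_eq_square mult_le_cancel_right1)
  then show ?thesis using hs_lr_upper[OF assms(1), of y] by simp
qed

lemma log_lr_diff_le_const:
  assumes \<tau>: "0 < \<tau>" "\<tau> \<le> \<tau>0"
  shows "log_lr \<tau> \<tau>0 y \<le> ln 4"
proof -
  have "hs_lr \<tau> y \<le> 1 + \<tau> * lr_slope y" using assms \<tau>0 by (intro hs_lr_le_one_plus) auto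
  also have "\<dots> \<le> 1 + \<tau>0 * lr_slope y" using assms lr_slope_nonneg[of y] by (intro add_left_mono mult_right_mono) auto
  also have "\<dots> \<le> 4 * hs_lr \<tau>0 y" using hs_lr_ref_ge[of y] by simp
  finally have "ln (hs_lr \<tau> y) \<le> ln (4 * hs_lr \<tau>0 y)" using hs_lr_pos \<tau> \<tau>0 by (intro ln_mono) auto
  also have "\<dots> = ln 4 + ln (hs_lr \<tau>0 y)" using hs_lr_pos \<tau>0 by (intro ln_mult_pos) auto
  finally show ?thesis by simp
qed

text \<open>With V = \<open>\<tau>0 * lr_slope y\<close> >= C, the likelihood ratio is at least V/4
  at \<open>\<tau>0\<close> and at most 1 + V/C <= 2V/C at tau.\<close>

lemma log_lr_diff_le_signal:
  assumes \<tau>: "0 < \<tau>" "\<tau> \<le> \<tau>0 / C" and C: "1 \<le> C" "C \<le> \<tau>0 * lr_slope y"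
  shows "log_lr \<tau> \<tau>0 y \<le> ln (8 / C)"
proof -
  define V where "V = \<tau>0 * lr_slope y"
  have V: "C \<le> V" "0 < V" using C by (auto simp: V_def)
  have "\<tau>0 / C \<le> \<tau>0 / 1" using C \<tau>0 by (intro divide_left_mono) auto
  then have "\<tau> \<le> 1" using \<tau> \<tau>0 by simp
  then have "hs_lr \<tau> y \<le> 1 + \<tau> * lr_slope y" using assms by (intro hs_lr_le_one_plus) auto
  also have "\<tau> * lr_slope y \<le> \<tau>0 / C * lr_slope y" using \<tau> lr_slope_nonneg[of y] by (intro mult_right_mono) auto
  also have "\<dots> = V / C" by (simp add: V_def)
  also have "1 + V / C \<le> V / C + V / C" using V C by (intro add_right_mono) simp
  also have "\<dots> = 8 / C * (V / 4)" by simp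
  also have "\<dots> \<le> 8 / C * hs_lr \<tau>0 y" using hs_lr_ref_ge[of y] C by (intro mult_left_mono) (auto simp: V_def)
  finally have "ln (hs_lr \<tau> y) \<le> ln (8 / C * hs_lr \<tau>0 y)" using hs_lr_pos \<tau> \<tau>0 C by (intro ln_mono) auto
  also have "\<dots> = ln (8 / C) + ln (hs_lr \<tau>0 y)" using hs_lr_pos \<tau>0 C by (intro ln_mult_pos) auto
  finally show ?thesis by simp
qed

lemma ln_hs_lr_ref_ge: "- (2 * \<tau>0) \<le> ln (hs_lr \<tau>0 y)"
proof -
  have "- \<tau>0 - 2 * \<tau>0\<^sup>2 \<le> ln (1 - \<tau>0)" using \<tau>0 by (intro ln_one_minus_pos_lower_bound) auto
  moreover have "2 * \<tau>0\<^sup>2 \<le> \<tau>0" using mult_left_mono[OF tau0_half, of \<tau>0] \<tau>0 by (simp add: power2_eq_square)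
  moreover have "ln (1 - \<tau>0) \<le> ln (hs_lr \<tau>0 y)" using hs_lr_ge[OF \<tau>0(1), of y] \<tau>0 by (intro ln_mono) auto
  ultimately show ?thesis by linarith
qed

lemma log_lr_diff_le_moderate:
  assumes \<tau>: "0 < \<tau>" "\<tau> \<le> 1" and y: "\<bar>y\<bar> \<le> L / 2"
  shows "log_lr \<tau> \<tau>0 y \<le> 60 * \<tau> * exp (L\<^sup>2 / 8) + 2 * \<tau>0"
proof -
  have "y\<^sup>2 \<le> (L / 2)\<^sup>2" using y by (metis abs_ge_zero power2_abs power_mono)
  then have "exp (y\<^sup>2 / 2) / (1 + y\<^sup>2) \<le> exp (L\<^sup>2 / 8) / 1" by (intro frac_le) (auto simp: power_divide)
  then have J: "lr_slope y \<le> 60 * exp (L\<^sup>2 / 8)" using lr_slope_upper[of y] by simp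
  have "ln (hs_lr \<tau> y) \<le> ln (1 + \<tau> * lr_slope y)"
    using hs_lr_le_one_plus[OF \<tau>, of y] hs_lr_pos[OF \<tau>(1), of y] by (intro ln_mono) auto
  also have "\<dots> \<le> \<tau> * lr_slope y" using \<tau> lr_slope_nonneg[of y] by (intro ln_add_one_self_le_self) auto
  also have "\<dots> \<le> \<tau> * (60 * exp (L\<^sup>2 / 8))" using \<tau> J by (intro mult_left_mono) auto
  finally show ?thesis using ln_hs_lr_ref_ge[of y] by simp
qed

end

lemma log_lr_diff_le_ratio:
  assumes "0 < \<sigma>" "\<sigma> \<le> \<tau>"
  shows "log_lr \<tau> \<sigma> y \<le> ln (\<tau> / \<sigma>)"
proof -
  have "ln (hs_lr \<tau> y) \<le> ln (\<tau> / \<sigma> * hs_lr \<sigma> y)"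
    using hs_lr_scale[OF assms, of y] hs_lr_pos assms by (intro ln_mono) auto
  also have "\<dots> = ln (\<tau> / \<sigma>) + ln (hs_lr \<sigma> y)" using hs_lr_pos assms by (intro ln_mult_pos) auto
  finally show ?thesis by simp
qed

text \<open>
  Below this level \<open>log_lr_diff_le\<close> applies, since its error \<open>2 * \<tau>\<^sup>2\<close> is small compared with \<open>\<tau> / L\<close>. Above it
  a union bound over the multiples of \<open>1 / n\<close> is affordable.
\<close>

definition grid_floor :: "real \<Rightarrow> real" where
  "grid_floor L = exp (- L\<^sup>2 / 200)"

text \<open>N, M and B stand for the near-null, middle and big coordinates, and
  \<open>n * exp (- L\<^sup>2)\<close> is the number k of signals. In the application A' = (A + 1)/2
  lies between 1 and A: large enough for strong evidence, small enough to leave room for the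
  noise.\<close>

definition typical :: "real \<Rightarrow> real \<Rightarrow> nat \<Rightarrow> nat set \<Rightarrow> nat set \<Rightarrow> nat set \<Rightarrow> (nat \<Rightarrow> real) \<Rightarrow> bool" where
  "typical A' L n N M B Y \<longleftrightarrow>
     (\<Sum>i\<in>N. score (ref_tau L) (Y i)) \<le> - (n * exp (- L\<^sup>2) / 400000) \<and>
     - (400001 * (n * exp (- L\<^sup>2))) \<le> (\<Sum>i\<in>N. score (ref_tau L) (Y i)) \<and>
     (\<Sum>i\<in>N. lr_error (ref_tau L) (Y i)) \<le> n * exp (- L\<^sup>2) \<and>
     card {i \<in> M. L / 2 < \<bar>Y i\<bar>} \<le> n * exp (- L\<^sup>2) \<and>
     n * exp (- L\<^sup>2) / 2 \<le> card {i \<in> B. sqrt 2 * A' * L \<le> \<bar>Y i\<bar>} \<and>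
     (\<forall>j\<in>{1..n}. grid_floor L / 2 \<le> real j / n \<longrightarrow>
        (\<Sum>i\<in>N. ln (hs_lr (real j / n) (Y i))) \<le> - (n * (real j / n)\<^sup>2 / 80000))"

text \<open>\<open>exp (L\<^sup>2) \<le> n\<close> says that k >= 1. The factor exp(L^2/25) is the
  inverse square of \<open>null_radius L\<close>, because the middle class is counted through its
  sum of squares.\<close>

definition class_sizes :: "real \<Rightarrow> real \<Rightarrow> nat \<Rightarrow> nat set \<Rightarrow> nat set \<Rightarrow> nat set \<Rightarrow> bool" where
  "class_sizes K L n N M B \<longleftrightarrow> N \<union> M \<union> B = {1..n} \<and> N \<inter> M = {} \<and> N \<inter> B = {} \<and> M \<inter> B = {} \<and>
     exp (L\<^sup>2) \<le> n \<and>
     card M \<le> K * (n * exp (- L\<^sup>2)) * L\<^sup>2 * exp (L\<^sup>2 / 25) \<and> card B \<le> K * (n * exp (- L\<^sup>2))"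

section \<open>Likelihood comparison on typical data\<close>

lemma class_sizes_sum_split:
  fixes F :: "nat \<Rightarrow> real"
  assumes "class_sizes K L n N M B"
  shows "(\<Sum>i = 1..n. F i) = (\<Sum>i\<in>N. F i) + (\<Sum>i\<in>M. F i) + (\<Sum>i\<in>B. F i)"
proof -
  have u: "{1..n} = (N \<union> M) \<union> B" and d: "N \<inter> M = {}" "N \<inter> B = {}" "M \<inter> B = {}"
    using assms by (auto simp: class_sizes_def)
  have "finite (N \<union> M \<union> B)" unfolding u[symmetric] by simp
  then have fin: "finite N" "finite M" "finite B" by auto
  show ?thesis unfolding u using fin d
    by (subst sum.union_disjoint, simp, simp, blast, subst sum.union_disjoint, simp, simp, blast, simp)
qed

lemma class_sizes_finite:
  assumes "class_sizes K L n N M B"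
  shows "finite N" "finite M" "finite B" "card N \<le> n"
proof -
  have u: "N \<subseteq> {1..n}" "M \<subseteq> {1..n}" "B \<subseteq> {1..n}" using assms by (auto simp: class_sizes_def)
  then show "finite N" "finite M" "finite B" by (auto intro: finite_subset)
  show "card N \<le> n" using card_mono[OF _ u(1)] by simp
qed

lemma null_sum_le:
  fixes N :: "nat set"
  assumes \<tau>0: "0 < \<tau>0" "\<tau>0 \<le> 1 / 100000" and \<tau>: "0 < \<tau>" "\<tau> \<le> 1 / 2" and N: "card N \<le> n"
  shows "(\<Sum>i\<in>N. log_lr \<tau> \<tau>0 (Y i))
     \<le> (\<tau> / \<tau>0 - 1) * (\<Sum>i\<in>N. score \<tau>0 (Y i)) + 2 * (n * \<tau>\<^sup>2) + 2 * (\<Sum>i\<in>N. lr_error \<tau>0 (Y i))"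
proof -
  have "(\<Sum>i\<in>N. log_lr \<tau> \<tau>0 (Y i))
    \<le> (\<Sum>i\<in>N. (\<tau> / \<tau>0 - 1) * score \<tau>0 (Y i) + 2 * \<tau>\<^sup>2 + 2 * lr_error \<tau>0 (Y i))"
    by (intro sum_mono log_lr_diff_le \<tau>0 \<tau>)
  also have "\<dots> = (\<tau> / \<tau>0 - 1) * (\<Sum>i\<in>N. score \<tau>0 (Y i)) + card N * (2 * \<tau>\<^sup>2) + 2 * (\<Sum>i\<in>N. lr_error \<tau>0 (Y i))"
    by (simp add: sum.distrib sum_distrib_left)
  also have "card N * (2 * \<tau>\<^sup>2) \<le> n * (2 * \<tau>\<^sup>2)" using N by (intro mult_right_mono) auto
  finally show ?thesis by simp
qed

lemma moderate_sum_le: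
  fixes M :: "nat set" and b :: real
  assumes \<tau>0: "0 < \<tau>0" "\<tau>0 \<le> 1 / 100000" and \<tau>: "0 < \<tau>" "\<tau> \<le> 1" and M: "finite M"
    and b: "\<And>y. log_lr \<tau> \<tau>0 y \<le> b"
  shows "(\<Sum>i\<in>M. log_lr \<tau> \<tau>0 (Y i))
     \<le> card M * (60 * \<tau> * exp (L\<^sup>2 / 8) + 2 * \<tau>0) + card {i \<in> M. L / 2 < \<bar>Y i\<bar>} * b"
proof -
  let ?F = "\<lambda>i. log_lr \<tau> \<tau>0 (Y i)"
  let ?c = "60 * \<tau> * exp (L\<^sup>2 / 8) + 2 * \<tau>0"
  let ?M1 = "{i \<in> M. \<bar>Y i\<bar> \<le> L / 2}" and ?M2 = "{i \<in> M. L / 2 < \<bar>Y i\<bar>}"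
  have "M = ?M1 \<union> ?M2" by auto
  then have "(\<Sum>i\<in>M. ?F i) = (\<Sum>i\<in>?M1 \<union> ?M2. ?F i)" by simp
  also have "\<dots> = (\<Sum>i\<in>?M1. ?F i) + (\<Sum>i\<in>?M2. ?F i)" using M by (intro sum.union_disjoint) auto
  also have "(\<Sum>i\<in>?M1. ?F i) \<le> card ?M1 * ?c"
    by (intro sum_bounded_above log_lr_diff_le_moderate \<tau>0 \<tau>) auto
  also have "\<dots> \<le> card M * ?c"
    using \<tau>0 \<tau> card_mono[OF M, of ?M1] by (intro mult_right_mono) (auto intro!: add_nonneg_nonneg)
  also have "(\<Sum>i\<in>?M2. ?F i) \<le> card ?M2 * b" by (intro sum_bounded_above b)
  finally show ?thesis by simp
qed

text \<open>\<open>CK\<close> adds up the contributions in units of k: 400001 from the null scores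
  and 3 from their errors, 1 + ln 4 from M, K ln 4 from B, and ln (8/C) from each of at least k/2
  strong observations.\<close>

lemma typical_small_tau:
  assumes K: "0 < K" and C: "1 \<le> C" and A': "1 < A'"
    and CK: "400006 + (K + 1) * ln 4 + ln (8 / C) / 2 < 0"
  shows "\<forall>\<^sub>F L in at_top. \<forall>n N M B Y \<tau>. class_sizes K L n N M B \<longrightarrow> typical A' L n N M B Y \<longrightarrow>
    0 < \<tau> \<longrightarrow> \<tau> < ref_tau L / C \<longrightarrow> (\<Sum>i = 1..n. log_lr \<tau> (ref_tau L) (Y i)) < 0"
proof -
  have ev: "\<forall>\<^sub>F L in at_top. 2 * L * ref_tau L \<le> 1"
    "\<forall>\<^sub>F L in at_top. K * L\<^sup>2 * exp (L\<^sup>2 / 25) * (62 * ref_tau L * exp (L\<^sup>2 / 8)) \<le> 1"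
    unfolding ref_tau_def by real_asymp+
  \<comment> \<open>The exponents combine to (A'^2 - 1) L^2, so at the level sqrt 2 A' L the product
    of \<open>ref_tau L\<close> and the slope outgrows every C, as A' > 1.\<close>
  have ev3: "\<forall>\<^sub>F L in at_top. C \<le> ref_tau L * (exp ((sqrt 2 * A' * L)\<^sup>2 / 2) / (1000 * (1 + (sqrt 2 * A' * L)\<^sup>2)))"
  proof -
    have "\<forall>\<^sub>F L in at_top. C \<le> L * exp (- L\<^sup>2) * (exp (A'\<^sup>2 * L\<^sup>2) / (1000 * (1 + 2 * A'\<^sup>2 * L\<^sup>2)))"
      using A' by real_asymp
    then show ?thesis by (simp add: ref_tau_def power_mult_distrib)
  qed
  show ?thesis
    using ev ev3 ref_tau_pos_small[of "1/100000", simplified] eventually_ge_at_top[of 1]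
  proof eventually_elim
    case (elim L)
    show ?case
    proof (intro allI impI)
      fix n N M B Y \<tau>
      assume cs: "class_sizes K L n N M B" and ty: "typical A' L n N M B Y" and \<tau>: "0 < \<tau>" "\<tau> < ref_tau L / C"
      define \<tau>0 k where "\<tau>0 = ref_tau L" and "k = n * exp (- L\<^sup>2)"
      let ?F = "\<lambda>i. log_lr \<tau> \<tau>0 (Y i)"
      have \<tau>0: "0 < \<tau>0" "\<tau>0 \<le> 1 / 100000" using elim by (auto simp: \<tau>0_def)
      have C1: "\<tau>0 / C \<le> \<tau>0 / 1" using C \<tau>0 by (intro divide_left_mono) auto
      then have \<tau>': "\<tau> \<le> \<tau>0" "\<tau> \<le> \<tau>0 / C" using \<tau> by (auto simp: \<tau>0_def)
      have "0 < real n" using cs exp_gt_zero[of "L\<^sup>2"] unfolding class_sizes_def by linarith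
      then have k: "0 < k" by (simp add: k_def)
      have nk: "n * \<tau>0 = k * L" by (simp add: \<tau>0_def k_def ref_tau_def)
      note fin = class_sizes_finite[OF cs]
      note T = ty[unfolded typical_def, folded \<tau>0_def k_def]
      have N: "(\<Sum>i\<in>N. ?F i) \<le> 400001 * k + k + 2 * k"
      proof -
        have "(\<Sum>i\<in>N. ?F i) \<le> (\<tau> / \<tau>0 - 1) * (\<Sum>i\<in>N. score \<tau>0 (Y i)) + 2 * (n * \<tau>\<^sup>2) + 2 * (\<Sum>i\<in>N. lr_error \<tau>0 (Y i))"
          using \<tau> \<tau>' \<tau>0 fin by (intro null_sum_le) auto
        moreover have "(\<tau> / \<tau>0 - 1) * (\<Sum>i\<in>N. score \<tau>0 (Y i)) \<le> 400001 * k"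
        proof -
          have "(1 - \<tau> / \<tau>0) * (- (\<Sum>i\<in>N. score \<tau>0 (Y i))) \<le> (1 - \<tau> / \<tau>0) * (400001 * k)"
            using T \<tau>' \<tau>0 by (intro mult_left_mono) auto
          also have "\<dots> \<le> 1 * (400001 * k)" using k \<tau> \<tau>0 by (intro mult_right_mono) auto
          finally show ?thesis by (simp add: algebra_simps)
        qed
        moreover have "2 * (n * \<tau>\<^sup>2) \<le> k"
        proof -
          have "n * \<tau>\<^sup>2 \<le> n * \<tau>0\<^sup>2" using \<tau> \<tau>' by (intro mult_left_mono power_mono) auto
          also have "\<dots> = k * (L * \<tau>0)" using nk by (simp add: power2_eq_square mult.assoc[symmetric])
          finally have "2 * (n * \<tau>\<^sup>2) \<le> k * (2 * L * \<tau>0)" by simp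
          also have "\<dots> \<le> k * 1" using k elim by (intro mult_left_mono) (auto simp: \<tau>0_def)
          finally show ?thesis by simp
        qed
        ultimately show ?thesis using T by linarith
      qed
      have ln4: "0 \<le> ln (4::real)" by simp
      have M: "(\<Sum>i\<in>M. ?F i) \<le> k + k * ln 4"
      proof -
        have "(\<Sum>i\<in>M. ?F i) \<le> card M * (60 * \<tau> * exp (L\<^sup>2 / 8) + 2 * \<tau>0) + card {i \<in> M. L / 2 < \<bar>Y i\<bar>} * ln 4"
          using \<tau> \<tau>' \<tau>0 fin by (intro moderate_sum_le log_lr_diff_le_const) auto
        also have "\<dots> \<le> (K * k * L\<^sup>2 * exp (L\<^sup>2 / 25)) * (62 * \<tau>0 * exp (L\<^sup>2 / 8)) + k * ln 4"
        proof (intro add_mono mult_mono)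
          show "card M \<le> K * k * L\<^sup>2 * exp (L\<^sup>2 / 25)" using cs by (simp add: class_sizes_def k_def)
          have "60 * \<tau> * exp (L\<^sup>2 / 8) \<le> 60 * \<tau>0 * exp (L\<^sup>2 / 8)" using \<tau>' by (intro mult_right_mono) auto
          moreover have "2 * \<tau>0 * 1 \<le> 2 * \<tau>0 * exp (L\<^sup>2 / 8)" using \<tau>0 by (intro mult_left_mono) auto
          ultimately show "60 * \<tau> * exp (L\<^sup>2 / 8) + 2 * \<tau>0 \<le> 62 * \<tau>0 * exp (L\<^sup>2 / 8)" by linarith
        qed (use T K k \<tau> \<tau>0 ln4 in \<open>auto intro!: add_nonneg_nonneg\<close>)
        also have "(K * k * L\<^sup>2 * exp (L\<^sup>2 / 25)) * (62 * \<tau>0 * exp (L\<^sup>2 / 8))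
            = k * (K * L\<^sup>2 * exp (L\<^sup>2 / 25) * (62 * \<tau>0 * exp (L\<^sup>2 / 8)))" by (simp only: mult_ac)
        also have "\<dots> \<le> k * 1" using k elim by (intro mult_left_mono) (auto simp: \<tau>0_def)
        finally show ?thesis by simp
      qed
      have B: "(\<Sum>i\<in>B. ?F i) \<le> K * k * ln 4 + k / 2 * ln (8 / C)"
      proof -
        let ?G = "{i \<in> B. sqrt 2 * A' * L \<le> \<bar>Y i\<bar>}"
        have ln8: "ln (8 / C) \<le> 0" using CK K ln4 mult_nonneg_nonneg[of "K + 1" "ln 4"] by linarith
        have "(\<Sum>i\<in>B. ?F i) \<le> (\<Sum>i\<in>B. ln 4 + (if i \<in> ?G then ln (8 / C) else 0))"
        proof (intro sum_mono)
          fix i assume i: "i \<in> B"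
          show "?F i \<le> ln 4 + (if i \<in> ?G then ln (8 / C) else 0)"
          proof (cases "i \<in> ?G")
            case True
            define x where "x = sqrt 2 * A' * L"
            have x: "0 \<le> x" "x \<le> \<bar>Y i\<bar>" using True A' elim by (auto simp: x_def)
            have x1: "1 \<le> x\<^sup>2"
            proof -
              have "1 * 1 \<le> A'\<^sup>2 * L\<^sup>2" using A' elim by (intro mult_mono) (auto simp: one_le_power)
              then show ?thesis by (simp add: x_def power_mult_distrib)
            qed
            have x2: "x\<^sup>2 \<le> (Y i)\<^sup>2" using x by (metis power2_abs power_mono)
            \<comment> \<open>The function exp(v/2)/(1 + v) increases for v >= 1, here through 1 +
              d/2 <= exp(d/2) with d the increment of v.\<close>
            have "exp (x\<^sup>2 / 2) / (1000 * (1 + x\<^sup>2)) \<le> exp ((Y i)\<^sup>2 / 2) / (1000 * (1 + (Y i)\<^sup>2))"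
            proof -
              define d where "d = (Y i)\<^sup>2 - x\<^sup>2"
              have d: "0 \<le> d" using x2 by (simp add: d_def)
              have "1 * (d / 2) \<le> x\<^sup>2 * (d / 2)" using x1 d by (intro mult_right_mono) auto
              moreover have "(1 + x\<^sup>2) * (1 + d / 2) = 1 + x\<^sup>2 + d / 2 + x\<^sup>2 * (d / 2)" by (simp add: algebra_simps)
              moreover have "(Y i)\<^sup>2 = x\<^sup>2 + d" by (simp add: d_def)
              ultimately have "1 + (Y i)\<^sup>2 \<le> (1 + x\<^sup>2) * (1 + d / 2)" by linarith
              also have "\<dots> \<le> (1 + x\<^sup>2) * exp (d / 2)" by (intro mult_left_mono) auto
              finally have "exp (x\<^sup>2 / 2) * (1 + (Y i)\<^sup>2) \<le> exp (x\<^sup>2 / 2) * ((1 + x\<^sup>2) * exp (d / 2))"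
                by (intro mult_left_mono) auto
              also have "\<dots> = exp (x\<^sup>2 / 2 + d / 2) * (1 + x\<^sup>2)" by (simp add: exp_add)
              also have "x\<^sup>2 / 2 + d / 2 = (Y i)\<^sup>2 / 2" by (simp add: d_def diff_divide_distrib)
              finally have "exp (x\<^sup>2 / 2) / (1 + x\<^sup>2) \<le> exp ((Y i)\<^sup>2 / 2) / (1 + (Y i)\<^sup>2)"
                by (simp add: divide_simps add_pos_nonneg)
              then have "exp (x\<^sup>2 / 2) / (1 + x\<^sup>2) / 1000 \<le> exp ((Y i)\<^sup>2 / 2) / (1 + (Y i)\<^sup>2) / 1000"
                by (rule divide_right_mono) simp
              moreover have "e / (1000 * b) = e / b / 1000" for e b :: real by simp
              ultimately show ?thesis by metis
            qed
            then have "exp (x\<^sup>2 / 2) / (1000 * (1 + x\<^sup>2)) \<le> lr_slope (Y i)" using lr_slope_lower[of "Y i"] by linarith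
            then have "\<tau>0 * (exp (x\<^sup>2 / 2) / (1000 * (1 + x\<^sup>2))) \<le> \<tau>0 * lr_slope (Y i)" using \<tau>0 by (intro mult_left_mono) auto
            then have "C \<le> \<tau>0 * lr_slope (Y i)" using elim unfolding \<tau>0_def x_def by linarith
            then have "?F i \<le> ln (8 / C)" using \<tau> \<tau>' C \<tau>0 by (intro log_lr_diff_le_signal) auto
            then have "?F i \<le> ln 4 + ln (8 / C)" using ln4 by linarith
            then show ?thesis using True by simp
          next
            case False
            then show ?thesis using \<tau> \<tau>' \<tau>0 log_lr_diff_le_const by auto
          qed
        qed
        also have "\<dots> = card B * ln 4 + card ?G * ln (8 / C)"
          using fin by (simp add: sum.distrib sum.If_cases Int_def)
        also have "\<dots> \<le> K * k * ln 4 + k / 2 * ln (8 / C)"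
        proof (rule add_mono)
          show "card B * ln 4 \<le> K * k * ln 4" using cs ln4 by (intro mult_right_mono) (auto simp: class_sizes_def k_def)
          have "k / 2 \<le> card ?G" using T by blast
          then show "card ?G * ln (8 / C) \<le> k / 2 * ln (8 / C)" using ln8 by (rule mult_right_mono_neg)
        qed
        finally show ?thesis .
      qed
      have "(\<Sum>i = 1..n. ?F i) \<le> k * (400006 + (K + 1) * ln 4 + ln (8 / C) / 2)"
        unfolding class_sizes_sum_split[OF cs] using N M B k by (simp add: algebra_simps)
      also have "\<dots> < 0" using CK k by (intro mult_pos_neg) auto
      finally show "(\<Sum>i = 1..n. log_lr \<tau> (ref_tau L) (Y i)) < 0" by (simp add: \<tau>0_def)
    qed
  qed
qed

text \<open>In units of k and with r = tau/tau_0, the null coordinates contribute -(r - 1)/400000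
  plus 2, the others (K + 1) ln r, up to errors proportional to r. These errors may use up a quarter
  of the linear term, hence the 3/4 in \<open>CK\<close> and the 1/1600000 in the proof.\<close>

lemma typical_medium_tau:
  assumes K: "0 < K" and C: "1 \<le> C"
    and CK: "\<forall>r\<ge>C. - (3 / 4 * r / 400000) + 1 / 400000 + 2 + (K + 1) * ln r < 0"
  shows "\<forall>\<^sub>F L in at_top. \<forall>n N M B Y \<tau>. class_sizes K L n N M B \<longrightarrow> typical A' L n N M B Y \<longrightarrow>
    C * ref_tau L \<le> \<tau> \<longrightarrow> \<tau> \<le> grid_floor L \<longrightarrow> (\<Sum>i = 1..n. log_lr \<tau> (ref_tau L) (Y i)) < 0"
proof -
  have ev: "\<forall>\<^sub>F L in at_top. 2 * (L * grid_floor L) + K * L\<^sup>2 * exp (L\<^sup>2 / 25) * (62 * ref_tau L * exp (L\<^sup>2 / 8)) \<le> 1 / 1600000"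
    "\<forall>\<^sub>F L in at_top. grid_floor L \<le> 1 / 2"
    unfolding ref_tau_def grid_floor_def by real_asymp+
  show ?thesis
    using ev ref_tau_pos_small[of "1/100000", simplified] eventually_ge_at_top[of 1]
  proof eventually_elim
    case (elim L)
    show ?case
    proof (intro allI impI)
      fix n N M B Y \<tau>
      assume cs: "class_sizes K L n N M B" and ty: "typical A' L n N M B Y"
        and \<tau>: "C * ref_tau L \<le> \<tau>" "\<tau> \<le> grid_floor L"
      define \<tau>0 k where "\<tau>0 = ref_tau L" and "k = n * exp (- L\<^sup>2)"
      define r where "r = \<tau> / \<tau>0"
      let ?F = "\<lambda>i. log_lr \<tau> \<tau>0 (Y i)"
      have \<tau>0: "0 < \<tau>0" "\<tau>0 \<le> 1 / 100000" using elim by (auto simp: \<tau>0_def)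
      have rC: "C \<le> r" using \<tau> \<tau>0 by (simp add: r_def \<tau>0_def pos_le_divide_eq)
      then have r1: "1 \<le> r" using C by simp
      have \<tau>r: "\<tau> = r * \<tau>0" using \<tau>0 by (simp add: r_def)
      have \<tau>': "\<tau>0 \<le> \<tau>" "0 < \<tau>" "\<tau> \<le> 1 / 2" using r1 \<tau>0 \<tau> elim by (auto simp: \<tau>r)
      have "0 < real n" using cs exp_gt_zero[of "L\<^sup>2"] unfolding class_sizes_def by linarith
      then have k: "0 < k" by (simp add: k_def)
      have nk: "n * \<tau>0 = k * L" by (simp add: \<tau>0_def k_def ref_tau_def)
      note fin = class_sizes_finite[OF cs]
      note T = ty[unfolded typical_def, folded \<tau>0_def k_def]
      have N: "(\<Sum>i\<in>N. ?F i) \<le> - ((r - 1) * (k / 400000)) + k * r * (2 * (L * grid_floor L)) + 2 * k"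
      proof -
        have "(\<Sum>i\<in>N. ?F i) \<le> (r - 1) * (\<Sum>i\<in>N. score \<tau>0 (Y i)) + 2 * (n * \<tau>\<^sup>2) + 2 * (\<Sum>i\<in>N. lr_error \<tau>0 (Y i))"
          unfolding r_def using \<tau>' \<tau>0 fin by (intro null_sum_le) auto
        moreover have "(r - 1) * (\<Sum>i\<in>N. score \<tau>0 (Y i)) \<le> (r - 1) * (- (k / 400000))"
          using T r1 by (intro mult_left_mono) auto
        moreover have "2 * (n * \<tau>\<^sup>2) \<le> k * r * (2 * (L * grid_floor L))"
        proof -
          \<comment> \<open>The quadratic error is k r times L tau, small compared with the linear
            term as long as tau stays below \<open>grid_floor L\<close>.\<close>
          have "n * \<tau>\<^sup>2 = k * r * (L * \<tau>)" using nk unfolding power2_eq_square \<tau>r by (simp add: mult_ac)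
          also have "\<dots> \<le> k * r * (L * grid_floor L)" using k r1 \<tau> elim by (intro mult_left_mono) auto
          finally show ?thesis by simp
        qed
        ultimately show ?thesis using T by linarith
      qed
      have lnr: "0 \<le> ln r" using r1 by simp
      have M: "(\<Sum>i\<in>M. ?F i) \<le> k * r * (K * L\<^sup>2 * exp (L\<^sup>2 / 25) * (62 * \<tau>0 * exp (L\<^sup>2 / 8))) + k * ln r"
      proof -
        have "(\<Sum>i\<in>M. ?F i) \<le> card M * (60 * \<tau> * exp (L\<^sup>2 / 8) + 2 * \<tau>0) + card {i \<in> M. L / 2 < \<bar>Y i\<bar>} * ln r"
          unfolding r_def using \<tau>' \<tau>0 fin by (intro moderate_sum_le log_lr_diff_le_ratio) auto
        also have "\<dots> \<le> (K * k * L\<^sup>2 * exp (L\<^sup>2 / 25)) * (62 * \<tau> * exp (L\<^sup>2 / 8)) + k * ln r"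
        proof (intro add_mono mult_mono)
          show "card M \<le> K * k * L\<^sup>2 * exp (L\<^sup>2 / 25)" using cs by (simp add: class_sizes_def k_def)
          have "2 * \<tau>0 * 1 \<le> 2 * \<tau> * exp (L\<^sup>2 / 8)" using \<tau>0 \<tau>' by (intro mult_mono) auto
          then show "60 * \<tau> * exp (L\<^sup>2 / 8) + 2 * \<tau>0 \<le> 62 * \<tau> * exp (L\<^sup>2 / 8)" by linarith
        qed (use T K k \<tau>' \<tau>0 lnr in \<open>auto intro!: add_nonneg_nonneg\<close>)
        also have "(K * k * L\<^sup>2 * exp (L\<^sup>2 / 25)) * (62 * \<tau> * exp (L\<^sup>2 / 8))
            = k * r * (K * L\<^sup>2 * exp (L\<^sup>2 / 25) * (62 * \<tau>0 * exp (L\<^sup>2 / 8)))" unfolding \<tau>r by (simp only: mult_ac)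
        finally show ?thesis .
      qed
      have B: "(\<Sum>i\<in>B. ?F i) \<le> K * k * ln r"
      proof -
        have "(\<Sum>i\<in>B. ?F i) \<le> card B * ln r" unfolding r_def by (intro sum_bounded_above log_lr_diff_le_ratio \<tau>0 \<tau>')
        also have "\<dots> \<le> K * k * ln r" using cs lnr by (intro mult_right_mono) (auto simp: class_sizes_def k_def)
        finally show ?thesis .
      qed
      define e where "e = 2 * (L * grid_floor L) + K * L\<^sup>2 * exp (L\<^sup>2 / 25) * (62 * \<tau>0 * exp (L\<^sup>2 / 8))"
      have e: "k * r * e \<le> k * r * (1 / 1600000)" using elim k r1 by (intro mult_left_mono) (auto simp: e_def \<tau>0_def)
      have "(\<Sum>i = 1..n. ?F i) \<le> - ((r - 1) * (k / 400000)) + k * r * e + 2 * k + (K + 1) * (k * ln r)"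
        unfolding class_sizes_sum_split[OF cs] e_def using N M B by (simp add: algebra_simps)
      also have "\<dots> \<le> k * (- (3 / 4 * r / 400000) + 1 / 400000 + 2 + (K + 1) * ln r)"
      proof -
        define p w where "p = k * r" and "w = (K + 1) * (k * ln r)"
        have "k * (- (3 / 4 * r / 400000) + 1 / 400000 + 2 + (K + 1) * ln r)
            = - (3 * p / 1600000) + k / 400000 + 2 * k + w" by (simp add: p_def w_def algebra_simps)
        moreover have "(r - 1) * (k / 400000) = p / 400000 - k / 400000" by (simp add: p_def field_simps)
        moreover have "p * e \<le> p / 1600000" using e by (simp add: p_def)
        ultimately show ?thesis unfolding p_def[symmetric] w_def[symmetric] by linarith
      qed
      also have "\<dots> < 0" using CK rC k by (intro mult_pos_neg) auto
      finally show "(\<Sum>i = 1..n. log_lr \<tau> (ref_tau L) (Y i)) < 0" by (simp add: \<tau>0_def)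
    qed
  qed
qed

text \<open>tau is rounded down to a = j/n, where \<open>typical\<close> bounds the null sum. The
  rounding costs at most 2/(g n) per coordinate, and a coordinate of M or B gains at most ln
  (tau/tau_0) <= L^2; both totals are negligible against n g^2.\<close>

lemma typical_large_tau:
  assumes K: "0 < K"
  shows "\<forall>\<^sub>F L in at_top. \<forall>n N M B Y \<tau>. class_sizes K L n N M B \<longrightarrow> typical A' L n N M B Y \<longrightarrow>
    grid_floor L \<le> \<tau> \<longrightarrow> \<tau> \<le> 1 \<longrightarrow> (\<Sum>i = 1..n. log_lr \<tau> (ref_tau L) (Y i)) < 0"
proof -
  have ev: "\<forall>\<^sub>F L in at_top. - ((grid_floor L)\<^sup>2 / 320000) + 2 / grid_floor L * exp (- L\<^sup>2) + 2 * ref_tau L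
      + K * exp (- L\<^sup>2) * L\<^sup>2 * (L\<^sup>2 * exp (L\<^sup>2 / 25) + 1) < 0"
    "\<forall>\<^sub>F L in at_top. 2 \<le> exp (L\<^sup>2) * grid_floor L" "\<forall>\<^sub>F L in at_top. ref_tau L \<le> grid_floor L"
    unfolding ref_tau_def grid_floor_def by real_asymp+
  show ?thesis
    using ev ref_tau_pos_small[of "1/100000", simplified] eventually_ge_at_top[of 1]
  proof eventually_elim
    case (elim L)
    show ?case
    proof (intro allI impI)
      fix n N M B Y \<tau>
      assume cs: "class_sizes K L n N M B" and ty: "typical A' L n N M B Y" and \<tau>: "grid_floor L \<le> \<tau>" "\<tau> \<le> 1"
      define \<tau>0 g where "\<tau>0 = ref_tau L" and "g = grid_floor L"
      let ?F = "\<lambda>i. log_lr \<tau> \<tau>0 (Y i)"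
      have \<tau>0: "0 < \<tau>0" "\<tau>0 \<le> 1 / 100000" using elim by (auto simp: \<tau>0_def)
      have g: "0 < g" "g \<le> \<tau>" "\<tau>0 \<le> \<tau>" using \<tau> elim by (auto simp: g_def grid_floor_def \<tau>0_def)
      have en: "exp (L\<^sup>2) \<le> n" using cs by (simp add: class_sizes_def)
      then have n: "0 < real n" using exp_gt_zero[of "L\<^sup>2"] by linarith
      have inv_n: "1 \<le> n * exp (- L\<^sup>2)" using en by (simp add: exp_minus field_simps)
      note fin = class_sizes_finite[OF cs]
      have "2 \<le> exp (L\<^sup>2) * g" using elim by (simp add: g_def)
      also have "\<dots> \<le> n * \<tau>" using en g by (intro mult_mono) auto
      finally have n\<tau>: "2 \<le> n * \<tau>" .
      define j where "j = nat \<lfloor>n * \<tau>\<rfloor>"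
      have j: "real j \<le> n * \<tau>" "n * \<tau> - 1 < real j" using n\<tau> by (auto simp: j_def)
      define a where "a = real j / n"
      have a: "0 < a" "a \<le> \<tau>" "\<tau> / 2 \<le> a"
        using j n\<tau> n by (auto simp: a_def field_simps)
      have "real j \<le> n * 1" using j(1) n \<tau> by (intro order_trans[OF j(1)] mult_left_mono) auto
      then have jn: "j \<in> {1..n}" using j n\<tau> by auto
      have "g / 2 \<le> real j / n" using a g unfolding a_def[symmetric] by linarith
      then have Na: "(\<Sum>i\<in>N. ln (hs_lr a (Y i))) \<le> - (n * a\<^sup>2 / 80000)"
        using ty jn unfolding typical_def g_def a_def by blast
      \<comment> \<open>The later 320000 is 4 * 80000, since a >= tau/2.\<close>
      have "n * (\<tau> / 2)\<^sup>2 / 80000 \<le> n * a\<^sup>2 / 80000" using a g by (intro divide_right_mono mult_left_mono power_mono) auto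
      moreover have "n * g\<^sup>2 \<le> n * \<tau>\<^sup>2" using g by (intro mult_left_mono power_mono) auto
      ultimately have Na': "(\<Sum>i\<in>N. ln (hs_lr a (Y i))) \<le> - (n * g\<^sup>2 / 320000)"
        using Na by (simp add: power_divide)
      have lna: "ln (\<tau> / a) \<le> 2 / g * (1 / n)"
      proof -
        have "ln (\<tau> / a) \<le> \<tau> / a - 1" using a g by (intro ln_le_minus_one) auto
        also have "\<dots> = (n * \<tau> - j) / j" using a n j n\<tau> by (simp add: a_def field_simps)
        also have "\<dots> \<le> 1 / (n * \<tau> / 2)" using j n\<tau> by (intro frac_le) auto
        also have "\<dots> = 2 / \<tau> * (1 / n)" by simp
        also have "\<dots> \<le> 2 / g * (1 / n)" using g n by (intro mult_right_mono divide_left_mono) auto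
        finally show ?thesis .
      qed
      have N: "(\<Sum>i\<in>N. ?F i) \<le> - (n * g\<^sup>2 / 320000) + n * (2 / g * (1 / n)) + n * (2 * \<tau>0)"
      proof -
        have "(\<Sum>i\<in>N. ?F i) \<le> (\<Sum>i\<in>N. ln (hs_lr a (Y i)) + (2 / g * (1 / n) + 2 * \<tau>0))"
        proof (intro sum_mono)
          fix i
          have "log_lr \<tau> a (Y i) \<le> ln (\<tau> / a)" by (rule log_lr_diff_le_ratio[OF a(1,2)])
          then show "?F i \<le> ln (hs_lr a (Y i)) + (2 / g * (1 / n) + 2 * \<tau>0)"
            using lna ln_hs_lr_ref_ge[OF \<tau>0, of "Y i"] by linarith
        qed
        also have "\<dots> = (\<Sum>i\<in>N. ln (hs_lr a (Y i))) + card N * (2 / g * (1 / n) + 2 * \<tau>0)" by (simp add: sum.distrib)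
        also have "card N * (2 / g * (1 / n) + 2 * \<tau>0) \<le> n * (2 / g * (1 / n) + 2 * \<tau>0)"
          using fin g \<tau>0 by (intro mult_right_mono) auto
        finally show ?thesis using Na' by (simp add: distrib_left)
      qed
      have lnr: "ln (\<tau> / \<tau>0) \<le> L\<^sup>2" "0 \<le> ln (\<tau> / \<tau>0)"
      proof -
        have "exp (- L\<^sup>2) * 1 \<le> \<tau>0" unfolding \<tau>0_def ref_tau_def using elim by (subst mult.commute) (intro mult_right_mono, auto)
        then have "\<tau> / \<tau>0 \<le> 1 / exp (- L\<^sup>2)" using \<tau> g \<tau>0 by (intro frac_le) auto
        also have "\<dots> = exp (L\<^sup>2)" by (simp add: exp_minus field_simps)
        finally have "ln (\<tau> / \<tau>0) \<le> ln (exp (L\<^sup>2))" using g \<tau>0 by (intro ln_mono) auto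
        then show "ln (\<tau> / \<tau>0) \<le> L\<^sup>2" by simp
        show "0 \<le> ln (\<tau> / \<tau>0)" using g \<tau>0 by simp
      qed
      have S: "(\<Sum>i\<in>S. ?F i) \<le> c * L\<^sup>2" if "card S \<le> c" for S :: "nat set" and c :: real
      proof -
        have "(\<Sum>i\<in>S. ?F i) \<le> card S * ln (\<tau> / \<tau>0)" using \<tau>0 g by (intro sum_bounded_above log_lr_diff_le_ratio)
        also have "\<dots> \<le> c * L\<^sup>2" using that lnr by (intro mult_mono) auto
        finally show ?thesis .
      qed
      have M: "(\<Sum>i\<in>M. ?F i) \<le> K * (n * exp (- L\<^sup>2)) * L\<^sup>2 * exp (L\<^sup>2 / 25) * L\<^sup>2"
        and B: "(\<Sum>i\<in>B. ?F i) \<le> K * (n * exp (- L\<^sup>2)) * L\<^sup>2"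
        using cs by (auto simp: class_sizes_def intro!: S)
      have "1 / n \<le> exp (- L\<^sup>2)" using inv_n n by (simp add: pos_divide_le_eq mult.commute)
      then have "2 / g * (1 / n) \<le> 2 / g * exp (- L\<^sup>2)" by (rule mult_left_mono) (use g in simp)
      then have "n * (2 / g * (1 / n)) \<le> n * (2 / g * exp (- L\<^sup>2))" by (rule mult_left_mono) simp
      then have "(\<Sum>i = 1..n. ?F i) \<le> n * (- (g\<^sup>2 / 320000) + 2 / g * exp (- L\<^sup>2) + 2 * \<tau>0
          + K * exp (- L\<^sup>2) * L\<^sup>2 * (L\<^sup>2 * exp (L\<^sup>2 / 25) + 1))"
        unfolding class_sizes_sum_split[OF cs] using N M B by (simp add: algebra_simps)
      also have "\<dots> < 0" using n elim by (intro mult_pos_neg) (auto simp: g_def \<tau>0_def)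
      finally show "(\<Sum>i = 1..n. log_lr \<tau> (ref_tau L) (Y i)) < 0" by (simp add: \<tau>0_def)
    qed
  qed
qed

lemma typical_maximiser:
  assumes K: "0 < K" and A': "1 < A'"
  shows "\<exists>C>1. \<forall>\<^sub>F L in at_top. \<forall>n N M B Y \<tau>. class_sizes K L n N M B \<longrightarrow> typical A' L n N M B Y \<longrightarrow>
    0 < \<tau> \<longrightarrow> \<tau> \<le> 1 \<longrightarrow> \<not> (ref_tau L / C \<le> \<tau> \<and> \<tau> \<le> C * ref_tau L) \<longrightarrow>
    (\<Sum>i = 1..n. log_lr \<tau> (ref_tau L) (Y i)) < 0"
proof -
  have "\<forall>\<^sub>F C in at_top. 400006 + (K + 1) * ln 4 + ln (8 / C) / 2 < 0" by real_asymp
  moreover have "\<forall>\<^sub>F C in at_top. \<forall>r\<ge>C. - (3 / 4 * r / 400000) + 1 / 400000 + 2 + (K + 1) * ln r < 0"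
    by (rule eventually_all_ge_at_top) real_asymp
  moreover have "\<forall>\<^sub>F C::real in at_top. 1 < C" by (rule eventually_gt_at_top)
  ultimately have "\<forall>\<^sub>F C in at_top. 400006 + (K + 1) * ln 4 + ln (8 / C) / 2 < 0 \<and>
      (\<forall>r\<ge>C. - (3 / 4 * r / 400000) + 1 / 400000 + 2 + (K + 1) * ln r < 0) \<and> 1 < C"
    by eventually_elim blast
  then obtain C where C: "400006 + (K + 1) * ln 4 + ln (8 / C) / 2 < 0"
    "\<forall>r\<ge>C. - (3 / 4 * r / 400000) + 1 / 400000 + 2 + (K + 1) * ln r < 0" "1 < C"
    by (auto simp: eventually_at_top_linorder)
  then have C1: "1 \<le> C" by simp
  from typical_small_tau[OF K C1 A' C(1)] typical_medium_tau[OF K C1 C(2), of A'] typical_large_tau[OF K, of A']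
  have "\<forall>\<^sub>F L in at_top. \<forall>n N M B Y \<tau>. class_sizes K L n N M B \<longrightarrow> typical A' L n N M B Y \<longrightarrow>
    0 < \<tau> \<longrightarrow> \<tau> \<le> 1 \<longrightarrow> \<not> (ref_tau L / C \<le> \<tau> \<and> \<tau> \<le> C * ref_tau L) \<longrightarrow>
    (\<Sum>i = 1..n. log_lr \<tau> (ref_tau L) (Y i)) < 0"
  proof eventually_elim
    case (elim L)
    show ?case
    proof (intro allI impI)
      fix n N M B Y \<tau>
      assume a: "class_sizes K L n N M B" "typical A' L n N M B Y" "0 < \<tau>" "\<tau> \<le> 1"
        "\<not> (ref_tau L / C \<le> \<tau> \<and> \<tau> \<le> C * ref_tau L)"
      consider "\<tau> < ref_tau L / C" | "C * ref_tau L \<le> \<tau>" "\<tau> \<le> grid_floor L" | "grid_floor L \<le> \<tau>"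
        using a(5) by linarith
      then show "(\<Sum>i = 1..n. log_lr \<tau> (ref_tau L) (Y i)) < 0"
      proof cases
        case 1 then show ?thesis using elim(1) a by blast
      next
        case 2 then show ?thesis using elim(2) a by blast
      next
        case 3 then show ?thesis using elim(3) a by blast
      qed
    qed
  qed
  with C(3) show ?thesis by blast
qed

section \<open>Typical data\<close>

definition null_class :: "real \<Rightarrow> nat \<Rightarrow> (nat \<Rightarrow> real) \<Rightarrow> nat set" where
  "null_class L n \<theta> = {i \<in> {1..n}. \<bar>\<theta> i\<bar> \<le> null_radius L}"

text \<open>With |theta| < L/10 an observation above L/2 needs noise above 2L/5. This is rarer than
  the class is large: exp(-2 L^2/25) against exp(L^2/25).\<close>

definition middle_class :: "real \<Rightarrow> nat \<Rightarrow> (nat \<Rightarrow> real) \<Rightarrow> nat set" where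
  "middle_class L n \<theta> = {i \<in> {1..n}. null_radius L < \<bar>\<theta> i\<bar> \<and> \<bar>\<theta> i\<bar> < L / 10}"

definition big_class :: "real \<Rightarrow> nat \<Rightarrow> (nat \<Rightarrow> real) \<Rightarrow> nat set" where
  "big_class L n \<theta> = {i \<in> {1..n}. L / 10 \<le> \<bar>\<theta> i\<bar>}"

abbreviation classified :: "real \<Rightarrow> real \<Rightarrow> nat \<Rightarrow> (nat \<Rightarrow> real) \<Rightarrow> bool" where
  "classified K L n \<theta> \<equiv> class_sizes K L n (null_class L n \<theta>) (middle_class L n \<theta>) (big_class L n \<theta>)"

abbreviation typical_data :: "real \<Rightarrow> real \<Rightarrow> nat \<Rightarrow> (nat \<Rightarrow> real) \<Rightarrow> (nat \<Rightarrow> real) \<Rightarrow> bool" where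
  "typical_data A L n \<theta> Y \<equiv>
     typical ((A + 1) / 2) L n (null_class L n \<theta>) (middle_class L n \<theta>) (big_class L n \<theta>) Y"

section \<open>The excessive-bias restriction as bounds on class sizes\<close>

lemma excess_bias_scale:
  fixes n q k :: real
  assumes "0 < q" "q \<le> Cs * k" "0 < k" "0 < n" "1 \<le> ln (n / k)"
  shows "q * ln (n / q) \<le> (Cs + 1) * k * ln (n / k)"
proof -
  \<comment> \<open>q may be far below k, where ln (n/q) exceeds ln (n/k); the excess q ln (k/q) is
    at most k - q because ln x <= x - 1.\<close>
  have "ln (n / q) = ln (n / k) + ln (k / q)" using assms by (simp add: ln_div)
  moreover have "q * ln (k / q) \<le> q * (k / q - 1)" using assms by (intro mult_left_mono ln_le_minus_one) auto
  moreover have "q * (k / q - 1) \<le> k" using assms by (simp add: right_diff_distrib)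
  moreover have "k * 1 \<le> k * ln (n / k)" using assms by (intro mult_left_mono) auto
  moreover have "q * ln (n / k) \<le> Cs * k * ln (n / k)" using assms by (intro mult_right_mono) linarith+
  ultimately show ?thesis by (simp add: algebra_simps)
qed

lemma card_mult_le_sum_squares:
  fixes \<theta> :: "'a \<Rightarrow> real" and c :: real
  assumes "finite T" "S \<subseteq> T" "\<And>i. i \<in> S \<Longrightarrow> c \<le> \<bar>\<theta> i\<bar>" "0 \<le> c"
  shows "card S * c\<^sup>2 \<le> (\<Sum>i\<in>T. (\<theta> i)\<^sup>2)"
proof -
  have "card S * c\<^sup>2 = (\<Sum>i\<in>S. c\<^sup>2)" by simp
  also have "\<dots> \<le> (\<Sum>i\<in>S. (\<theta> i)\<^sup>2)"
  proof (intro sum_mono)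
    fix i assume "i \<in> S"
    then have "c\<^sup>2 \<le> \<bar>\<theta> i\<bar>\<^sup>2" using assms by (intro power_mono) auto
    then show "c\<^sup>2 \<le> (\<theta> i)\<^sup>2" by simp
  qed
  also have "\<dots> \<le> (\<Sum>i\<in>T. (\<theta> i)\<^sup>2)" using assms by (intro sum_mono2) auto
  finally show ?thesis .
qed

text \<open>As q <= Cs k, ln (n/q) is at least L^2 - ln Cs, so for large L the threshold exceeds any
  fixed fraction of A sqrt 2 L. The squares below the threshold sum to at most K1 k L^2; dividing by
  the squared lower ends of the middle and big classes counts these, apart from the k signals, with
  100 coming from (L/10)^2.\<close>

lemma excessive_bias_classes:
  assumes A: "1 < A" and Cs: "0 < Cs" and Cb: "0 < Cb"
  shows "\<forall>\<^sub>F L in at_top. \<forall>n \<theta> q. excessive_bias_at A Cs Cb n \<theta> q \<longrightarrow> real (num_signals A n \<theta> q) = n * exp (- L\<^sup>2) \<longrightarrow>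
     classified (1 + 100 * (Cb * (Cs + 1))) L n \<theta> \<and>
     (\<exists>S \<subseteq> big_class L n \<theta>. real (card S) = n * exp (- L\<^sup>2) \<and> (\<forall>i\<in>S. sqrt 2 * L * ((3 * A + 1) / 4) \<le> \<bar>\<theta> i\<bar>))"
proof -
  \<comment> \<open>This makes A beta = (3A + 1)/4, the midpoint of A and (A + 1)/2.\<close>
  define \<beta> where "\<beta> = (3 * A + 1) / (4 * A)"
  have \<beta>: "0 < \<beta>" "\<beta> < 1" using A by (auto simp: \<beta>_def divide_simps)
  have c: "0 < 1 - \<beta>\<^sup>2" using \<beta> power_strict_mono[of \<beta> 1 2] by simp
  have "\<forall>\<^sub>F L in at_top. ln Cs \<le> (1 - \<beta>\<^sup>2) * L\<^sup>2" using c by real_asymp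
  moreover have "\<forall>\<^sub>F L in at_top. null_radius L < L / 10" unfolding null_radius_def by real_asymp
  ultimately show ?thesis using eventually_ge_at_top[of 1]
  proof eventually_elim
    case (elim L)
    show ?case
    proof (intro allI impI)
      fix n \<theta> q
      assume eb: "excessive_bias_at A Cs Cb n \<theta> q" and k_eq: "real (num_signals A n \<theta> q) = n * exp (- L\<^sup>2)"
      define k where "k = real (num_signals A n \<theta> q)"
      define thr where "thr = signal_threshold A n q"
      define S where "S = {i \<in> {1..n}. thr \<le> \<bar>\<theta> i\<bar>}"
      define T where "T = {i. i \<in> {1..n} \<and> \<bar>\<theta> i\<bar> < thr}"
      define K1 where "K1 = Cb * (Cs + 1)"
      have q: "1 \<le> q" "q < n" and sum: "(\<Sum>i\<in>T. (\<theta> i)\<^sup>2) \<le> Cb * q * ln (n / q)" and qk: "q / Cs \<le> k"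
        using eb by (auto simp: excessive_bias_at_def thr_def k_def T_def)
      have n: "0 < real n" using q by simp
      have qCs: "real q \<le> Cs * k" using qk Cs by (simp add: divide_simps mult.commute)
      have "0 < real q / Cs" using q Cs by simp
      then have k0: "0 < k" using qk by linarith
      then have k1: "1 \<le> k" by (simp add: k_def Suc_leI)
      have kn: "k = n * exp (- L\<^sup>2)" using k_eq by (simp add: k_def)
      have "n / k = exp (L\<^sup>2)" using n by (simp add: kn exp_minus inverse_eq_divide)
      then have lnk: "ln (n / k) = L\<^sup>2" by simp
      have L2: "1 \<le> L\<^sup>2" using elim by simp
      have K1: "0 < K1" using Cs Cb by (simp add: K1_def)
      have sumK: "(\<Sum>i\<in>T. (\<theta> i)\<^sup>2) \<le> K1 * k * L\<^sup>2"
      proof -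
        have "q * ln (n / q) \<le> (Cs + 1) * k * ln (n / k)"
          using q qCs k0 n L2 lnk by (intro excess_bias_scale) auto
        then have "Cb * (q * ln (n / q)) \<le> Cb * ((Cs + 1) * k * ln (n / k))" using Cb by (intro mult_left_mono) auto
        then show ?thesis using sum by (simp add: lnk K1_def mult.assoc)
      qed
      have "\<beta>\<^sup>2 * L\<^sup>2 \<le> ln (n / q)"
      proof -
        have "n / (Cs * k) \<le> n / q" using qCs q n k0 Cs by (intro divide_left_mono) auto
        then have "ln (n / (Cs * k)) \<le> ln (n / q)" using n k0 Cs q by (intro ln_mono) auto
        moreover have "ln (n / (Cs * k)) = ln (n / k) - ln Cs" using n k0 Cs by (simp add: ln_div ln_mult)
        ultimately show ?thesis using elim lnk by (simp add: algebra_simps)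
      qed
      then have "sqrt (2 * (\<beta>\<^sup>2 * L\<^sup>2)) \<le> sqrt (2 * ln (n / q))" by simp
      moreover have "sqrt (2 * (\<beta>\<^sup>2 * L\<^sup>2)) = sqrt 2 * (\<beta> * L)" using \<beta> elim by (simp add: real_sqrt_mult)
      ultimately have "A * (sqrt 2 * (\<beta> * L)) \<le> thr" using A by (simp add: thr_def signal_threshold_def)
      moreover have "A * (sqrt 2 * (\<beta> * L)) = sqrt 2 * L * (A * \<beta>)" by simp
      moreover have "A * \<beta> = (3 * A + 1) / 4" using A by (simp add: \<beta>_def)
      ultimately have thr: "sqrt 2 * L * ((3 * A + 1) / 4) \<le> thr" by simp
      have "L / 10 \<le> 1 * L * 1" using elim by simp
      also have "\<dots> \<le> sqrt 2 * L * ((3 * A + 1) / 4)" using elim A by (intro mult_mono) auto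
      finally have thrL: "L / 10 \<le> thr" using thr by simp
      have finT: "finite T" by (simp add: T_def)
      have cS: "real (card S) = k" by (simp add: k_def num_signals_def S_def thr_def)
      have SB: "S \<subseteq> big_class L n \<theta>" using thrL by (auto simp: S_def big_class_def)
      have \<nu>: "0 < null_radius L" by (simp add: null_radius_def)
      have M: "card (middle_class L n \<theta>) \<le> (1 + 100 * K1) * k * L\<^sup>2 * exp (L\<^sup>2 / 25)"
      proof -
        have "card (middle_class L n \<theta>) * (null_radius L)\<^sup>2 \<le> (\<Sum>i\<in>T. (\<theta> i)\<^sup>2)"
          using thrL \<nu> by (intro card_mult_le_sum_squares[OF finT]) (auto simp: middle_class_def T_def)
        also have "\<dots> \<le> K1 * k * L\<^sup>2" by (rule sumK)
        finally have "card (middle_class L n \<theta>) * (null_radius L)\<^sup>2 * exp (L\<^sup>2 / 25) \<le> K1 * k * L\<^sup>2 * exp (L\<^sup>2 / 25)"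
          by (intro mult_right_mono) auto
        moreover have "(null_radius L)\<^sup>2 * exp (L\<^sup>2 / 25) = 1"
          by (simp add: null_radius_def power2_eq_square flip: exp_add)
        moreover have "K1 * (k * L\<^sup>2 * exp (L\<^sup>2 / 25)) \<le> (1 + 100 * K1) * (k * L\<^sup>2 * exp (L\<^sup>2 / 25))"
          using K1 k0 by (intro mult_right_mono) auto
        ultimately show ?thesis by (simp add: mult.assoc)
      qed
      have B: "card (big_class L n \<theta>) \<le> (1 + 100 * K1) * k"
      proof -
        have "card (big_class L n \<theta> \<inter> T) * (L / 10)\<^sup>2 \<le> (\<Sum>i\<in>T. (\<theta> i)\<^sup>2)"
          using elim by (intro card_mult_le_sum_squares[OF finT]) (auto simp: big_class_def)
        also have "\<dots> \<le> K1 * k * L\<^sup>2" by (rule sumK)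
        finally have "card (big_class L n \<theta> \<inter> T) * L\<^sup>2 \<le> 100 * K1 * k * L\<^sup>2" by (simp add: power_divide)
        then have "card (big_class L n \<theta> \<inter> T) \<le> 100 * K1 * k" using L2 by (auto simp only: mult_le_cancel_right)
        moreover have "card (big_class L n \<theta>) \<le> card (S \<union> (big_class L n \<theta> \<inter> T))"
          by (intro card_mono) (auto simp: S_def T_def big_class_def)
        moreover have "card (S \<union> (big_class L n \<theta> \<inter> T)) \<le> card S + card (big_class L n \<theta> \<inter> T)" by (rule card_Un_le)
        ultimately show ?thesis using cS by (simp add: algebra_simps)
      qed
      have en: "exp (L\<^sup>2) \<le> n"
      proof -
        have "exp (L\<^sup>2) * 1 \<le> exp (L\<^sup>2) * k" using k1 by (intro mult_left_mono) auto
        also have "\<dots> = n" by (simp add: kn exp_minus)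
        finally show ?thesis by simp
      qed
      have "classified (1 + 100 * K1) L n \<theta>"
        unfolding class_sizes_def kn[symmetric] using M B en elim
        by (auto simp: null_class_def middle_class_def big_class_def)
      moreover have "\<forall>i\<in>S. sqrt 2 * L * ((3 * A + 1) / 4) \<le> \<bar>\<theta> i\<bar>" using thr by (auto simp: S_def)
      ultimately show "classified (1 + 100 * (Cb * (Cs + 1))) L n \<theta> \<and>
         (\<exists>S \<subseteq> big_class L n \<theta>. real (card S) = n * exp (- L\<^sup>2) \<and> (\<forall>i\<in>S. sqrt 2 * L * ((3 * A + 1) / 4) \<le> \<bar>\<theta> i\<bar>))"
        using SB cS kn unfolding K1_def by metis
    qed
  qed
qed

section \<open>Probability of atypical data\<close>

lemma data_law_sum_measurable:
  fixes g :: "nat \<Rightarrow> real \<Rightarrow> real"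
  assumes "I \<subseteq> {1..n}" "\<And>i. g i \<in> borel_measurable borel"
  shows "(\<lambda>Y. \<Sum>i\<in>I. g i (Y i)) \<in> borel_measurable (data_law n \<theta>)"
  using assms by (intro borel_measurable_sum measurable_compose[OF data_law_component_measurable]) auto

lemma data_law_prod_measurable:
  fixes g :: "nat \<Rightarrow> real \<Rightarrow> real"
  assumes "I \<subseteq> {1..n}" "\<And>i. g i \<in> borel_measurable borel"
  shows "(\<lambda>Y. \<Prod>i\<in>I. g i (Y i)) \<in> borel_measurable (data_law n \<theta>)"
  using assms by (intro borel_measurable_prod measurable_compose[OF data_law_component_measurable]) auto

lemma superlevel_set_measurable:
  fixes f :: "'a \<Rightarrow> real"
  shows "f \<in> borel_measurable M \<Longrightarrow> {x \<in> space M. c \<le> f x} \<in> sets M"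
  by (rule borel_measurable_le[OF borel_measurable_const])

lemma deviation_count_Markov:
  assumes I: "I \<subseteq> {1..n}" and w: "0 \<le> w" and t: "0 < t"
  shows "{Y \<in> space (data_law n \<theta>). t \<le> (\<Sum>i\<in>I. indicator {y. w < \<bar>y - \<theta> i\<bar>} (Y i))} \<in> sets (data_law n \<theta>)"
    and "measure (data_law n \<theta>) {Y \<in> space (data_law n \<theta>). t \<le> (\<Sum>i\<in>I. indicator {y. w < \<bar>y - \<theta> i\<bar>} (Y i))}
      \<le> card I * (2 * exp (- w\<^sup>2 / 2)) / t"
proof -
  show "{Y \<in> space (data_law n \<theta>). t \<le> (\<Sum>i\<in>I. indicator {y. w < \<bar>y - \<theta> i\<bar>} (Y i))} \<in> sets (data_law n \<theta>)"
    by (intro superlevel_set_measurable data_law_sum_measurable I) measurable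
  show "measure (data_law n \<theta>) {Y \<in> space (data_law n \<theta>). t \<le> (\<Sum>i\<in>I. indicator {y. w < \<bar>y - \<theta> i\<bar>} (Y i))}
      \<le> card I * (2 * exp (- w\<^sup>2 / 2)) / t"
    by (intro data_law_sum_Markov[OF I] gaussian_tail w t) (auto split: split_indicator)
qed

lemma sum_indicator_eq_card:
  assumes "finite I"
  shows "(\<Sum>i\<in>I. indicator (P i) (Y i)) = real (card {i \<in> I. Y i \<in> P i})"
  using assms by (simp add: indicator_def sum.If_cases Int_def)

text \<open>All bounds are uniform in k >= 1: Chebyshev for the null score, Markov for the errors
  and for the counts of large deviations, and on the grid Markov for the product of the sqrt R,
  summed over at most n points.\<close>

lemma typical_probability:
  assumes K: "0 < K" and A: "1 < A" and \<epsilon>: "0 < \<epsilon>"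
  shows "\<forall>\<^sub>F L in at_top. \<forall>n \<theta> S. classified K L n \<theta> \<longrightarrow>
     S \<subseteq> big_class L n \<theta> \<longrightarrow> real (card S) = n * exp (- L\<^sup>2) \<longrightarrow> (\<forall>i\<in>S. sqrt 2 * L * ((3 * A + 1) / 4) \<le> \<bar>\<theta> i\<bar>) \<longrightarrow>
     (\<exists>F \<in> sets (data_law n \<theta>). measure (data_law n \<theta>) F \<le> 5 * \<epsilon> \<and>
       (\<forall>Y \<in> space (data_law n \<theta>) - F. typical_data A L n \<theta> Y))"
proof -
  \<comment> \<open>Used at x = n >= exp(L^2): there are at most n grid points, each failing with
    probability at most exp(-sqrt n/640000).\<close>
  have "\<forall>\<^sub>F x::real in at_top. x * exp (- (sqrt x / 640000)) \<le> \<epsilon>" using \<epsilon> by real_asymp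
  then obtain x0 where x0: "\<And>x. x0 \<le> x \<Longrightarrow> x * exp (- (sqrt x / 640000)) \<le> \<epsilon>" by (auto simp: eventually_at_top_linorder)
  have ev1: "\<forall>\<^sub>F L::real in at_top. x0 \<le> exp (L\<^sup>2)" by real_asymp
  have ev2: "\<forall>\<^sub>F L::real in at_top. K * exp (- L\<^sup>2) * (L\<^sup>2 * exp (L\<^sup>2 / 25) + 1) \<le> 1 / 2" using K by real_asymp
  \<comment> \<open>The large number is 2000000 * 400000^2, from the second-moment bound and the
    Chebyshev radius k/400000.\<close>
  have ev3: "\<forall>\<^sub>F L::real in at_top. 320000000000000000 / sqrt L \<le> \<epsilon>" "\<forall>\<^sub>F L::real in at_top. 1 / L \<le> \<epsilon>"
    using \<epsilon> by real_asymp+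
  \<comment> \<open>Noise of size 2L/5 has exponent 2/25, which beats the 1/25 in the size of the
    middle class.\<close>
  have ev4: "\<forall>\<^sub>F L::real in at_top. K * L\<^sup>2 * exp (L\<^sup>2 / 25) * (2 * exp (- (2 * L / 5)\<^sup>2 / 2)) \<le> \<epsilon>"
  proof -
    have "exp (L\<^sup>2 / 25) * exp (- (2 * L / 5)\<^sup>2 / 2) = exp (- (L\<^sup>2 / 25))" for L :: real
      by (simp add: power_divide power_mult_distrib flip: exp_add)
    moreover have "K * L\<^sup>2 * exp (L\<^sup>2 / 25) * (2 * exp (- (2 * L / 5)\<^sup>2 / 2))
        = 2 * K * L\<^sup>2 * (exp (L\<^sup>2 / 25) * exp (- (2 * L / 5)\<^sup>2 / 2))" for L :: real
      by (simp only: mult_ac)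
    ultimately have "K * L\<^sup>2 * exp (L\<^sup>2 / 25) * (2 * exp (- (2 * L / 5)\<^sup>2 / 2)) = 2 * K * L\<^sup>2 * exp (- (L\<^sup>2 / 25))" for L :: real
      by metis
    moreover have "\<forall>\<^sub>F L::real in at_top. 2 * K * L\<^sup>2 * exp (- (L\<^sup>2 / 25)) \<le> \<epsilon>" using K \<epsilon> by real_asymp
    ultimately show ?thesis by presburger
  qed
  \<comment> \<open>(A - 1)/4 is the gap between (3A + 1)/4, the level of the signals, and (A +
    1)/2, the level required of the observations.\<close>
  have ev5: "\<forall>\<^sub>F L::real in at_top. 4 * exp (- (sqrt 2 * L * ((A - 1) / 4))\<^sup>2 / 2) \<le> \<epsilon>"
  proof -
    define d where "d = (A - 1) / 4"
    have "0 < d" using A by (simp add: d_def)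
    then have "\<forall>\<^sub>F L::real in at_top. 4 * exp (- (L * d)\<^sup>2) \<le> \<epsilon>" using \<epsilon> by real_asymp
    moreover have "- (sqrt 2 * L * d)\<^sup>2 / 2 = - (L * d)\<^sup>2" for L by (simp add: power_mult_distrib)
    ultimately show ?thesis unfolding d_def[symmetric] by simp
  qed
  have ev6: "\<forall>\<^sub>F L::real in at_top. 2 * null_radius L \<le> (grid_floor L)\<^sup>2 / 160000" "\<forall>\<^sub>F L::real in at_top. null_radius L \<le> 1"
    unfolding null_radius_def grid_floor_def by real_asymp+
  show ?thesis
    using ev1 ev2 ev3 ev4 ev5 ev6 near_null_score_moments ref_tau_pos_small[of "1/100000", simplified] eventually_ge_at_top[of 1]
  proof eventually_elim
    case (elim L)
    show ?case
    proof (intro allI impI)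
      fix n \<theta> S
      define N M B where "N = null_class L n \<theta>" and "M = middle_class L n \<theta>" and "B = big_class L n \<theta>"
      define P where "P = data_law n \<theta>"
      define \<tau>0 k where "\<tau>0 = ref_tau L" and "k = n * exp (- L\<^sup>2)"
      assume cs: "classified K L n \<theta>"
        and S: "S \<subseteq> big_class L n \<theta>" "real (card S) = n * exp (- L\<^sup>2)" "\<forall>i\<in>S. sqrt 2 * L * ((3 * A + 1) / 4) \<le> \<bar>\<theta> i\<bar>"
      note cs = cs[folded N_def M_def B_def] and S = S[folded B_def k_def]
      note fin = class_sizes_finite[OF cs]
      interpret prob_space P unfolding P_def by (rule prob_space_data_law)
      have sub: "N \<subseteq> {1..n}" "M \<subseteq> {1..n}" "B \<subseteq> {1..n}" using cs by (auto simp: class_sizes_def)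
      have en: "exp (L\<^sup>2) \<le> n" using cs by (simp add: class_sizes_def)
      then have n: "0 < real n" using exp_gt_zero[of "L\<^sup>2"] by linarith
      have k1: "1 \<le> k" using en by (simp add: k_def exp_minus field_simps)
      have \<tau>0: "0 < \<tau>0" "\<tau>0 \<le> 1 / 100000" and \<tau>2: "\<tau>0 \<le> 1 / 2" using elim by (auto simp: \<tau>0_def)
      have L: "1 \<le> L" using elim by simp
      have Nhalf: "n / 2 \<le> card N"
      proof -
        have "card {1..n} = card N + card M + card B"
          using class_sizes_sum_split[OF cs, of "\<lambda>_. 1"] by simp
        then have "real n = card N + card M + card B" by simp
        moreover have "card M + card B \<le> n * (K * exp (- L\<^sup>2) * (L\<^sup>2 * exp (L\<^sup>2 / 25) + 1))"
          using cs by (simp add: class_sizes_def algebra_simps)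
        moreover have "n * (K * exp (- L\<^sup>2) * (L\<^sup>2 * exp (L\<^sup>2 / 25) + 1)) \<le> n * (1 / 2)" using elim by (intro mult_left_mono) auto
        ultimately show ?thesis by simp
      qed
      have mom: "normal_mean (\<theta> i) (score \<tau>0) \<le> - (exp (- L\<^sup>2) / 100000)"
         "- (400000 * exp (- L\<^sup>2)) \<le> normal_mean (\<theta> i) (score \<tau>0)"
         "normal_mean (\<theta> i) (\<lambda>y. (score \<tau>0 y)\<^sup>2) \<le> 2000000 * (exp (- L\<^sup>2) / sqrt L)"
         "normal_mean (\<theta> i) (lr_error \<tau>0) \<le> exp (- L\<^sup>2) / L" if "i \<in> N" for i
        using elim that by (auto simp: N_def null_class_def \<tau>0_def)
      define \<mu> where "\<mu> = (\<Sum>i\<in>N. normal_mean (\<theta> i) (score \<tau>0))"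
      have \<mu>: "\<mu> \<le> - (k / 200000)" "- (400000 * k) \<le> \<mu>"
      proof -
        have "\<mu> \<le> card N * (- (exp (- L\<^sup>2) / 100000))" unfolding \<mu>_def by (intro sum_bounded_above mom)
        also have "\<dots> \<le> n / 2 * (- (exp (- L\<^sup>2) / 100000))" using Nhalf by (intro mult_right_mono_neg) auto
        finally show "\<mu> \<le> - (k / 200000)" by (simp add: k_def)
        have "- \<mu> \<le> card N * (400000 * exp (- L\<^sup>2))" unfolding \<mu>_def sum_negf[symmetric]
          using mom(2) by (intro sum_bounded_above) (simp add: minus_le_iff)
        also have "\<dots> \<le> n * (400000 * exp (- L\<^sup>2))" using fin by (intro mult_right_mono) auto
        finally show "- (400000 * k) \<le> \<mu>" by (simp add: k_def)
      qed
      define F1 where "F1 = {Y \<in> space P. k / 400000 \<le> \<bar>(\<Sum>i\<in>N. score \<tau>0 (Y i)) - \<mu>\<bar>}"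
      have F1m: "F1 \<in> sets P" unfolding F1_def P_def
        by (intro superlevel_set_measurable borel_measurable_abs borel_measurable_diff data_law_sum_measurable[OF sub(1)]) auto
      have F1: "measure P F1 \<le> \<epsilon>"
      proof -
        have "measure P F1 \<le> card N * (2000000 * (exp (- L\<^sup>2) / sqrt L)) / (k / 400000)\<^sup>2"
          unfolding F1_def P_def \<mu>_def using abs_score_le_one[OF \<tau>0(1) \<tau>2] k1 mom(3)
          by (intro data_law_sum_Chebyshev[OF sub(1)]) auto
        also have "\<dots> \<le> n * (2000000 * (exp (- L\<^sup>2) / sqrt L)) / (k / 400000)\<^sup>2"
          using fin L by (intro divide_right_mono mult_right_mono) auto
        also have "\<dots> = 320000000000000000 / sqrt L * (1 / k)"
        proof -
          have "n * (2000000 * (exp (- L\<^sup>2) / sqrt L)) = 2000000 * k / sqrt L" by (simp add: k_def)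
          then show ?thesis using k1 L by (simp add: power2_eq_square field_simps)
        qed
        also have "\<dots> \<le> 320000000000000000 / sqrt L * 1" using k1 L by (intro mult_left_mono) auto
        finally show ?thesis using elim by simp
      qed
      define F2 where "F2 = {Y \<in> space P. k \<le> (\<Sum>i\<in>N. lr_error \<tau>0 (Y i))}"
      have F2m: "F2 \<in> sets P" unfolding F2_def P_def
        by (intro superlevel_set_measurable data_law_sum_measurable[OF sub(1)]) auto
      have F2: "measure P F2 \<le> \<epsilon>"
      proof -
        have "lr_error \<tau>0 y \<le> 1" for y using lr_error_le[OF \<tau>0(1) \<tau>2, of y] \<tau>0 by simp
        then have "measure P F2 \<le> card N * (exp (- L\<^sup>2) / L) / k"
          unfolding F2_def P_def using lr_error_nonneg[OF \<tau>0(1) \<tau>2] k1 mom(4)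
          by (intro data_law_sum_Markov[OF sub(1)]) auto
        also have "\<dots> \<le> n * (exp (- L\<^sup>2) / L) / k"
          using fin L k1 by (intro divide_right_mono mult_right_mono) auto
        also have "\<dots> = 1 / L"
        proof -
          have eq: "n * (exp (- L\<^sup>2) / L) = k / L" by (simp add: k_def)
          show ?thesis unfolding eq using k1 by simp
        qed
        finally show ?thesis using elim by simp
      qed
      define F3 where "F3 = {Y \<in> space P. k \<le> (\<Sum>i\<in>M. indicator {y. 2 * L / 5 < \<bar>y - \<theta> i\<bar>} (Y i))}"
      have F3m: "F3 \<in> sets P" unfolding F3_def P_def using L k1 by (intro deviation_count_Markov[OF sub(2)]) auto
      have F3: "measure P F3 \<le> \<epsilon>"
      proof -
        have "measure P F3 \<le> card M * (2 * exp (- (2 * L / 5)\<^sup>2 / 2)) / k"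
          unfolding F3_def P_def using L k1 by (intro deviation_count_Markov[OF sub(2)]) auto
        also have "\<dots> \<le> (K * k * L\<^sup>2 * exp (L\<^sup>2 / 25)) * (2 * exp (- (2 * L / 5)\<^sup>2 / 2)) / k"
          using cs k1 by (intro divide_right_mono mult_right_mono) (auto simp: class_sizes_def k_def)
        also have "\<dots> = K * L\<^sup>2 * exp (L\<^sup>2 / 25) * (2 * exp (- (2 * L / 5)\<^sup>2 / 2))" using k1 by simp
        finally show ?thesis using elim by linarith
      qed
      define w where "w = sqrt 2 * L * ((A - 1) / 4)"
      have w: "0 \<le> w" using A L by (simp add: w_def)
      have Sn: "S \<subseteq> {1..n}" using S sub by auto
      define F4 where "F4 = {Y \<in> space P. k / 2 \<le> (\<Sum>i\<in>S. indicator {y. w < \<bar>y - \<theta> i\<bar>} (Y i))}"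
      have F4m: "F4 \<in> sets P" unfolding F4_def P_def using w k1 by (intro deviation_count_Markov[OF Sn]) auto
      have F4: "measure P F4 \<le> \<epsilon>"
      proof -
        have "measure P F4 \<le> card S * (2 * exp (- w\<^sup>2 / 2)) / (k / 2)"
          unfolding F4_def P_def using w k1 by (intro deviation_count_Markov[OF Sn]) auto
        also have "\<dots> = 4 * exp (- w\<^sup>2 / 2)" using S k1 by simp
        finally show ?thesis using elim unfolding w_def by linarith
      qed
      define J where "J = {j \<in> {1..n}. grid_floor L / 2 \<le> real j / n}"
      define G where "G j = {Y \<in> space P. exp (- (n * (real j / n)\<^sup>2 / 160000)) \<le> (\<Prod>i\<in>N. sqrt (hs_lr (real j / n) (Y i)))}" for j
      define F5 where "F5 = (\<Union>j\<in>J. G j)"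
      have Gm: "G j \<in> sets P" for j unfolding G_def P_def
        by (intro superlevel_set_measurable data_law_prod_measurable[OF sub(1)]) measurable
      have G: "measure P (G j) \<le> exp (- (sqrt n / 640000))" if j: "j \<in> J" for j
      proof -
        define a where "a = real j / n"
        have a: "0 < a" "a \<le> 1" "grid_floor L / 2 \<le> a" using j n by (auto simp: a_def J_def)
        have g0: "0 < grid_floor L" by (simp add: grid_floor_def)
        have "(grid_floor L / 2)\<^sup>2 \<le> a\<^sup>2" using a g0 by (intro power_mono) auto
        then have ga: "(grid_floor L)\<^sup>2 / 4 \<le> a\<^sup>2" by (simp add: power_divide)
        \<comment> \<open>Half of the deficit a^2/20000 pays for the shift term 2
          \<open>null_radius L\<close>, as a >= \<open>grid_floor L / 2\<close>.\<close>
        have r: "1 - a\<^sup>2 / 20000 + 2 * null_radius L \<le> exp (- (a\<^sup>2 / 40000))"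
          using exp_ge_add_one_self[of "- (a\<^sup>2 / 40000)"] ga elim by linarith
        have near: "integrable lborel (\<lambda>y. normal_density (\<theta> i) 1 y * sqrt (hs_lr a y))"
          "normal_mean (\<theta> i) (\<lambda>y. sqrt (hs_lr a y)) \<le> exp (- (a\<^sup>2 / 40000))" if "i \<in> N" for i
        proof -
          have \<theta>: "\<bar>\<theta> i\<bar> \<le> null_radius L" "0 < null_radius L" "null_radius L \<le> 1"
            using that elim by (auto simp: N_def null_class_def) (simp add: null_radius_def)
          show "integrable lborel (\<lambda>y. normal_density (\<theta> i) 1 y * sqrt (hs_lr a y))"
            by (rule sqrt_hs_lr_mean_near_null(1)[OF a(1,2) \<theta>])
          show "normal_mean (\<theta> i) (\<lambda>y. sqrt (hs_lr a y)) \<le> exp (- (a\<^sup>2 / 40000))"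
            using sqrt_hs_lr_mean_near_null(2)[OF a(1,2) \<theta>] r by linarith
        qed
        have "measure P (G j) \<le> exp (- (a\<^sup>2 / 40000)) ^ card N / exp (- (n * a\<^sup>2 / 160000))"
          unfolding G_def P_def a_def[symmetric] using near hs_lr_nonneg[OF a(1)]
          by (intro data_law_prod_Markov[OF sub(1)]) auto
        also have "\<dots> = exp (- (card N * a\<^sup>2 / 40000) + n * a\<^sup>2 / 160000)"
          unfolding exp_of_nat_mult[symmetric] exp_diff[symmetric] by simp
        also have "\<dots> \<le> exp (- (sqrt n / 640000))"
        proof -
          \<comment> \<open>At least n/2 null coordinates give the exponent n a^2/80000. Half of it
            is spent on the threshold in \<open>G\<close>; the rest is at least n g^2/640000, where
            g is the grid floor.\<close>
          have "n / 2 * a\<^sup>2 \<le> card N * a\<^sup>2" using Nhalf by (intro mult_right_mono) auto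
          moreover have "n * ((grid_floor L)\<^sup>2 / 4) \<le> n * a\<^sup>2" using ga by (intro mult_left_mono) auto
          moreover have "sqrt n \<le> n * (grid_floor L)\<^sup>2"
          proof -
            have "exp (L\<^sup>2 / 100) \<le> exp (L\<^sup>2 / 2)" by simp
            also have "\<dots> = sqrt (exp (L\<^sup>2))" by (rule real_sqrt_unique[symmetric]) (auto simp flip: exp_double)
            also have "\<dots> \<le> sqrt n" using en by simp
            finally have "sqrt n * exp (L\<^sup>2 / 100) \<le> sqrt n * sqrt n" using n by (intro mult_left_mono) auto
            then have "sqrt n * exp (L\<^sup>2 / 100) * exp (- (L\<^sup>2 / 100)) \<le> n * exp (- (L\<^sup>2 / 100))" by (intro mult_right_mono) auto
            moreover have "exp (L\<^sup>2 / 100) * exp (- (L\<^sup>2 / 100)) = 1" by (simp flip: exp_add)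
            moreover have "exp (- (L\<^sup>2 / 100)) = (grid_floor L)\<^sup>2" by (simp add: grid_floor_def flip: exp_double)
            ultimately show ?thesis by (simp add: mult.assoc)
          qed
          ultimately show ?thesis by simp
        qed
        finally show ?thesis .
      qed
      have F5m: "F5 \<in> sets P" unfolding F5_def J_def using Gm by auto
      have F5: "measure P F5 \<le> \<epsilon>"
      proof -
        have finJ: "finite J" by (simp add: J_def)
        have "measure P F5 \<le> (\<Sum>j\<in>J. measure P (G j))" unfolding F5_def using Gm finJ
          by (intro finite_measure_subadditive_finite) auto
        also have "\<dots> \<le> card J * exp (- (sqrt n / 640000))" by (intro sum_bounded_above G)
        also have "\<dots> \<le> n * exp (- (sqrt n / 640000))"
        proof (rule mult_right_mono)
          have "card J \<le> card {1..n}" by (intro card_mono) (auto simp: J_def)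
          then show "real (card J) \<le> n" by simp
        qed simp
        also have "\<dots> \<le> \<epsilon>" using en elim by (intro x0) simp
        finally show ?thesis .
      qed
      define F where "F = F1 \<union> F2 \<union> F3 \<union> F4 \<union> F5"
      have Fm: "F \<in> sets P" unfolding F_def using F1m F2m F3m F4m F5m by auto
      have "measure P F \<le> measure P F1 + measure P F2 + measure P F3 + measure P F4 + measure P F5"
        unfolding F_def using F1m F2m F3m F4m F5m
        by (intro order_trans[OF measure_Un_le] add_mono order_refl) auto
      then have F5e: "measure P F \<le> 5 * \<epsilon>" using F1 F2 F3 F4 F5 by linarith
      have "typical ((A + 1) / 2) L n N M B Y" if Y: "Y \<in> space P - F" for Y
      proof -
        have "\<bar>(\<Sum>i\<in>N. score \<tau>0 (Y i)) - \<mu>\<bar> < k / 400000" using Y by (auto simp: F_def F1_def)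
        then have T1: "(\<Sum>i\<in>N. score \<tau>0 (Y i)) \<le> - (k / 400000)" "- (400001 * k) \<le> (\<Sum>i\<in>N. score \<tau>0 (Y i))"
          using \<mu> k1 by linarith+
        have T2: "(\<Sum>i\<in>N. lr_error \<tau>0 (Y i)) \<le> k" using Y by (auto simp: F_def F2_def)
        have T3: "card {i \<in> M. L / 2 < \<bar>Y i\<bar>} \<le> k"
        proof -
          have "(\<Sum>i\<in>M. indicator {y. 2 * L / 5 < \<bar>y - \<theta> i\<bar>} (Y i)) < k" using Y by (auto simp: F_def F3_def)
          then have "card {i \<in> M. 2 * L / 5 < \<bar>Y i - \<theta> i\<bar>} < k"
            using fin by (simp add: sum_indicator_eq_card)
          moreover have "card {i \<in> M. L / 2 < \<bar>Y i\<bar>} \<le> card {i \<in> M. 2 * L / 5 < \<bar>Y i - \<theta> i\<bar>}"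
          proof (intro card_mono subsetI)
            fix i assume "i \<in> {i \<in> M. L / 2 < \<bar>Y i\<bar>}"
            then have i: "i \<in> M" "L / 2 < \<bar>Y i\<bar>" "\<bar>\<theta> i\<bar> < L / 10" by (auto simp: M_def middle_class_def)
            then have "2 * L / 5 < \<bar>Y i - \<theta> i\<bar>" by linarith
            with i show "i \<in> {i \<in> M. 2 * L / 5 < \<bar>Y i - \<theta> i\<bar>}" by simp
          qed (use fin in simp)
          ultimately show ?thesis by linarith
        qed
        have T4: "k / 2 \<le> card {i \<in> B. sqrt 2 * ((A + 1) / 2) * L \<le> \<bar>Y i\<bar>}"
        proof -
          have finS: "finite S" using Sn finite_subset by blast
          have "(\<Sum>i\<in>S. indicator {y. w < \<bar>y - \<theta> i\<bar>} (Y i)) < k / 2" using Y by (auto simp: F_def F4_def)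
          then have "card {i \<in> S. w < \<bar>Y i - \<theta> i\<bar>} < k / 2" using finS by (simp add: sum_indicator_eq_card)
          \<comment> \<open>Every signal either deviates by more than w or is observed above the
            required level, so fewer than k/2 deviations among k signals leave at least k/2.\<close>
          moreover have "card S \<le> card ({i \<in> S. w < \<bar>Y i - \<theta> i\<bar>} \<union> {i \<in> B. sqrt 2 * ((A + 1) / 2) * L \<le> \<bar>Y i\<bar>})"
          proof (intro card_mono subsetI)
            fix i assume i: "i \<in> S"
            have "\<not> w < \<bar>Y i - \<theta> i\<bar> \<Longrightarrow> sqrt 2 * L * ((3 * A + 1) / 4) - w \<le> \<bar>Y i\<bar>" using S(3) i by fastforce
            moreover have "sqrt 2 * L * ((3 * A + 1) / 4) - w = sqrt 2 * ((A + 1) / 2) * L" by (simp add: w_def field_simps)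
            ultimately have "\<not> w < \<bar>Y i - \<theta> i\<bar> \<Longrightarrow> sqrt 2 * ((A + 1) / 2) * L \<le> \<bar>Y i\<bar>" by metis
            then show "i \<in> {i \<in> S. w < \<bar>Y i - \<theta> i\<bar>} \<union> {i \<in> B. sqrt 2 * ((A + 1) / 2) * L \<le> \<bar>Y i\<bar>}" using i S(1) by blast
          qed (use finS fin in auto)
          moreover have "card ({i \<in> S. w < \<bar>Y i - \<theta> i\<bar>} \<union> {i \<in> B. sqrt 2 * ((A + 1) / 2) * L \<le> \<bar>Y i\<bar>})
              \<le> card {i \<in> S. w < \<bar>Y i - \<theta> i\<bar>} + card {i \<in> B. sqrt 2 * ((A + 1) / 2) * L \<le> \<bar>Y i\<bar>}" by (rule card_Un_le)
          ultimately show ?thesis using S(2) by linarith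
        qed
        have T5: "(\<Sum>i\<in>N. ln (hs_lr (real j / n) (Y i))) \<le> - (n * (real j / n)\<^sup>2 / 80000)"
          if j: "j \<in> {1..n}" "grid_floor L / 2 \<le> real j / n" for j
        proof -
          define a where "a = real j / n"
          have a: "0 < a" using j n by (auto simp: a_def)
          have "Y \<notin> G j" using Y j by (auto simp: F_def F5_def J_def)
          then have lt: "(\<Prod>i\<in>N. sqrt (hs_lr a (Y i))) < exp (- (n * a\<^sup>2 / 160000))" using Y by (auto simp: G_def a_def)
          have pos: "0 < sqrt (hs_lr a (Y i))" for i using hs_lr_pos[OF a] by simp
          have nz: "hs_lr a y \<noteq> 0" for y using hs_lr_pos[OF a, of y] by simp
          have "ln (\<Prod>i\<in>N. sqrt (hs_lr a (Y i))) \<le> ln (exp (- (n * a\<^sup>2 / 160000)))"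
            using lt pos by (intro ln_mono prod_pos) auto
          moreover have "ln (\<Prod>i\<in>N. sqrt (hs_lr a (Y i))) = (\<Sum>i\<in>N. ln (sqrt (hs_lr a (Y i))))"
            using fin nz by (intro ln_prod) auto
          moreover have "(\<Sum>i\<in>N. ln (sqrt (hs_lr a (Y i)))) = (\<Sum>i\<in>N. ln (hs_lr a (Y i))) / 2"
            unfolding sum_divide_distrib by (intro sum.cong refl ln_sqrt hs_lr_nonneg a)
          ultimately show ?thesis unfolding a_def[symmetric] by simp
        qed
        show ?thesis unfolding typical_def \<tau>0_def[symmetric] k_def[symmetric]
          using T1 T2 T3 T4 T5 by blast
      qed
      then show "\<exists>F \<in> sets (data_law n \<theta>). measure (data_law n \<theta>) F \<le> 5 * \<epsilon> \<and>
         (\<forall>Y \<in> space (data_law n \<theta>) - F. typical_data A L n \<theta> Y)"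
        using Fm F5e unfolding P_def N_def M_def B_def by blast
    qed
  qed
qed

text \<open>An infimum over an empty set of reals carries no information, so the parameter set has
  to be inhabited for large n. The witness puts m coordinates exactly at the threshold for q = 1,
  and m >= 1/Cs makes them numerous enough.\<close>

lemma Theta_nonempty:
  assumes A: "0 < A" and Cs: "0 < Cs" and Cb: "0 < Cb" and n: "1 < n"
    and m: "1 / Cs \<le> real m" "m \<le> n" "m \<le> p"
  shows "Theta A Cs Cb n p \<noteq> {}"
proof -
  define b where "b = signal_threshold A n 1"
  have b: "0 < b" using A n by (simp add: b_def signal_threshold_def)
  define \<theta> where "\<theta> = restrict (\<lambda>i. if i \<le> m then b else 0) {1..n}"
  have "{i \<in> {1..n}. \<theta> i \<noteq> 0} = {1..m}" using b m by (auto simp: \<theta>_def split: if_splits)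
  then have "\<theta> \<in> nearly_black n p" using m by (auto simp: nearly_black_def \<theta>_def)
  moreover have "excessive_bias_at A Cs Cb n \<theta> 1"
  proof -
    have "{i \<in> {1..n}. b \<le> \<bar>\<theta> i\<bar>} = {1..m}" using b m by (auto simp: \<theta>_def split: if_splits)
    then have "num_signals A n \<theta> 1 = m" unfolding num_signals_def b_def[symmetric] by simp
    moreover have "(\<Sum>i | i \<in> {1..n} \<and> \<bar>\<theta> i\<bar> < signal_threshold A n 1. (\<theta> i)\<^sup>2) = 0"
      unfolding b_def[symmetric] by (intro sum.neutral) (auto simp: \<theta>_def)
    moreover have "0 \<le> Cb * ln (real n)" using Cb n by simp
    ultimately show ?thesis using n m by (simp add: excessive_bias_at_def)
  qed
  ultimately show ?thesis by (auto simp: Theta_def)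
qed

text \<open>Since q < n the threshold is positive, so signals are nonzero coordinates and at most p
  in number; q >= 1 forces at least one of them.\<close>

lemma Theta_excessive_bias:
  assumes A: "0 < A" and Cs: "0 < Cs" and \<theta>: "\<theta> \<in> Theta A Cs Cb n p"
  obtains q where "excessive_bias_at A Cs Cb n \<theta> q" "p_tilde A Cs Cb n \<theta> = num_signals A n \<theta> q"
    "1 \<le> p_tilde A Cs Cb n \<theta>" "p_tilde A Cs Cb n \<theta> \<le> p"
proof -
  define q where "q = (LEAST q. excessive_bias_at A Cs Cb n \<theta> q)"
  have eb: "excessive_bias_at A Cs Cb n \<theta> q" using \<theta> unfolding q_def by (auto simp: Theta_def intro: LeastI)
  have k: "p_tilde A Cs Cb n \<theta> = num_signals A n \<theta> q" by (simp add: p_tilde_def q_def)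
  have q: "1 \<le> q" "q < n" "q / Cs \<le> num_signals A n \<theta> q" using eb by (auto simp: excessive_bias_at_def)
  have "0 < real q / Cs" using q Cs by simp
  then have "0 < real (num_signals A n \<theta> q)" using q by linarith
  then have k1: "1 \<le> p_tilde A Cs Cb n \<theta>" by (simp add: k)
  have "0 < signal_threshold A n q" using A q by (simp add: signal_threshold_def)
  then have "num_signals A n \<theta> q \<le> card {i \<in> {1..n}. \<theta> i \<noteq> 0}"
    unfolding num_signals_def by (intro card_mono) auto
  also have "\<dots> \<le> p" using \<theta> by (simp add: Theta_def nearly_black_def)
  finally show thesis using that eb k k1 by simp
qed

section \<open>From the likelihood comparison to the estimator\<close>

lemma marginal_likelihood_less:
  assumes "0 < \<tau>" "0 < \<sigma>" "(\<Sum>i = 1..n. log_lr \<tau> \<sigma> (Y i)) < 0"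
  shows "marginal_likelihood n Y \<tau> < marginal_likelihood n Y \<sigma>"
proof -
  have "(\<Sum>i = 1..n. ln (hs_lr \<tau> (Y i))) < (\<Sum>i = 1..n. ln (hs_lr \<sigma> (Y i)))"
    using assms(3) by (simp add: sum_subtractf)
  moreover have "(\<Sum>i = 1..n. ln (hs_lr t (Y i))) = ln (\<Prod>i = 1..n. hs_lr t (Y i))" if "0 < t" for t
    using hs_lr_pos[OF that, THEN less_imp_neq] by (subst ln_prod) (metis finite_atLeastAtMost | simp)+
  ultimately have "ln (\<Prod>i = 1..n. hs_lr \<tau> (Y i)) < ln (\<Prod>i = 1..n. hs_lr \<sigma> (Y i))" using assms by simp
  then have "(\<Prod>i = 1..n. hs_lr \<tau> (Y i)) < (\<Prod>i = 1..n. hs_lr \<sigma> (Y i))"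
    using assms hs_lr_pos by (subst (asm) ln_less_cancel_iff) (auto intro!: prod_pos)
  moreover have "0 < (\<Prod>i = 1..n. std_normal_density (Y i))" by (intro prod_pos ballI normal_density_pos) simp
  ultimately show ?thesis using assms by (simp add: marginal_likelihood_eq)
qed

theorem lemma4p4:
  fixes A Cs Cb :: real and p :: "nat \<Rightarrow> nat"
  assumes "A > 1" and "Cs > 0" and "Cb > 0"
    and "filterlim p at_top sequentially"
    and "(\<lambda>n. real (p n)) \<in> o(\<lambda>n. real n)"
  shows "\<exists>C>1. \<forall>tau_hat. is_MMLE tau_hat \<longrightarrow>
    (\<lambda>n. INF \<theta>\<in>Theta A Cs Cb n (p n).
        measure (data_law n \<theta>)
          {Y \<in> space (data_law n \<theta>).
             inverse C * tau_rate n (p_tilde A Cs Cb n \<theta>) \<le> tau_hat n Y \<and>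
             tau_hat n Y \<le> C * tau_rate n (p_tilde A Cs Cb n \<theta>)}) \<longlonglongrightarrow> 1"
proof -
  define K where "K = 1 + 100 * (Cb * (Cs + 1))"
  have "0 \<le> Cb * (Cs + 1)" using assms by simp
  then have K: "0 < K" by (simp add: K_def)
  have A': "1 < (A + 1) / 2" using assms by simp
  obtain C where C: "1 < C" and max: "\<forall>\<^sub>F L in at_top. \<forall>n N M B Y \<tau>. class_sizes K L n N M B \<longrightarrow> typical ((A + 1) / 2) L n N M B Y \<longrightarrow>
    0 < \<tau> \<longrightarrow> \<tau> \<le> 1 \<longrightarrow> \<not> (ref_tau L / C \<le> \<tau> \<and> \<tau> \<le> C * ref_tau L) \<longrightarrow>
    (\<Sum>i = 1..n. log_lr \<tau> (ref_tau L) (Y i)) < 0"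
    using typical_maximiser[OF K A'] by blast
  have "(\<lambda>n. INF \<theta>\<in>Theta A Cs Cb n (p n).
        measure (data_law n \<theta>)
          {Y \<in> space (data_law n \<theta>).
             inverse C * tau_rate n (p_tilde A Cs Cb n \<theta>) \<le> tau_hat n Y \<and>
             tau_hat n Y \<le> C * tau_rate n (p_tilde A Cs Cb n \<theta>)}) \<longlonglongrightarrow> 1"
    (is "(\<lambda>n. INF \<theta>\<in>_. measure _ (?good n \<theta>)) \<longlonglongrightarrow> 1")
    if mmle: "is_MMLE tau_hat" for tau_hat
  proof (rule LIMSEQ_I)
    fix \<epsilon> :: real assume \<epsilon>: "0 < \<epsilon>"
    then have \<epsilon>10: "0 < \<epsilon> / 10" by simp
    \<comment> \<open>The required size of L is uniform in n, theta and q, because L will be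
      computed from n and the number of signals of theta.\<close>
    have "\<forall>\<^sub>F L in at_top. \<forall>n\<ge>1. \<forall>\<theta> q. excessive_bias_at A Cs Cb n \<theta> q \<longrightarrow> real (num_signals A n \<theta> q) = n * exp (- L\<^sup>2) \<longrightarrow>
      1 / n \<le> ref_tau L \<longrightarrow>
      (\<exists>F \<in> sets (data_law n \<theta>). measure (data_law n \<theta>) F \<le> \<epsilon> / 2 \<and>
       (\<forall>Y \<in> space (data_law n \<theta>) - F. ref_tau L / C \<le> tau_hat n Y \<and> tau_hat n Y \<le> C * ref_tau L))"
      using max excessive_bias_classes[OF assms(1-3), folded K_def] typical_probability[OF K assms(1) \<epsilon>10]
        ref_tau_pos_small[of 1, simplified]
    proof eventually_elim
      case (elim L)
      show ?case
      proof (intro allI impI)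
        fix n \<theta> q
        assume n: "1 \<le> n" and eb: "excessive_bias_at A Cs Cb n \<theta> q" "real (num_signals A n \<theta> q) = n * exp (- L\<^sup>2)"
          and lo: "1 / n \<le> ref_tau L"
        obtain S where cs: "classified K L n \<theta>"
          and S: "S \<subseteq> big_class L n \<theta>" "real (card S) = n * exp (- L\<^sup>2)" "\<forall>i\<in>S. sqrt 2 * L * ((3 * A + 1) / 4) \<le> \<bar>\<theta> i\<bar>"
          using elim(2)[rule_format, OF eb] by auto
        obtain F where F: "F \<in> sets (data_law n \<theta>)" "measure (data_law n \<theta>) F \<le> 5 * (\<epsilon> / 10)"
          "\<forall>Y \<in> space (data_law n \<theta>) - F. typical_data A L n \<theta> Y"
          using elim(3)[THEN spec, THEN spec, THEN spec, THEN mp, THEN mp, THEN mp, THEN mp, OF cs S] by auto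
        have "ref_tau L / C \<le> tau_hat n Y \<and> tau_hat n Y \<le> C * ref_tau L" if Y: "Y \<in> space (data_law n \<theta>) - F" for Y
        proof (rule ccontr)
          assume out: "\<not> ?thesis"
          have ty: "typical_data A L n \<theta> Y"
            using F Y by blast
          have am: "is_arg_max (marginal_likelihood n Y) (\<lambda>\<tau>. \<tau> \<in> {1 / real n..1}) (tau_hat n Y)"
            using mmle n Y unfolding is_MMLE_def space_data_law by blast
          then have T: "1 / n \<le> tau_hat n Y" "tau_hat n Y \<le> 1" by (auto simp: is_arg_max_def)
          moreover have "0 < 1 / real n" using n by simp
          ultimately have T0: "0 < tau_hat n Y" by linarith
          have "(\<Sum>i = 1..n. log_lr (tau_hat n Y) (ref_tau L) (Y i)) < 0"
            using elim(1)[rule_format, OF cs ty T0 T(2) out] .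
          then have "marginal_likelihood n Y (tau_hat n Y) < marginal_likelihood n Y (ref_tau L)"
            using T0 elim by (intro marginal_likelihood_less) auto
          moreover have "ref_tau L \<in> {1 / real n..1}" using lo elim by simp
          ultimately show False using am by (auto simp: is_arg_max_def)
        qed
        then show "\<exists>F \<in> sets (data_law n \<theta>). measure (data_law n \<theta>) F \<le> \<epsilon> / 2 \<and>
           (\<forall>Y \<in> space (data_law n \<theta>) - F. ref_tau L / C \<le> tau_hat n Y \<and> tau_hat n Y \<le> C * ref_tau L)"
          using F(1,2) by (intro bexI[of _ F]) auto
      qed
    qed
    then obtain L0 where L0: "\<And>L n \<theta> q. L0 \<le> L \<Longrightarrow> 1 \<le> n \<Longrightarrow> excessive_bias_at A Cs Cb n \<theta> q \<Longrightarrow>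
      real (num_signals A n \<theta> q) = n * exp (- L\<^sup>2) \<Longrightarrow> 1 / n \<le> ref_tau L \<Longrightarrow>
      \<exists>F \<in> sets (data_law n \<theta>). measure (data_law n \<theta>) F \<le> \<epsilon> / 2 \<and>
       (\<forall>Y \<in> space (data_law n \<theta>) - F. ref_tau L / C \<le> tau_hat n Y \<and> tau_hat n Y \<le> C * ref_tau L)"
      unfolding eventually_at_top_linorder by blast
    define L1 where "L1 = max L0 1"
    define m where "m = nat \<lceil>1 / Cs\<rceil>"
    have m: "1 / Cs \<le> real m" unfolding m_def by (rule real_nat_ceiling_ge)
    \<comment> \<open>Since the number of signals is at most p, this bounds n/k below by exp(L1^2)
      for all parameters at once.\<close>
    have "\<forall>\<^sub>F n in sequentially. real (p n) \<le> exp (- L1\<^sup>2) * real n"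
      using landau_o.smallD[OF assms(5), of "exp (- L1\<^sup>2)"] by simp
    moreover have "\<forall>\<^sub>F n in sequentially. m \<le> p n" using assms(4) by (auto simp: filterlim_at_top)
    moreover have "\<forall>\<^sub>F n in sequentially. max m 2 \<le> n" by (rule eventually_ge_at_top)
    ultimately have "\<forall>\<^sub>F n in sequentially. norm ((INF \<theta>\<in>Theta A Cs Cb n (p n). measure (data_law n \<theta>) (?good n \<theta>)) - 1) < \<epsilon>"
    proof eventually_elim
      case (elim n)
      have ne: "Theta A Cs Cb n (p n) \<noteq> {}"
        using assms m elim by (intro Theta_nonempty[where m = m]) auto
      have good: "1 - \<epsilon> / 2 \<le> measure (data_law n \<theta>) (?good n \<theta>)" if \<theta>: "\<theta> \<in> Theta A Cs Cb n (p n)" for \<theta>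
      proof -
        interpret prob_space "data_law n \<theta>" by (rule prob_space_data_law)
        have A0: "0 < A" using assms by simp
        obtain q where q: "excessive_bias_at A Cs Cb n \<theta> q" "p_tilde A Cs Cb n \<theta> = num_signals A n \<theta> q"
          "1 \<le> p_tilde A Cs Cb n \<theta>" "p_tilde A Cs Cb n \<theta> \<le> p n"
          using Theta_excessive_bias[OF A0 assms(2) \<theta>] .
        define k where "k = p_tilde A Cs Cb n \<theta>"
        define L where "L = sqrt (ln (n / k))"
        have k: "1 \<le> real k" "real k \<le> exp (- L1\<^sup>2) * n" using q elim by (auto simp: k_def)
        have n: "2 \<le> real n" using elim by simp
        have "exp (L1\<^sup>2) * k \<le> exp (L1\<^sup>2) * (exp (- L1\<^sup>2) * n)" using k by (intro mult_left_mono) auto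
        also have "\<dots> = n" by (simp add: exp_minus)
        finally have "exp (L1\<^sup>2) \<le> n / k" using k by (simp add: pos_le_divide_eq)
        then have "ln (exp (L1\<^sup>2)) \<le> ln (n / k)" by (intro ln_mono) auto
        then have ln1: "L1\<^sup>2 \<le> ln (n / k)" by simp
        then have L1L: "L1 \<le> L" unfolding L_def by (rule real_le_rsqrt)
        have "0 \<le> ln (n / k)" using ln1 zero_le_power2[of L1] by linarith
        then have "exp (- L\<^sup>2) = k / n" using k n by (simp add: L_def exp_minus)
        then have kn: "real (num_signals A n \<theta> q) = n * exp (- L\<^sup>2)" "ref_tau L = tau_rate n k"
          using n q by (auto simp: k_def ref_tau_def tau_rate_def L_def)
        have L1': "1 \<le> L" "L0 \<le> L" using L1L by (auto simp: L1_def)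
        \<comment> \<open>The reference scale thus belongs to the range of the maximisation, so a
          maximiser cannot have a smaller likelihood.\<close>
        have "1 / n \<le> ref_tau L"
        proof -
          have "1 * 1 \<le> k * L" using k L1' by (intro mult_mono) auto
          then have "1 / n \<le> k * L / n" using n by (intro divide_right_mono) auto
          then show ?thesis unfolding kn(2) tau_rate_def L_def[symmetric] by simp
        qed
        then obtain F where F: "F \<in> sets (data_law n \<theta>)" "measure (data_law n \<theta>) F \<le> \<epsilon> / 2"
          "\<forall>Y \<in> space (data_law n \<theta>) - F. ref_tau L / C \<le> tau_hat n Y \<and> tau_hat n Y \<le> C * ref_tau L"
          using L0[OF L1'(2) _ q(1) kn(1)] n by auto
        have [measurable]: "tau_hat n \<in> borel_measurable (data_law n \<theta>)"
          using mmle n unfolding is_MMLE_def measurable_cong_sets[OF sets_data_law refl] by auto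
        have meas: "?good n \<theta> \<in> sets (data_law n \<theta>)" by measurable
        have "1 - \<epsilon> / 2 \<le> measure (data_law n \<theta>) (space (data_law n \<theta>) - F)"
          using F by (simp add: prob_compl)
        also have "\<dots> \<le> measure (data_law n \<theta>) (?good n \<theta>)"
        proof (rule finite_measure_mono)
          show "space (data_law n \<theta>) - F \<subseteq> ?good n \<theta>"
          proof
            fix Y assume Y: "Y \<in> space (data_law n \<theta>) - F"
            then have "ref_tau L / C \<le> tau_hat n Y" "tau_hat n Y \<le> C * ref_tau L" using F(3) by auto
            moreover have "inverse C * tau_rate n (p_tilde A Cs Cb n \<theta>) = ref_tau L / C"
              "tau_rate n (p_tilde A Cs Cb n \<theta>) = ref_tau L" by (simp_all add: kn(2) k_def divide_inverse)
            ultimately show "Y \<in> ?good n \<theta>" using Y by simp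
          qed
        qed (rule meas)
        finally show ?thesis .
      qed
      have bdd: "bdd_below ((\<lambda>\<theta>. measure (data_law n \<theta>) (?good n \<theta>)) ` Theta A Cs Cb n (p n))"
        by (intro bdd_belowI[of _ 0]) auto
      obtain \<theta> where \<theta>: "\<theta> \<in> Theta A Cs Cb n (p n)" using ne by auto
      have "(INF \<theta>\<in>Theta A Cs Cb n (p n). measure (data_law n \<theta>) (?good n \<theta>)) \<le> measure (data_law n \<theta>) (?good n \<theta>)"
        by (rule cINF_lower[OF bdd \<theta>])
      also have "\<dots> \<le> 1" by (rule prob_space.prob_le_1[OF prob_space_data_law])
      finally have "(INF \<theta>\<in>Theta A Cs Cb n (p n). measure (data_law n \<theta>) (?good n \<theta>)) \<le> 1" .
      moreover have "1 - \<epsilon> / 2 \<le> (INF \<theta>\<in>Theta A Cs Cb n (p n). measure (data_law n \<theta>) (?good n \<theta>))"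
        using ne good by (rule cINF_greatest)
      ultimately show ?case using \<epsilon> by simp
    qed
    then show "\<exists>no. \<forall>n\<ge>no. norm ((INF \<theta>\<in>Theta A Cs Cb n (p n). measure (data_law n \<theta>) (?good n \<theta>)) - 1) < \<epsilon>"
      by (simp add: eventually_sequentially)
  qed
  with C show ?thesis by blast
qed

end
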